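(* Let $R$ be a commutative unital ring. For any globular set $X$ the triple $\big(\mathrm{C}_\bullet(X;R),\Delta,\varepsilon\big)$, where for $x\in X_n$ $$\Delta_k(x)=\begin{cases}0 & n<k\\ x\otimes x & n=k\\ t_kx\otimes x+(-1)^{(n+1)k}\,x\otimes s_kx & k<n,\end{cases}\qquad \varepsilon(x)=\begin{cases}1&n=0\\0&n>0,\end{cases}$$ is a counital cosymmetric $R$-coalgebra.
   Context: **Globular sets.** The globe category $\mathbb{G}$ has the non-negative integers as objects; its morphisms are generated by $\sigma_n,\tau_n : n\to n+1$ and $\iota_n : n\to n-1$ subject to $\tau_n\tau_{n-1}=\sigma_n\tau_{n-1}$, $\sigma_n\sigma_{n-1}=\tau_n\sigma_{n-1}$, $\iota_{n+1}\tau_n=\mathrm{id}_n$, $\iota_{n+1}\sigma_n=\mathrm{id}_n$. A (reflexive) globular set is a functor $X:\mathbb{G}^{\mathrm{op}}\to\mathrm{Set}$. Write $X_n=X(n)$, $t_n=X(\tau_n)$, $s_n=X(\sigma_n)$ (maps $X_{n+1}\to X_n$), $i_n=X(\iota_n):X_{n-1}\to X_n$. For $x\in X_n$ and $k<n$, $t_kx$ denotes $t_k r(x)$ and $s_kx$ denotes $s_k r(x)$, where $r:X_n\to X_{k+1}$ is any composite of maps $s_j,t_j$ (the result does not depend on $r$). **Chains.** $\mathrm{C}_n(X;R)=R\{X_n\}/R\{i_n(X_{n-1})\}$ (free modules; nothing is quotiented for $n=0$), with $\partial_n=t_{n-1}-s_{n-1}$. **Counital cosymmetric $R$-coalgebras.**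 All differential graded $R$-modules are homologically graded and non-negative. Let $\Sigma_2=\{1,T\}$ act on $C\otimes C$ by $T(x\otimes y)=(-1)^{|x||y|}y\otimes x$, and let $W$ be the resolution $R[\Sigma_2]\xleftarrow{1-T}R[\Sigma_2]\xleftarrow{1+T}R[\Sigma_2]\xleftarrow{1-T}\cdots$ of $R$, with generator $e_k$ in degree $k$ and $R[\Sigma_2]$-linear augmentation $\varepsilon_W:W\to R$, $\varepsilon_W(e_0)=1$. A counital cosymmetric $R$-coalgebra is a differential graded $R$-module $C$ with a chain map $\varepsilon:C\to R$ ($R$ in degree $0$) and an $R[\Sigma_2]$-linear chain map $\Delta:W\otimes C\to C\otimes C$ with $(\mathrm{id}\otimes\varepsilon)\Delta=\varepsilon_W\otimes\mathrm{id}=(\varepsilon\otimes\mathrm{id})\Delta$. Writing $\Delta_k(c)=\Delta(e_k\otimes c)$, such a $\Delta$ is the same as a family of degree-$k$ maps $\Delta_k:C\to C\otimes C$, $k\ge 0$, with $\partial\Delta_k-(-1)^k\Delta_k\partial=(1+(-1)^kT)\Delta_{k-1}$, where $\Delta_{-1}=0$, together with the counit conditions. *)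

theory Defs
  imports "HOL-Algebra.Module" "HOL-Algebra.AbelCoset"
begin

section \<open>Modules: homomorphisms, free modules, quotients, direct sums, tensor products\<close>

text \<open>
  The record of modules extends that of rings.  Its ring multiplication and unit play no role
  for a module and are left \<open>undefined\<close>.
\<close>

definition module_hom ::
  "('r, 'x) ring_scheme \<Rightarrow> ('r, 'm) module \<Rightarrow> ('r, 'n) module \<Rightarrow> ('m \<Rightarrow> 'n) set" where
  "module_hom R M N =
     {f \<in> carrier M \<rightarrow> carrier N.
        (\<forall>x\<in>carrier M. \<forall>y\<in>carrier M. f (x \<oplus>\<^bsub>M\<^esub> y) = f x \<oplus>\<^bsub>N\<^esub> f y) \<and>
        (\<forall>a\<in>carrier R. \<forall>x\<in>carrier M. f (a \<odot>\<^bsub>M\<^esub> x) = a \<odot>\<^bsub>N\<^esub> f x)}"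

text \<open>\<open>signed M n v\<close> is $(-1)^n v$.\<close>

definition signed :: "('r, 'm) module \<Rightarrow> nat \<Rightarrow> 'm \<Rightarrow> 'm" where
  "signed M n v = (if even n then v else \<ominus>\<^bsub>M\<^esub> v)"

definition self_module :: "('r, 'x) ring_scheme \<Rightarrow> ('r, 'r) module" where
  "self_module R =
     \<lparr>carrier = carrier R, mult = undefined, one = undefined,
      zero = \<zero>\<^bsub>R\<^esub>, add = (\<oplus>\<^bsub>R\<^esub>), smult = (\<otimes>\<^bsub>R\<^esub>)\<rparr>"

definition zero_module :: "('r, 'x) ring_scheme \<Rightarrow> ('r, 'r) module" where
  "zero_module R = (self_module R)\<lparr>carrier := {\<zero>\<^bsub>R\<^esub>}\<rparr>"

definition free_module :: "('r, 'x) ring_scheme \<Rightarrow> 'a set \<Rightarrow> ('r, 'a \<Rightarrow> 'r) module" where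
  "free_module R A =
     \<lparr>carrier = {f. (\<forall>a. f a \<in> carrier R) \<and> (\<forall>a. a \<notin> A \<longrightarrow> f a = \<zero>\<^bsub>R\<^esub>) \<and>
                    finite {a. f a \<noteq> \<zero>\<^bsub>R\<^esub>}},
      mult = undefined, one = undefined,
      zero = (\<lambda>a. \<zero>\<^bsub>R\<^esub>), add = (\<lambda>f g a. f a \<oplus>\<^bsub>R\<^esub> g a),
      smult = (\<lambda>r f a. r \<otimes>\<^bsub>R\<^esub> f a)\<rparr>"

definition free_gen :: "('r, 'x) ring_scheme \<Rightarrow> 'a \<Rightarrow> ('a \<Rightarrow> 'r)" where
  "free_gen R a = (\<lambda>b. if b = a then \<one>\<^bsub>R\<^esub> else \<zero>\<^bsub>R\<^esub>)"

text \<open>The linear map from a free module to \<open>P\<close> that extends \<open>\<phi>\<close> from the basis.\<close>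

definition lin_ext ::
  "('r, 'x) ring_scheme \<Rightarrow> ('r, 'p) module \<Rightarrow> ('a \<Rightarrow> 'p) \<Rightarrow> ('a \<Rightarrow> 'r) \<Rightarrow> 'p" where
  "lin_ext R P \<phi> f = finsum P (\<lambda>a. f a \<odot>\<^bsub>P\<^esub> \<phi> a) {a. f a \<noteq> \<zero>\<^bsub>R\<^esub>}"

definition quot_module :: "('r, 'm) module \<Rightarrow> 'm set \<Rightarrow> ('r, 'm set) module" where
  "quot_module M N =
     \<lparr>carrier = a_rcosets\<^bsub>M\<^esub> N, mult = undefined, one = undefined,
      zero = N, add = set_add M,
      smult = (\<lambda>r U. \<Union>u\<in>U. N +>\<^bsub>M\<^esub> (r \<odot>\<^bsub>M\<^esub> u))\<rparr>"

text \<open>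
  The map on a quotient induced by \<open>h\<close>: when \<open>h\<close> is additive and vanishes on the submodule,
  it is constant on each coset \<open>U\<close>, so \<open>h ` U\<close> is a singleton.
\<close>

definition quot_lift :: "('m \<Rightarrow> 'p) \<Rightarrow> 'm set \<Rightarrow> 'p" where
  "quot_lift h U = the_elem (h ` U)"

definition submodule_span ::
  "('r, 'x) ring_scheme \<Rightarrow> ('r, 'm) module \<Rightarrow> 'm set \<Rightarrow> 'm set" where
  "submodule_span R M S = \<Inter>{H. submodule H R M \<and> S \<subseteq> H}"

definition direct_sum ::
  "'j set \<Rightarrow> ('j \<Rightarrow> ('r, 'm) module) \<Rightarrow> ('r, 'j \<Rightarrow> 'm) module" where
  "direct_sum J M =
     \<lparr>carrier = {u \<in> (\<Pi>\<^sub>E j\<in>J. carrier (M j)). finite {j \<in> J. u j \<noteq> \<zero>\<^bsub>M j\<^esub>}},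
      mult = undefined, one = undefined,
      zero = (\<lambda>j\<in>J. \<zero>\<^bsub>M j\<^esub>), add = (\<lambda>u v. \<lambda>j\<in>J. u j \<oplus>\<^bsub>M j\<^esub> v j),
      smult = (\<lambda>r u. \<lambda>j\<in>J. r \<odot>\<^bsub>M j\<^esub> u j)\<rparr>"

definition tensor_relations ::
  "('r, 'x) ring_scheme \<Rightarrow> ('r, 'm) module \<Rightarrow> ('r, 'n) module \<Rightarrow> ('m \<times> 'n \<Rightarrow> 'r) set" where
  "tensor_relations R M N =
     (let F = free_module R (carrier M \<times> carrier N) in
       {free_gen R (x \<oplus>\<^bsub>M\<^esub> x', y) \<ominus>\<^bsub>F\<^esub> (free_gen R (x, y) \<oplus>\<^bsub>F\<^esub> free_gen R (x', y)) | x x' y.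
          x \<in> carrier M \<and> x' \<in> carrier M \<and> y \<in> carrier N} \<union>
       {free_gen R (x, y \<oplus>\<^bsub>N\<^esub> y') \<ominus>\<^bsub>F\<^esub> (free_gen R (x, y) \<oplus>\<^bsub>F\<^esub> free_gen R (x, y')) | x y y'.
          x \<in> carrier M \<and> y \<in> carrier N \<and> y' \<in> carrier N} \<union>
       {free_gen R (r \<odot>\<^bsub>M\<^esub> x, y) \<ominus>\<^bsub>F\<^esub> r \<odot>\<^bsub>F\<^esub> free_gen R (x, y) | r x y.
          r \<in> carrier R \<and> x \<in> carrier M \<and> y \<in> carrier N} \<union>
       {free_gen R (x, r \<odot>\<^bsub>N\<^esub> y) \<ominus>\<^bsub>F\<^esub> r \<odot>\<^bsub>F\<^esub> free_gen R (x, y) | r x y.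
          r \<in> carrier R \<and> x \<in> carrier M \<and> y \<in> carrier N})"

definition tensor_kernel ::
  "('r, 'x) ring_scheme \<Rightarrow> ('r, 'm) module \<Rightarrow> ('r, 'n) module \<Rightarrow> ('m \<times> 'n \<Rightarrow> 'r) set" where
  "tensor_kernel R M N =
     submodule_span R (free_module R (carrier M \<times> carrier N)) (tensor_relations R M N)"

definition tensor_module ::
  "('r, 'x) ring_scheme \<Rightarrow> ('r, 'm) module \<Rightarrow> ('r, 'n) module \<Rightarrow> ('r, ('m \<times> 'n \<Rightarrow> 'r) set) module" where
  "tensor_module R M N =
     quot_module (free_module R (carrier M \<times> carrier N)) (tensor_kernel R M N)"

definition pure_tensor ::
  "('r, 'x) ring_scheme \<Rightarrow> ('r, 'm) module \<Rightarrow> ('r, 'n) module \<Rightarrow> 'm \<Rightarrow> 'n \<Rightarrow> ('m \<times> 'n \<Rightarrow> 'r) set" where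
  "pure_tensor R M N x y =
     tensor_kernel R M N +>\<^bsub>free_module R (carrier M \<times> carrier N)\<^esub> free_gen R (x, y)"

text \<open>The linear map on a tensor product induced by a bilinear map \<open>b\<close> with values in \<open>P\<close>.\<close>

definition tensor_lift ::
  "('r, 'x) ring_scheme \<Rightarrow> ('r, 'p) module \<Rightarrow> ('m \<Rightarrow> 'n \<Rightarrow> 'p) \<Rightarrow> ('m \<times> 'n \<Rightarrow> 'r) set \<Rightarrow> 'p" where
  "tensor_lift R P b = quot_lift (lin_ext R P (\<lambda>(x, y). b x y))"


section \<open>Differential graded modules\<close>

text \<open>
  Non-negative homological grading.  The differential \<open>bd C n\<close> maps degree \<open>n\<close> to degree
  \<open>n - 1\<close> for \<open>n \<ge> 1\<close>; \<open>bd C 0\<close> is irrelevant, the differential of degree \<open>0\<close> being zero.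
\<close>

record ('r, 'm) dg_module =
  grade :: "nat \<Rightarrow> ('r, 'm) module"
  bd :: "nat \<Rightarrow> 'm \<Rightarrow> 'm"

locale dg_module =
  fixes R :: "('r, 'x) ring_scheme" and C :: "('r, 'm) dg_module"
  assumes grade_module: "\<And>n. module R (grade C n)"
    and bd_hom: "\<And>n. bd C (Suc n) \<in> module_hom R (grade C (Suc n)) (grade C n)"
    and bd_bd: "\<And>n x. x \<in> carrier (grade C (Suc (Suc n))) \<Longrightarrow>
                  bd C (Suc n) (bd C (Suc (Suc n)) x) = \<zero>\<^bsub>grade C n\<^esub>"

definition chain_map ::
  "('r, 'x) ring_scheme \<Rightarrow> ('r, 'm) dg_module \<Rightarrow> ('r, 'n) dg_module \<Rightarrow> (nat \<Rightarrow> 'm \<Rightarrow> 'n) \<Rightarrow> bool" where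
  "chain_map R C D f \<longleftrightarrow>
     (\<forall>n. f n \<in> module_hom R (grade C n) (grade D n)) \<and>
     (\<forall>n. \<forall>x\<in>carrier (grade C (Suc n)). f n (bd C (Suc n) x) = bd D (Suc n) (f (Suc n) x))"

definition ground :: "('r, 'x) ring_scheme \<Rightarrow> ('r, 'r) dg_module" where
  "ground R =
     \<lparr>grade = (\<lambda>n. if n = 0 then self_module R else zero_module R), bd = (\<lambda>_ _. \<zero>\<^bsub>R\<^esub>)\<rparr>"

subsection \<open>Tensor products\<close>

type_synonym ('r, 'm, 'n) tens = "nat \<times> nat \<Rightarrow> ('m \<times> 'n \<Rightarrow> 'r) set"

definition bidegrees :: "nat \<Rightarrow> (nat \<times> nat) set" where
  "bidegrees n = {(p, q). p + q = n}"

definition gr_tensor ::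
  "('r, 'x) ring_scheme \<Rightarrow> ('r, 'm) dg_module \<Rightarrow> ('r, 'n) dg_module \<Rightarrow> nat \<Rightarrow>
   ('r, ('r, 'm, 'n) tens) module" where
  "gr_tensor R C D n =
     direct_sum (bidegrees n) (\<lambda>(p, q). tensor_module R (grade C p) (grade D q))"

text \<open>
  \<open>htensor R C D p x q y\<close> is $x \otimes y$ for $x \in C_p$ and $y \in D_q$, as an element of
  $(C \otimes D)_{p+q}$.
\<close>

definition htensor ::
  "('r, 'x) ring_scheme \<Rightarrow> ('r, 'm) dg_module \<Rightarrow> ('r, 'n) dg_module \<Rightarrow>
   nat \<Rightarrow> 'm \<Rightarrow> nat \<Rightarrow> 'n \<Rightarrow> ('r, 'm, 'n) tens" where
  "htensor R C D p x q y =
     (\<lambda>(a, b)\<in>bidegrees (p + q).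
        if (a, b) = (p, q) then pure_tensor R (grade C p) (grade D q) x y
        else \<zero>\<^bsub>tensor_module R (grade C a) (grade D b)\<^esub>)"

text \<open>
  The linear map from $(C \otimes D)_n$ to \<open>P\<close> that sends $x \otimes y$ to \<open>b p q x y\<close> for
  $x \in C_p$ and $y \in D_q$, where $p + q = n$.
\<close>

definition gr_lift ::
  "('r, 'x) ring_scheme \<Rightarrow> ('r, 'p) module \<Rightarrow> (nat \<Rightarrow> nat \<Rightarrow> 'm \<Rightarrow> 'n \<Rightarrow> 'p) \<Rightarrow>
   nat \<Rightarrow> ('r, 'm, 'n) tens \<Rightarrow> 'p" where
  "gr_lift R P b n u = finsum P (\<lambda>(p, q). tensor_lift R P (b p q) (u (p, q))) (bidegrees n)"

text \<open>$\partial(x \otimes y) = \partial x \otimes y + (-1)^{|x|} x \otimes \partial y$\<close>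

definition tensor_bd ::
  "('r, 'x) ring_scheme \<Rightarrow> ('r, 'm) dg_module \<Rightarrow> ('r, 'n) dg_module \<Rightarrow>
   nat \<Rightarrow> ('r, 'm, 'n) tens \<Rightarrow> ('r, 'm, 'n) tens" where
  "tensor_bd R C D n =
     (let P = gr_tensor R C D (n - 1) in
      gr_lift R P
        (\<lambda>p q x y.
           (if p = 0 then \<zero>\<^bsub>P\<^esub> else htensor R C D (p - 1) (bd C p x) q y) \<oplus>\<^bsub>P\<^esub>
           signed P p (if q = 0 then \<zero>\<^bsub>P\<^esub> else htensor R C D p x (q - 1) (bd D q y)))
        n)"

definition dg_tensor ::
  "('r, 'x) ring_scheme \<Rightarrow> ('r, 'm) dg_module \<Rightarrow> ('r, 'n) dg_module \<Rightarrow>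
   ('r, ('r, 'm, 'n) tens) dg_module" where
  "dg_tensor R C D = \<lparr>grade = gr_tensor R C D, bd = tensor_bd R C D\<rparr>"

text \<open>$f \otimes g : C \otimes D \to C' \otimes D'$ for \<open>f\<close> and \<open>g\<close> of degree $0$.\<close>

definition tensor_map ::
  "('r, 'x) ring_scheme \<Rightarrow> ('r, 'm2) dg_module \<Rightarrow> ('r, 'n2) dg_module \<Rightarrow>
   (nat \<Rightarrow> 'm \<Rightarrow> 'm2) \<Rightarrow> (nat \<Rightarrow> 'n \<Rightarrow> 'n2) \<Rightarrow>
   nat \<Rightarrow> ('r, 'm, 'n) tens \<Rightarrow> ('r, 'm2, 'n2) tens" where
  "tensor_map R C' D' f g n =
     gr_lift R (gr_tensor R C' D' n) (\<lambda>p q x y. htensor R C' D' p (f p x) q (g q y)) n"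

text \<open>The canonical isomorphisms $C \otimes R \to C$ and $R \otimes C \to C$.\<close>

definition right_unitor ::
  "('r, 'x) ring_scheme \<Rightarrow> ('r, 'm) dg_module \<Rightarrow> nat \<Rightarrow> ('r, 'm, 'r) tens \<Rightarrow> 'm" where
  "right_unitor R C n =
     gr_lift R (grade C n)
       (\<lambda>p q x r. if q = 0 then r \<odot>\<^bsub>grade C n\<^esub> x else \<zero>\<^bsub>grade C n\<^esub>) n"

definition left_unitor ::
  "('r, 'x) ring_scheme \<Rightarrow> ('r, 'm) dg_module \<Rightarrow> nat \<Rightarrow> ('r, 'r, 'm) tens \<Rightarrow> 'm" where
  "left_unitor R C n =
     gr_lift R (grade C n)
       (\<lambda>p q r x. if p = 0 then r \<odot>\<^bsub>grade C n\<^esub> x else \<zero>\<^bsub>grade C n\<^esub>) n"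

text \<open>The action of the transposition on $C \otimes C$: $T(x \otimes y) = (-1)^{|x||y|} y \otimes x$.\<close>

definition transpose_tensor ::
  "('r, 'x) ring_scheme \<Rightarrow> ('r, 'm) dg_module \<Rightarrow>
   nat \<Rightarrow> ('r, 'm, 'm) tens \<Rightarrow> ('r, 'm, 'm) tens" where
  "transpose_tensor R C n =
     gr_lift R (gr_tensor R C C n)
       (\<lambda>p q x y. signed (gr_tensor R C C n) (p * q) (htensor R C C q y p x)) n"


section \<open>The resolution \<open>W\<close>\<close>

text \<open>The two elements $1$ and $T$ of $\Sigma_2$.\<close>

datatype sigma2 = Unit2 | Twist2

primrec twist :: "sigma2 \<Rightarrow> sigma2" where
  "twist Unit2 = Twist2"
| "twist Twist2 = Unit2"

text \<open>
  Every $W_k$ is the group ring $R[\Sigma_2]$, that is, the free module on $\Sigma_2$, with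
  $e_k$ the basis element $1$.  Multiplication by $T$ permutes the coefficients.
\<close>

definition W_twist :: "(sigma2 \<Rightarrow> 'r) \<Rightarrow> (sigma2 \<Rightarrow> 'r)" where
  "W_twist w = (\<lambda>g. w (twist g))"

definition W_gen :: "('r, 'x) ring_scheme \<Rightarrow> (sigma2 \<Rightarrow> 'r)" where
  "W_gen R = free_gen R Unit2"

text \<open>The differential $W_k \to W_{k-1}$ is $1 - T$ for odd $k$ and $1 + T$ for even $k$.\<close>

definition W_res :: "('r, 'x) ring_scheme \<Rightarrow> ('r, sigma2 \<Rightarrow> 'r) dg_module" where
  "W_res R =
     (let F = free_module R (UNIV :: sigma2 set) in
      \<lparr>grade = (\<lambda>_. F), bd = (\<lambda>k w. w \<oplus>\<^bsub>F\<^esub> signed F k (W_twist w))\<rparr>)"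

definition W_aug :: "('r, 'x) ring_scheme \<Rightarrow> nat \<Rightarrow> (sigma2 \<Rightarrow> 'r) \<Rightarrow> 'r" where
  "W_aug R k w = (if k = 0 then w Unit2 \<oplus>\<^bsub>R\<^esub> w Twist2 else \<zero>\<^bsub>R\<^esub>)"

text \<open>The action of $T$ on $W \otimes C$ through the first factor.\<close>

definition W_tensor_twist ::
  "('r, 'x) ring_scheme \<Rightarrow> ('r, 'm) dg_module \<Rightarrow>
   nat \<Rightarrow> ('r, sigma2 \<Rightarrow> 'r, 'm) tens \<Rightarrow> ('r, sigma2 \<Rightarrow> 'r, 'm) tens" where
  "W_tensor_twist R C = tensor_map R (W_res R) C (\<lambda>_. W_twist) (\<lambda>_ c. c)"


section \<open>Counital cosymmetric coalgebras\<close>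

text \<open>
  An $R[\Sigma_2]$-linear map is an $R$-linear map that commutes with the action of $T$.
  The counit conditions compare maps $W \otimes C \to C$, after identifying $C \otimes R$ and
  $R \otimes C$ with $C$.
\<close>

locale counital_cosymmetric_coalgebra =
  dg_module R C
  for R :: "('r, 'x) ring_scheme" and C :: "('r, 'm) dg_module" +
  fixes \<Delta> :: "nat \<Rightarrow> ('r, sigma2 \<Rightarrow> 'r, 'm) tens \<Rightarrow> ('r, 'm, 'm) tens"
    and \<epsilon> :: "nat \<Rightarrow> 'm \<Rightarrow> 'r"
  assumes counit_chain_map: "chain_map R C (ground R) \<epsilon>"
    and coproduct_chain_map: "chain_map R (dg_tensor R (W_res R) C) (dg_tensor R C C) \<Delta>"
    and coproduct_equivariant:
      "\<And>n u. u \<in> carrier (gr_tensor R (W_res R) C n) \<Longrightarrow>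
         \<Delta> n (W_tensor_twist R C n u) = transpose_tensor R C n (\<Delta> n u)"
    and right_counit:
      "\<And>n u. u \<in> carrier (gr_tensor R (W_res R) C n) \<Longrightarrow>
         right_unitor R C n (tensor_map R C (ground R) (\<lambda>_ c. c) \<epsilon> n (\<Delta> n u)) =
         left_unitor R C n (tensor_map R (ground R) C (W_aug R) (\<lambda>_ c. c) n u)"
    and left_counit:
      "\<And>n u. u \<in> carrier (gr_tensor R (W_res R) C n) \<Longrightarrow>
         left_unitor R C n (tensor_map R (ground R) C \<epsilon> (\<lambda>_ c. c) n (\<Delta> n u)) =
         left_unitor R C n (tensor_map R (ground R) C (W_aug R) (\<lambda>_ c. c) n u)"

text \<open>
  The $R[\Sigma_2]$-linear map $\Delta : W \otimes C \to C \otimes C$ with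
  $\Delta(e_k \otimes c) = \Delta_k(c)$, where \<open>\<delta> k n\<close> is the map
  $\Delta_k : C_n \to (C \otimes C)_{k+n}$.
\<close>

definition coproduct_of_family ::
  "('r, 'x) ring_scheme \<Rightarrow> ('r, 'm) dg_module \<Rightarrow> (nat \<Rightarrow> nat \<Rightarrow> 'm \<Rightarrow> ('r, 'm, 'm) tens) \<Rightarrow>
   nat \<Rightarrow> ('r, sigma2 \<Rightarrow> 'r, 'm) tens \<Rightarrow> ('r, 'm, 'm) tens" where
  "coproduct_of_family R C \<delta> n =
     (let P = gr_tensor R C C n in
      gr_lift R P
        (\<lambda>k m w c. w Unit2 \<odot>\<^bsub>P\<^esub> \<delta> k m c \<oplus>\<^bsub>P\<^esub>
                   w Twist2 \<odot>\<^bsub>P\<^esub> transpose_tensor R C n (\<delta> k m c)) n)"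


section \<open>Globular sets\<close>

text \<open>
  A reflexive globular set, given by the values of the functor on objects and on generating
  morphisms: \<open>s n\<close> and \<open>t n\<close> are the maps $X_{n+1} \to X_n$ induced by $\sigma_n$ and $\tau_n$,
  and \<open>i n\<close> (for \<open>n \<ge> 1\<close>; \<open>i 0\<close> is irrelevant) is the map $X_{n-1} \to X_n$ induced by $\iota_n$.
\<close>

locale globular_set =
  fixes X :: "nat \<Rightarrow> 'a set" and s t i :: "nat \<Rightarrow> 'a \<Rightarrow> 'a"
  assumes s_closed: "\<And>n x. x \<in> X (Suc n) \<Longrightarrow> s n x \<in> X n"
    and t_closed: "\<And>n x. x \<in> X (Suc n) \<Longrightarrow> t n x \<in> X n"
    and i_closed: "\<And>n x. x \<in> X n \<Longrightarrow> i (Suc n) x \<in> X (Suc n)"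
    and t_t: "\<And>n x. x \<in> X (Suc (Suc n)) \<Longrightarrow> t n (t (Suc n) x) = t n (s (Suc n) x)"
    and s_s: "\<And>n x. x \<in> X (Suc (Suc n)) \<Longrightarrow> s n (s (Suc n) x) = s n (t (Suc n) x)"
    and t_i: "\<And>n x. x \<in> X n \<Longrightarrow> t n (i (Suc n) x) = x"
    and s_i: "\<And>n x. x \<in> X n \<Longrightarrow> s n (i (Suc n) x) = x"

text \<open>\<open>descend f k m\<close> is the composite $f_k f_{k+1} \cdots f_{k+m-1} : X_{k+m} \to X_k$.\<close>

primrec descend :: "(nat \<Rightarrow> 'a \<Rightarrow> 'a) \<Rightarrow> nat \<Rightarrow> nat \<Rightarrow> 'a \<Rightarrow> 'a" where
  "descend f k 0 x = x"
| "descend f k (Suc m) x = descend f k m (f (k + m) x)"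

text \<open>
  The iterated source and target $s_k x$ and $t_k x$ of $x \in X_n$, for $k < n$.  The choice of
  the maps before the last one is immaterial, see \<open>iter_src_eq\<close> and \<open>iter_tgt_eq\<close> below.
\<close>

definition iter_src :: "(nat \<Rightarrow> 'a \<Rightarrow> 'a) \<Rightarrow> nat \<Rightarrow> nat \<Rightarrow> 'a \<Rightarrow> 'a" where
  "iter_src s k n x = s k (descend s (Suc k) (n - Suc k) x)"

definition iter_tgt :: "(nat \<Rightarrow> 'a \<Rightarrow> 'a) \<Rightarrow> nat \<Rightarrow> nat \<Rightarrow> 'a \<Rightarrow> 'a" where
  "iter_tgt t k n x = t k (descend t (Suc k) (n - Suc k) x)"

lemma descend_Suc_left: "descend f k (Suc m) x = f k (descend f (Suc k) m x)"
  by (induction m arbitrary: x) simp_all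

context globular_set
begin

lemma descend_closed:
  assumes "\<And>j y. f j y \<in> {s j y, t j y}" and "x \<in> X (k + m)"
  shows "descend f k m x \<in> X k"
  using assms(2)
proof (induction m arbitrary: x)
  case (Suc m)
  then have "f (k + m) x \<in> X (k + m)"
    using assms(1)[of "k + m" x] s_closed[of x "k + m"] t_closed[of x "k + m"] by auto
  then show ?case
    using Suc.IH by simp
qed simp

lemma iter_eq_aux:
  assumes f: "\<And>j y. f j y \<in> {s j y, t j y}" and "x \<in> X (Suc k + m)"
  shows "s k (descend f (Suc k) m x) = s k (descend s (Suc k) m x) \<and>
         t k (descend f (Suc k) m x) = t k (descend t (Suc k) m x)"
  using assms(2)
proof (induction m arbitrary: k)
  case (Suc m)
  let ?z = "descend f (Suc (Suc k)) m x"
  have x: "x \<in> X (Suc (Suc k) + m)"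
    using Suc.prems by simp
  have "?z \<in> X (Suc (Suc k))"
    using descend_closed[of f, OF f x] .
  then have "s k (f (Suc k) ?z) = s k (s (Suc k) ?z)" "t k (f (Suc k) ?z) = t k (t (Suc k) ?z)"
    using f[of "Suc k" ?z] s_s t_t by auto
  then show ?case
    using Suc.IH[OF x] by (simp add: descend_Suc_left del: descend.simps(2))
qed simp

lemma iter_src_eq:
  assumes "\<And>j y. f j y \<in> {s j y, t j y}" and "x \<in> X n" and "k < n"
  shows "s k (descend f (Suc k) (n - Suc k) x) = iter_src s k n x"
  unfolding iter_src_def using iter_eq_aux[of f x k "n - Suc k"] assms by simp

lemma iter_tgt_eq:
  assumes "\<And>j y. f j y \<in> {s j y, t j y}" and "x \<in> X n" and "k < n"
  shows "t k (descend f (Suc k) (n - Suc k) x) = iter_tgt t k n x"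
  unfolding iter_tgt_def using iter_eq_aux[of f x k "n - Suc k"] assms by simp

end


section \<open>Chains of a globular set\<close>

definition degenerate :: "(nat \<Rightarrow> 'a set) \<Rightarrow> (nat \<Rightarrow> 'a \<Rightarrow> 'a) \<Rightarrow> nat \<Rightarrow> 'a set" where
  "degenerate X i n = (if n = 0 then {} else i n ` X (n - 1))"

definition chain_group ::
  "('r, 'x) ring_scheme \<Rightarrow> (nat \<Rightarrow> 'a set) \<Rightarrow> (nat \<Rightarrow> 'a \<Rightarrow> 'a) \<Rightarrow> nat \<Rightarrow> ('r, ('a \<Rightarrow> 'r) set) module" where
  "chain_group R X i n =
     quot_module (free_module R (X n)) (carrier (free_module R (degenerate X i n)))"

text \<open>The class in $C_n(X; R)$ of the basis element \<open>x\<close> of $R\{X_n\}$.\<close>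

definition cell ::
  "('r, 'x) ring_scheme \<Rightarrow> (nat \<Rightarrow> 'a set) \<Rightarrow> (nat \<Rightarrow> 'a \<Rightarrow> 'a) \<Rightarrow> nat \<Rightarrow> 'a \<Rightarrow> ('a \<Rightarrow> 'r) set" where
  "cell R X i n x =
     carrier (free_module R (degenerate X i n)) +>\<^bsub>free_module R (X n)\<^esub> free_gen R x"

definition globular_chains ::
  "('r, 'x) ring_scheme \<Rightarrow> (nat \<Rightarrow> 'a set) \<Rightarrow> (nat \<Rightarrow> 'a \<Rightarrow> 'a) \<Rightarrow> (nat \<Rightarrow> 'a \<Rightarrow> 'a) \<Rightarrow>
   (nat \<Rightarrow> 'a \<Rightarrow> 'a) \<Rightarrow> ('r, ('a \<Rightarrow> 'r) set) dg_module" where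
  "globular_chains R X s t i =
     \<lparr>grade = chain_group R X i,
      bd = (\<lambda>n. let P = chain_group R X i (n - 1) in
        quot_lift (lin_ext R P
          (\<lambda>x. cell R X i (n - 1) (t (n - 1) x) \<ominus>\<^bsub>P\<^esub> cell R X i (n - 1) (s (n - 1) x))))\<rparr>"

definition globular_counit ::
  "('r, 'x) ring_scheme \<Rightarrow> nat \<Rightarrow> ('a \<Rightarrow> 'r) set \<Rightarrow> 'r" where
  "globular_counit R n =
     quot_lift (lin_ext R (self_module R) (\<lambda>x. if n = 0 then \<one>\<^bsub>R\<^esub> else \<zero>\<^bsub>R\<^esub>))"

text \<open>The value of $\Delta_k$ on $x \in X_n$.\<close>

definition globular_coproduct_on_cell ::
  "('r, 'x) ring_scheme \<Rightarrow> (nat \<Rightarrow> 'a set) \<Rightarrow> (nat \<Rightarrow> 'a \<Rightarrow> 'a) \<Rightarrow> (nat \<Rightarrow> 'a \<Rightarrow> 'a) \<Rightarrow>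
   (nat \<Rightarrow> 'a \<Rightarrow> 'a) \<Rightarrow> nat \<Rightarrow> nat \<Rightarrow> 'a \<Rightarrow> ('r, ('a \<Rightarrow> 'r) set, ('a \<Rightarrow> 'r) set) tens" where
  "globular_coproduct_on_cell R X s t i k n x =
     (let C = globular_chains R X s t i; P = gr_tensor R C C (k + n); c = cell R X i in
      if n < k then \<zero>\<^bsub>P\<^esub>
      else if n = k then htensor R C C n (c n x) n (c n x)
      else htensor R C C k (c k (iter_tgt t k n x)) n (c n x) \<oplus>\<^bsub>P\<^esub>
           signed P ((n + 1) * k) (htensor R C C n (c n x) k (c k (iter_src s k n x))))"

text \<open>The linear extension $\Delta_k : C_n \to (C \otimes C)_{k+n}$, and the resulting $\Delta$.\<close>

definition globular_coproduct_family ::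
  "('r, 'x) ring_scheme \<Rightarrow> (nat \<Rightarrow> 'a set) \<Rightarrow> (nat \<Rightarrow> 'a \<Rightarrow> 'a) \<Rightarrow> (nat \<Rightarrow> 'a \<Rightarrow> 'a) \<Rightarrow>
   (nat \<Rightarrow> 'a \<Rightarrow> 'a) \<Rightarrow> nat \<Rightarrow> nat \<Rightarrow> ('a \<Rightarrow> 'r) set \<Rightarrow>
   ('r, ('a \<Rightarrow> 'r) set, ('a \<Rightarrow> 'r) set) tens" where
  "globular_coproduct_family R X s t i k n =
     (let C = globular_chains R X s t i in
      quot_lift (lin_ext R (gr_tensor R C C (k + n)) (globular_coproduct_on_cell R X s t i k n)))"

definition globular_coproduct ::
  "('r, 'x) ring_scheme \<Rightarrow> (nat \<Rightarrow> 'a set) \<Rightarrow> (nat \<Rightarrow> 'a \<Rightarrow> 'a) \<Rightarrow> (nat \<Rightarrow> 'a \<Rightarrow> 'a) \<Rightarrow>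
   (nat \<Rightarrow> 'a \<Rightarrow> 'a) \<Rightarrow> nat \<Rightarrow> ('r, sigma2 \<Rightarrow> 'r, ('a \<Rightarrow> 'r) set) tens \<Rightarrow>
   ('r, ('a \<Rightarrow> 'r) set, ('a \<Rightarrow> 'r) set) tens" where
  "globular_coproduct R X s t i =
     coproduct_of_family R (globular_chains R X s t i) (globular_coproduct_family R X s t i)"

end

theory Submission
  imports Defs
begin

text \<open>
  All maps in sight are $R$-linear, chain modules are generated by cells, $W$ by the elements
  $e_k$ and $T e_k$, and tensor products by pure tensors.  Every axiom of a coalgebra therefore
  becomes an identity between values on generators.

  For any differential graded module, the $R[\Sigma_2]$-linear map $\Delta$ built from a family
  $\Delta_k$ is a chain map as soon as the cosymmetry relation
  $\partial\Delta_k - (-1)^k\Delta_k\partial = (1 + (-1)^k T)\Delta_{k-1}$ holds: on $e_k \otimes c$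
  the two statements are the same, and $T e_k \otimes c$ follows because $T$ is an involution that
  commutes with the boundary of $C \otimes C$.  This reduction is the locale
  \<open>coproduct_family\<close>, with the conclusion \<open>coalgebra\<close>.

  For a globular set, $\Delta_k$ descends to the quotient by degenerate cells because every
  tensor in $\Delta_k(x)$ has $x$ itself as a factor.  The cosymmetry relation on an $n$-cell $x$
  is \<open>bd_on_cell\<close>.  Suppose $k < n$.  The terms of $\partial\Delta_k(x)$ in which the boundary
  falls on $x$ make up $(-1)^k\Delta_k(\partial x)$, since $t_k$ and $s_k$ do not distinguish the
  source and the target of $x$; for $k = n - 1$ this needs the cancellation
  $t x \otimes (t x - s x) + (t x - s x) \otimes s x = t x \otimes t x - s x \otimes s x$.  The
  boundary of $t_k x$, as well as that of $s_k x$, is $t_{k-1} x - s_{k-1} x$ by globularity, and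
  the four remaining terms are those of $(1 + (-1)^k T)\Delta_{k-1}(x)$.  For $k = n$ the
  boundary of $x \otimes x$ is $(1 + (-1)^n T)\Delta_{n-1}(x)$, and for $k = n + 1$ the right hand
  side is $(1 + (-1)^{n+1} T)(x \otimes x) = 0$, as $T(x \otimes x) = (-1)^n x \otimes x$.

  The counit annihilates cells of positive dimension, so the counit conditions only see the terms
  of $\Delta_k(x)$ with a factor of dimension $0$.  There are none for $k > 0$, and for $k = 0$
  exactly one of them contributes $x$ on each side.
\<close>

section \<open>Linear maps\<close>

text \<open>
  After sorting with \<open>a_ac\<close>, an element and its negative can be separated by another summand.
  These rules cancel the two all the same.
\<close>

context abelian_group
begin

lemma a_cancel_0:
  "x \<in> carrier G \<Longrightarrow> x \<oplus> \<ominus> x = \<zero>"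
  "\<lbrakk>x \<in> carrier G; y \<in> carrier G\<rbrakk> \<Longrightarrow> x \<oplus> (\<ominus> x \<oplus> y) = y"
  by (simp_all add: r_neg a_assoc[symmetric])

lemma a_cancel_1:
  "\<lbrakk>x \<in> carrier G; y \<in> carrier G\<rbrakk> \<Longrightarrow> x \<oplus> (y \<oplus> \<ominus> x) = y"
  "\<lbrakk>x \<in> carrier G; y \<in> carrier G; z \<in> carrier G\<rbrakk> \<Longrightarrow> x \<oplus> (y \<oplus> (\<ominus> x \<oplus> z)) = y \<oplus> z"
  by (simp_all add: a_lcomm[of y] a_comm[of y "\<ominus> x"] a_cancel_0)

lemmas a_cancel = a_cancel_0 a_cancel_1

end

lemma module_homI:
  assumes "\<And>x. x \<in> carrier M \<Longrightarrow> f x \<in> carrier N"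
    and "\<And>x y. \<lbrakk>x \<in> carrier M; y \<in> carrier M\<rbrakk> \<Longrightarrow> f (x \<oplus>\<^bsub>M\<^esub> y) = f x \<oplus>\<^bsub>N\<^esub> f y"
    and "\<And>a x. \<lbrakk>a \<in> carrier R; x \<in> carrier M\<rbrakk> \<Longrightarrow> f (a \<odot>\<^bsub>M\<^esub> x) = a \<odot>\<^bsub>N\<^esub> f x"
  shows "f \<in> module_hom R M N"
  using assms unfolding module_hom_def by auto

lemma module_hom_closed: "\<lbrakk>f \<in> module_hom R M N; x \<in> carrier M\<rbrakk> \<Longrightarrow> f x \<in> carrier N"
  unfolding module_hom_def by auto

lemma module_hom_add:
  "\<lbrakk>f \<in> module_hom R M N; x \<in> carrier M; y \<in> carrier M\<rbrakk> \<Longrightarrow> f (x \<oplus>\<^bsub>M\<^esub> y) = f x \<oplus>\<^bsub>N\<^esub> f y"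
  unfolding module_hom_def by auto

lemma module_hom_smult:
  "\<lbrakk>f \<in> module_hom R M N; a \<in> carrier R; x \<in> carrier M\<rbrakk> \<Longrightarrow> f (a \<odot>\<^bsub>M\<^esub> x) = a \<odot>\<^bsub>N\<^esub> f x"
  unfolding module_hom_def by auto

lemma module_abelian: "module R M \<Longrightarrow> abelian_group M"
  by (rule module.axioms)

lemma module_hom_zero:
  assumes "module R M" "module R N" "f \<in> module_hom R M N"
  shows "f \<zero>\<^bsub>M\<^esub> = \<zero>\<^bsub>N\<^esub>"
proof -
  interpret M: module R M by fact
  interpret N: module R N by fact
  have "f \<zero>\<^bsub>M\<^esub> = f (\<zero>\<^bsub>R\<^esub> \<odot>\<^bsub>M\<^esub> \<zero>\<^bsub>M\<^esub>)"
    by simp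
  also have "\<dots> = \<zero>\<^bsub>R\<^esub> \<odot>\<^bsub>N\<^esub> f \<zero>\<^bsub>M\<^esub>"
    using module_hom_smult[OF assms(3) M.R.zero_closed M.M.zero_closed] .
  also have "\<dots> = \<zero>\<^bsub>N\<^esub>"
    using module_hom_closed[OF assms(3)] by simp
  finally show ?thesis .
qed

lemma module_hom_neg:
  assumes "module R M" "module R N" "f \<in> module_hom R M N" "x \<in> carrier M"
  shows "f (\<ominus>\<^bsub>M\<^esub> x) = \<ominus>\<^bsub>N\<^esub> f x"
proof -
  interpret M: module R M by fact
  interpret N: module R N by fact
  have "f x \<oplus>\<^bsub>N\<^esub> f (\<ominus>\<^bsub>M\<^esub> x) = \<zero>\<^bsub>N\<^esub>"
    using module_hom_add[OF assms(3), of x "\<ominus>\<^bsub>M\<^esub> x"] module_hom_zero[OF assms(1-3)] assms(4)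
    by (simp add: M.M.r_neg)
  then show ?thesis
    using module_hom_closed[OF assms(3)] assms(4)
    by (metis M.M.a_inv_closed N.M.minus_equality N.M.a_comm)
qed

lemma module_hom_minus:
  assumes "module R M" "module R N" "f \<in> module_hom R M N" "x \<in> carrier M" "y \<in> carrier M"
  shows "f (x \<ominus>\<^bsub>M\<^esub> y) = f x \<ominus>\<^bsub>N\<^esub> f y"
proof -
  interpret M: module R M by fact
  show ?thesis
    using assms(4,5) unfolding a_minus_def
    by (simp add: module_hom_add[OF assms(3)] module_hom_neg[OF assms(1-3)])
qed

lemma module_hom_signed:
  assumes "module R M" "module R N" "f \<in> module_hom R M N" "x \<in> carrier M"
  shows "f (signed M n x) = signed N n (f x)"
  using module_hom_neg[OF assms] by (simp add: signed_def)

lemma module_hom_id: "(\<lambda>x. x) \<in> module_hom R M M"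
  by (rule module_homI) auto

lemma module_hom_comp:
  assumes "f \<in> module_hom R M N" "g \<in> module_hom R N P"
  shows "(\<lambda>x. g (f x)) \<in> module_hom R M P"
  using assms unfolding module_hom_def by (auto simp: Pi_def)

lemma module_hom_cong:
  assumes "f \<in> module_hom R M N" "module R M" "\<And>x. x \<in> carrier M \<Longrightarrow> g x = f x"
  shows "g \<in> module_hom R M N"
proof -
  interpret M: module R M by fact
  show ?thesis
    by (rule module_homI)
      (simp_all add: assms(3) module_hom_closed[OF assms(1)] module_hom_add[OF assms(1)]
        module_hom_smult[OF assms(1)])
qed

lemma module_hom_plus:
  assumes "f \<in> module_hom R M N" "g \<in> module_hom R M N" "module R N"
  shows "(\<lambda>x. f x \<oplus>\<^bsub>N\<^esub> g x) \<in> module_hom R M N"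
proof -
  interpret N: module R N by fact
  note [simp] = module_hom_closed[OF assms(1)] module_hom_closed[OF assms(2)]
    module_hom_add[OF assms(1)] module_hom_add[OF assms(2)]
    module_hom_smult[OF assms(1)] module_hom_smult[OF assms(2)]
  show ?thesis
    by (rule module_homI) (simp_all add: N.M.a_ac N.smult_r_distr)
qed

lemma module_hom_const_zero:
  assumes "module R N"
  shows "(\<lambda>x. \<zero>\<^bsub>N\<^esub>) \<in> module_hom R M N"
proof -
  interpret N: module R N by fact
  show ?thesis by (rule module_homI) simp_all
qed

lemma module_hom_scale:
  assumes "f \<in> module_hom R M N" "module R N" "a \<in> carrier R"
  shows "(\<lambda>x. a \<odot>\<^bsub>N\<^esub> f x) \<in> module_hom R M N"
proof -
  interpret N: module R N by fact
  have "a \<odot>\<^bsub>N\<^esub> (b \<odot>\<^bsub>N\<^esub> y) = b \<odot>\<^bsub>N\<^esub> (a \<odot>\<^bsub>N\<^esub> y)" if "b \<in> carrier R" "y \<in> carrier N" for b y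
    using that assms(3) N.smult_assoc1[symmetric] by (simp add: N.R.m_comm)
  then show ?thesis
    using assms(3)
    by (intro module_homI)
      (simp_all add: module_hom_closed[OF assms(1)] module_hom_add[OF assms(1)]
        module_hom_smult[OF assms(1)] N.smult_r_distr)
qed

lemma module_hom_uminus:
  assumes "f \<in> module_hom R M N" "module R N"
  shows "(\<lambda>x. \<ominus>\<^bsub>N\<^esub> f x) \<in> module_hom R M N"
proof -
  interpret N: module R N by fact
  show ?thesis
    by (intro module_homI)
      (simp_all add: module_hom_closed[OF assms(1)] module_hom_add[OF assms(1)]
        module_hom_smult[OF assms(1)] N.smult_r_minus N.M.minus_add)
qed

lemma module_hom_signed_comp:
  assumes "f \<in> module_hom R M N" "module R N"
  shows "(\<lambda>x. signed N n (f x)) \<in> module_hom R M N"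
  using module_hom_uminus[OF assms] assms(1) by (cases "even n") (simp_all add: signed_def)

lemma module_hom_if:
  assumes "c \<Longrightarrow> f \<in> module_hom R M N" "\<not> c \<Longrightarrow> g \<in> module_hom R M N"
  shows "(\<lambda>x. if c then f x else g x) \<in> module_hom R M N"
  using assms by (cases c) simp_all

lemma module_hom_smult_right:
  assumes "f \<in> module_hom R M (self_module R)" "module R N" "v \<in> carrier N"
  shows "(\<lambda>x. f x \<odot>\<^bsub>N\<^esub> v) \<in> module_hom R M N"
proof -
  interpret N: module R N by fact
  show ?thesis
    using module_hom_closed[OF assms(1)] module_hom_add[OF assms(1)]
        module_hom_smult[OF assms(1)] assms(3)
    by (intro module_homI) (simp_all add: N.smult_l_distr N.smult_assoc1 self_module_def)
qed

lemma module_hom_finsum: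
  assumes "finite J" "\<And>j. j \<in> J \<Longrightarrow> f j \<in> module_hom R M N" "module R N"
  shows "(\<lambda>x. finsum N (\<lambda>j. f j x) J) \<in> module_hom R M N"
proof -
  interpret N: module R N by fact
  have *: "(\<lambda>j. f j x) \<in> J \<rightarrow> carrier N" if "x \<in> carrier M" for x
    using assms(2) that by (auto intro: module_hom_closed)
  show ?thesis
  proof (rule module_homI)
    fix x assume x: "x \<in> carrier M"
    show "finsum N (\<lambda>j. f j x) J \<in> carrier N"
      using *[OF x] by (rule N.M.finsum_closed)
    show "finsum N (\<lambda>j. f j (x \<oplus>\<^bsub>M\<^esub> y)) J = finsum N (\<lambda>j. f j x) J \<oplus>\<^bsub>N\<^esub> finsum N (\<lambda>j. f j y) J"
      if y: "y \<in> carrier M" for y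
      unfolding N.M.finsum_addf[OF *[OF x] *[OF y], symmetric]
      using *[OF x] *[OF y] module_hom_add[OF assms(2) x y]
      by (intro N.M.finsum_cong') auto
    show "finsum N (\<lambda>j. f j (a \<odot>\<^bsub>M\<^esub> x)) J = a \<odot>\<^bsub>N\<^esub> finsum N (\<lambda>j. f j x) J"
      if a: "a \<in> carrier R" for a
      unfolding N.finsum_smult_ldistr[OF assms(1) a *[OF x]]
      using *[OF x] a module_hom_smult[OF assms(2) a x]
      by (intro N.M.finsum_cong') auto
  qed
qed

lemma module_hom_image_finsum:
  assumes "module R M" "module R N" "f \<in> module_hom R M N" "finite J" "g \<in> J \<rightarrow> carrier M"
  shows "f (finsum M g J) = finsum N (\<lambda>j. f (g j)) J"
  using assms(4,5)
proof (induction J rule: finite_induct)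
  interpret M: module R M by fact
  interpret N: module R N by fact
  {
    case empty
    then show ?case by (simp add: module_hom_zero[OF assms(1-3)])
  next
    case (insert j J)
    then show ?case
      using module_hom_closed[OF assms(3)]
      by (simp add: module_hom_add[OF assms(3)] Pi_def)
  }
qed

lemma signed_closed: "\<lbrakk>module R M; x \<in> carrier M\<rbrakk> \<Longrightarrow> signed M n x \<in> carrier M"
  using abelian_group.a_inv_closed[OF module_abelian] by (auto simp: signed_def)

lemma signed_zero: "module R M \<Longrightarrow> signed M n \<zero>\<^bsub>M\<^esub> = \<zero>\<^bsub>M\<^esub>"
  using abelian_group.minus_equality[OF module_abelian, of R M "\<zero>\<^bsub>M\<^esub>" "\<zero>\<^bsub>M\<^esub>"]
    abelian_monoid.zero_closed[OF abelian_group.axioms(1)[OF module_abelian], of R M]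
    abelian_monoid.l_zero[OF abelian_group.axioms(1)[OF module_abelian], of R M]
  by (auto simp: signed_def)

lemma signed_signed:
  "\<lbrakk>module R M; x \<in> carrier M\<rbrakk> \<Longrightarrow> signed M m (signed M n x) = signed M (m + n) x"
  using abelian_group.minus_minus[OF module_abelian] by (auto simp: signed_def)

lemma signed_parity: "even m = even n \<Longrightarrow> signed M m x = signed M n x"
  by (simp add: signed_def)

lemma signed_plus:
  "\<lbrakk>module R M; x \<in> carrier M; y \<in> carrier M\<rbrakk> \<Longrightarrow>
    signed M n (x \<oplus>\<^bsub>M\<^esub> y) = signed M n x \<oplus>\<^bsub>M\<^esub> signed M n y"
  using abelian_group.minus_add[OF module_abelian, of R M x y] by (simp add: signed_def)

section \<open>Generating sets\<close>

lemma submodule_span_least: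
  "submodule H R M \<Longrightarrow> S \<subseteq> H \<Longrightarrow> submodule_span R M S \<subseteq> H"
  unfolding submodule_span_def by blast

lemma submodule_span_superset: "S \<subseteq> submodule_span R M S"
  unfolding submodule_span_def by blast

lemma submodule_span_subset:
  assumes "module R M" "S \<subseteq> carrier M"
  shows "submodule_span R M S \<subseteq> carrier M"
  using submodule_span_least[OF module.carrier_is_submodule[OF assms(1)] assms(2)] .

lemma submodule_span_submodule:
  assumes "module R M" "S \<subseteq> carrier M"
  shows "submodule (submodule_span R M S) R M"
proof -
  interpret M: module R M by fact
  note E = M.submoduleE
  have z: "\<zero>\<^bsub>M\<^esub> \<in> H" if "submodule H R M" for H
    using subgroup.one_closed[OF submodule.axioms(1)[OF that]] by simp
  show ?thesis
  proof (rule M.submoduleI)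
    show "submodule_span R M S \<subseteq> carrier M"
      using submodule_span_subset[OF assms] .
  qed (auto simp: submodule_span_def z E(3-5))
qed

lemma module_hom_equalizer:
  assumes "module R M" "module R N" "f \<in> module_hom R M N" "g \<in> module_hom R M N"
  shows "submodule {x \<in> carrier M. f x = g x} R M"
proof -
  interpret M: module R M by fact
  note l = module_hom_zero module_hom_neg 
  note [simp] = l[OF assms(1,2,3)] l[OF assms(1,2,4)]
   module_hom_add[OF assms(3)]  module_hom_add[OF assms(4)]
   module_hom_smult[OF assms(3)]  module_hom_smult[OF assms(4)]
  show ?thesis by (rule M.submoduleI) auto
qed

text \<open>
  The points where two linear maps agree form a submodule, which contains the span of any set on
  which they agree.  Every identity between maps below is reduced to generators in this way.
\<close>

lemma module_hom_eq_on_generators: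
  assumes "module R M" "module R N" "f \<in> module_hom R M N" "g \<in> module_hom R M N"
    and "submodule_span R M S = carrier M"
    and "\<And>x. x \<in> S \<Longrightarrow> f x = g x"
    and "x \<in> carrier M"
  shows "f x = g x"
proof -
  have "S \<subseteq> carrier M"
    using submodule_span_superset[of S R M] assms(5) by simp
  then have "carrier M \<subseteq> {x \<in> carrier M. f x = g x}"
    using submodule_span_least[OF module_hom_equalizer[OF assms(1-4)], of S] assms(5,6) by auto
  with assms(7) show ?thesis by auto
qed

lemma module_hom_preimage:
  assumes "module R M" "module R N" "f \<in> module_hom R M N" "submodule H R N"
  shows "submodule {x \<in> carrier M. f x \<in> H} R M"
proof -
  interpret M: module R M by fact
  interpret N: module R N by fact
  have "\<zero>\<^bsub>N\<^esub> \<in> H"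
    using subgroup.one_closed[OF submodule.axioms(1)[OF assms(4)]] by simp
  then show ?thesis
    using N.submoduleE(3-5)[OF assms(4)]
    by (intro M.submoduleI) (auto simp: module_hom_zero[OF assms(1-3)] module_hom_neg[OF assms(1-3)]
       module_hom_add[OF assms(3)] module_hom_smult[OF assms(3)])
qed

text \<open>
  If a submodule contains the image of \<open>S\<close>, its preimage contains the span of \<open>S\<close>, which is
  everything.
\<close>

lemma span_image_surj:
  assumes "module R M" "module R N" "f \<in> module_hom R M N" "carrier N \<subseteq> f ` carrier M"
    and S: "submodule_span R M S = carrier M"
  shows "submodule_span R N (f ` S) = carrier N"
proof -
  have SM: "S \<subseteq> carrier M"
    using submodule_span_superset[of S R M] S by simp
  then have "f ` S \<subseteq> carrier N"
    using module_hom_closed[OF assms(3)] by auto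
  moreover have "carrier N \<subseteq> H" if H: "submodule H R N" "f ` S \<subseteq> H" for H
    using submodule_span_least[OF module_hom_preimage[OF assms(1-3) H(1)], of S] SM S H(2) assms(4)
    by fastforce
  ultimately show ?thesis
    using submodule_span_subset[OF assms(2)] unfolding submodule_span_def[of R N] by blast
qed

section \<open>Bilinear maps\<close>

text \<open>
  Both conditions are phrased through \<open>module_hom\<close>, so that closure properties and equality
  principles for linear maps apply in each variable.
\<close>

definition bilinear ::
  "('r, 'x) ring_scheme \<Rightarrow> ('r, 'm) module \<Rightarrow> ('r, 'n) module \<Rightarrow> ('r, 'p) module \<Rightarrow>
   ('m \<Rightarrow> 'n \<Rightarrow> 'p) \<Rightarrow> bool" where
  "bilinear R M N P b \<longleftrightarrow>
     (\<forall>x\<in>carrier M. b x \<in> module_hom R N P) \<and>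
     (\<forall>y\<in>carrier N. (\<lambda>x. b x y) \<in> module_hom R M P)"

lemma bilinear_left: "\<lbrakk>bilinear R M N P b; y \<in> carrier N\<rbrakk> \<Longrightarrow> (\<lambda>x. b x y) \<in> module_hom R M P"
  by (simp add: bilinear_def)

lemma bilinear_right: "\<lbrakk>bilinear R M N P b; x \<in> carrier M\<rbrakk> \<Longrightarrow> (\<lambda>y. b x y) \<in> module_hom R N P"
  by (simp add: bilinear_def)

lemma bilinear_comp:
  assumes "bilinear R M N P b" "f \<in> module_hom R M' M" "g \<in> module_hom R N' N"
    "h \<in> module_hom R P P'"
  shows "bilinear R M' N' P' (\<lambda>x y. h (b (f x) (g y)))"
  unfolding bilinear_def
proof safe
  fix x assume "x \<in> carrier M'"
  then have "b (f x) \<in> module_hom R N P"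
    using bilinear_right[OF assms(1)] module_hom_closed[OF assms(2)] by simp
  then show "(\<lambda>y. h (b (f x) (g y))) \<in> module_hom R N' P'"
    using module_hom_comp[OF module_hom_comp[OF assms(3)] assms(4)] by blast
next
  fix y assume "y \<in> carrier N'"
  then have "(\<lambda>x. b x (g y)) \<in> module_hom R M P"
    using bilinear_left[OF assms(1)] module_hom_closed[OF assms(3)] by simp
  then show "(\<lambda>x. h (b (f x) (g y))) \<in> module_hom R M' P'"
    using module_hom_comp[OF module_hom_comp[OF assms(2)] assms(4)] by blast
qed

lemma bilinear_plus:
  assumes "bilinear R M N P b" "bilinear R M N P c" "module R P"
  shows "bilinear R M N P (\<lambda>x y. b x y \<oplus>\<^bsub>P\<^esub> c x y)"
  using assms unfolding bilinear_def by (auto intro!: module_hom_plus)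

lemma bilinear_signed:
  assumes "bilinear R M N P b" "module R P"
  shows "bilinear R M N P (\<lambda>x y. signed P n (b x y))"
  using assms unfolding bilinear_def by (auto intro!: module_hom_signed_comp)

lemma bilinear_if:
  assumes "c \<Longrightarrow> bilinear R M N P f" "\<not> c \<Longrightarrow> bilinear R M N P g"
  shows "bilinear R M N P (\<lambda>x y. if c then f x y else g x y)"
  using assms by (cases c) simp_all

lemma bilinear_zero: "module R P \<Longrightarrow> bilinear R M N P (\<lambda>x y. \<zero>\<^bsub>P\<^esub>)"
  unfolding bilinear_def by (auto intro!: module_hom_const_zero)

lemma bilinear_swap: "bilinear R M N P b \<Longrightarrow> bilinear R N M P (\<lambda>y x. b x y)"
  unfolding bilinear_def by auto

lemma bilinear_zero_left:
  assumes "bilinear R M N P b" "module R M" "module R P" "y \<in> carrier N"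
  shows "b \<zero>\<^bsub>M\<^esub> y = \<zero>\<^bsub>P\<^esub>"
  using module_hom_zero[OF assms(2,3) bilinear_left[OF assms(1,4)]] .

lemma bilinear_zero_right:
  assumes "bilinear R M N P b" "module R N" "module R P" "x \<in> carrier M"
  shows "b x \<zero>\<^bsub>N\<^esub> = \<zero>\<^bsub>P\<^esub>"
  using module_hom_zero[OF assms(2,3) bilinear_right[OF assms(1,4)]] .

section \<open>Free modules, quotients and tensor products\<close>

lemma module_self:
  assumes "cring R"
  shows "module R (self_module R)"
proof -
  interpret cring R by fact
  show ?thesis
    by (rule moduleI)
      (auto simp: self_module_def assms l_distr r_distr m_assoc a_ac r_neg
        intro!: abelian_groupI bexI[of _ "\<ominus>\<^bsub>R\<^esub> x" for x])
qed

lemma free_module_carrier: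
  "f \<in> carrier (free_module R A) \<longleftrightarrow>
     (\<forall>a. f a \<in> carrier R) \<and> {a. f a \<noteq> \<zero>\<^bsub>R\<^esub>} \<subseteq> A \<and> finite {a. f a \<noteq> \<zero>\<^bsub>R\<^esub>}"
  by (auto simp: free_module_def)

lemma free_module_ops [simp]:
  "f \<oplus>\<^bsub>free_module R A\<^esub> g = (\<lambda>a. f a \<oplus>\<^bsub>R\<^esub> g a)"
  "r \<odot>\<^bsub>free_module R A\<^esub> f = (\<lambda>a. r \<otimes>\<^bsub>R\<^esub> f a)"
  "\<zero>\<^bsub>free_module R A\<^esub> = (\<lambda>a. \<zero>\<^bsub>R\<^esub>)"
  by (simp_all add: free_module_def)

lemma module_free:
  assumes "cring R"
  shows "module R (free_module R A)"
proof -
  interpret cring R by fact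
  let ?F = "free_module R A"
  note c = free_module_carrier
  have supp: "finite {a. f a \<noteq> \<zero>\<^bsub>R\<^esub>} \<Longrightarrow> finite {a. h (f a) \<noteq> \<zero>\<^bsub>R\<^esub>}" if "h \<zero>\<^bsub>R\<^esub> = \<zero>\<^bsub>R\<^esub>"
    for f :: "'c \<Rightarrow> 'a" and h
    by (erule rev_finite_subset) (use that in auto)
  have add: "(\<lambda>a. f a \<oplus>\<^bsub>R\<^esub> g a) \<in> carrier ?F" if "f \<in> carrier ?F" "g \<in> carrier ?F" for f g
  proof -
    have "{a. f a \<oplus>\<^bsub>R\<^esub> g a \<noteq> \<zero>\<^bsub>R\<^esub>} \<subseteq> {a. f a \<noteq> \<zero>\<^bsub>R\<^esub>} \<union> {a. g a \<noteq> \<zero>\<^bsub>R\<^esub>}"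
      by auto
    moreover have "finite ({a. f a \<noteq> \<zero>\<^bsub>R\<^esub>} \<union> {a. g a \<noteq> \<zero>\<^bsub>R\<^esub>})" "{a. f a \<noteq> \<zero>\<^bsub>R\<^esub>} \<union> {a. g a \<noteq> \<zero>\<^bsub>R\<^esub>} \<subseteq> A"
      using that unfolding c by auto
    ultimately have "{a. f a \<oplus>\<^bsub>R\<^esub> g a \<noteq> \<zero>\<^bsub>R\<^esub>} \<subseteq> A" "finite {a. f a \<oplus>\<^bsub>R\<^esub> g a \<noteq> \<zero>\<^bsub>R\<^esub>}"
      using finite_subset by blast+
    moreover have "\<And>a. f a \<oplus>\<^bsub>R\<^esub> g a \<in> carrier R"
      using that by (simp add: c)
    ultimately show ?thesis
      unfolding c by blast
  qed
  show ?thesis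
  proof (rule moduleI)
    show "abelian_group ?F"
    proof (rule abelian_groupI)
      fix f assume f: "f \<in> carrier ?F"
      have "(\<lambda>a. \<ominus>\<^bsub>R\<^esub> f a) \<in> carrier ?F" 
        using f supp[of "\<lambda>x. \<ominus>\<^bsub>R\<^esub> x" f] unfolding c by auto
      then show "\<exists>g\<in>carrier ?F. g \<oplus>\<^bsub>?F\<^esub> f = \<zero>\<^bsub>?F\<^esub>"
        using f by (intro bexI[of _ "\<lambda>a. \<ominus>\<^bsub>R\<^esub> f a"]) (auto simp: c l_neg)
    qed (auto simp: add, auto simp: c a_ac)
    show "r \<odot>\<^bsub>?F\<^esub> f \<in> carrier ?F" if "r \<in> carrier R" "f \<in> carrier ?F" for r f
      using that supp[of "\<lambda>x. r \<otimes>\<^bsub>R\<^esub> x" f] unfolding c by auto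
  qed (auto simp: c assms l_distr r_distr m_assoc)
qed

lemma free_gen_closed:
  assumes "cring R" "a \<in> A"
  shows "free_gen R a \<in> carrier (free_module R A)"
proof -
  interpret cring R by fact
  have "{b. free_gen R a b \<noteq> \<zero>\<^bsub>R\<^esub>} \<subseteq> {a}"
    by (auto simp: free_gen_def)
  then show ?thesis
    using assms(2) finite_subset[of _ "{a}"] by (auto simp: free_module_carrier free_gen_def)
qed

text \<open>
  Additivity of \<open>lin_ext\<close> compares sums over three different supports; this lemma moves them to
  a common index set.
\<close>

lemma lin_ext_superset:
  assumes "module R P" "\<phi> \<in> A \<rightarrow> carrier P" "f \<in> carrier (free_module R A)"
    and "finite B" "{a. f a \<noteq> \<zero>\<^bsub>R\<^esub>} \<subseteq> B" "B \<subseteq> A"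
  shows "lin_ext R P \<phi> f = finsum P (\<lambda>a. f a \<odot>\<^bsub>P\<^esub> \<phi> a) B"
proof -
  interpret P: module R P by fact
  show ?thesis
    unfolding lin_ext_def using assms(2-6)
    by (intro P.M.add.finprod_mono_neutral_cong_left) (auto simp: free_module_carrier Pi_def subset_iff)
qed

lemma lin_ext_hom:
  assumes "module R P" "\<phi> \<in> A \<rightarrow> carrier P"
  shows "lin_ext R P \<phi> \<in> module_hom R (free_module R A) P"
proof -
  interpret P: module R P by fact
  interpret F: module R "free_module R A" by (rule module_free) (rule P.R.cring_axioms)
  let ?F = "free_module R A"
  let ?S = "\<lambda>f. {a. f a \<noteq> \<zero>\<^bsub>R\<^esub>}"
  have cl: "(\<lambda>a. f a \<odot>\<^bsub>P\<^esub> \<phi> a) \<in> B \<rightarrow> carrier P" if "f \<in> carrier ?F" "B \<subseteq> A" for f B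
    using that assms(2) by (auto simp: free_module_carrier Pi_def subset_iff)
  note sup = lin_ext_superset[OF assms]
  show ?thesis
  proof (rule module_homI)
    fix f assume f: "f \<in> carrier ?F"
    then have Sf: "finite (?S f)" "?S f \<subseteq> A"
      by (auto simp: free_module_carrier)
    show "lin_ext R P \<phi> f \<in> carrier P"
      unfolding lin_ext_def using cl[OF f Sf(2)] by (rule P.M.finsum_closed)
    show "lin_ext R P \<phi> (f \<oplus>\<^bsub>?F\<^esub> g) = lin_ext R P \<phi> f \<oplus>\<^bsub>P\<^esub> lin_ext R P \<phi> g"
      if g: "g \<in> carrier ?F" for g
    proof -
      let ?B = "?S f \<union> ?S g"
      have B: "finite ?B" "?B \<subseteq> A" "?S (f \<oplus>\<^bsub>?F\<^esub> g) \<subseteq> ?B"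
        using f g by (auto simp: free_module_carrier)
      have "lin_ext R P \<phi> (f \<oplus>\<^bsub>?F\<^esub> g) = finsum P (\<lambda>a. (f \<oplus>\<^bsub>?F\<^esub> g) a \<odot>\<^bsub>P\<^esub> \<phi> a) ?B"
        using B F.M.a_closed[OF f g] by (intro sup) auto
      also have "\<dots> = finsum P (\<lambda>a. f a \<odot>\<^bsub>P\<^esub> \<phi> a \<oplus>\<^bsub>P\<^esub> g a \<odot>\<^bsub>P\<^esub> \<phi> a) ?B"
        using f g B(2) assms(2)
        by (intro P.M.finsum_cong') (auto simp: free_module_carrier P.smult_l_distr Pi_def subset_iff)
      also have "\<dots> = finsum P (\<lambda>a. f a \<odot>\<^bsub>P\<^esub> \<phi> a) ?B \<oplus>\<^bsub>P\<^esub> finsum P (\<lambda>a. g a \<odot>\<^bsub>P\<^esub> \<phi> a) ?B"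
        using cl[OF f B(2)] cl[OF g B(2)] by (rule P.M.finsum_addf)
      also have "\<dots> = lin_ext R P \<phi> f \<oplus>\<^bsub>P\<^esub> lin_ext R P \<phi> g"
        using sup[OF f B(1) _ B(2)] sup[OF g B(1) _ B(2)] by simp
      finally show ?thesis .
    qed
    show "lin_ext R P \<phi> (r \<odot>\<^bsub>?F\<^esub> f) = r \<odot>\<^bsub>P\<^esub> lin_ext R P \<phi> f" if r: "r \<in> carrier R" for r
    proof -
      have "lin_ext R P \<phi> (r \<odot>\<^bsub>?F\<^esub> f) = finsum P (\<lambda>a. (r \<odot>\<^bsub>?F\<^esub> f) a \<odot>\<^bsub>P\<^esub> \<phi> a) (?S f)"
        using r Sf F.smult_closed[OF r f] by (intro sup) auto
      also have "\<dots> = finsum P (\<lambda>a. r \<odot>\<^bsub>P\<^esub> (f a \<odot>\<^bsub>P\<^esub> \<phi> a)) (?S f)"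
        using f r Sf(2) assms(2)
        by (intro P.M.finsum_cong') (auto simp: free_module_carrier P.smult_assoc1 Pi_def subset_iff)
      also have "\<dots> = r \<odot>\<^bsub>P\<^esub> lin_ext R P \<phi> f"
        unfolding lin_ext_def using Sf(1) r cl[OF f Sf(2)] by (rule P.finsum_smult_ldistr[symmetric])
      finally show ?thesis .
    qed
  qed
qed

lemma lin_ext_free_gen:
  assumes "module R P" "\<phi> a \<in> carrier P"
  shows "lin_ext R P \<phi> (free_gen R a) = \<phi> a"
proof -
  interpret P: module R P by fact
  have "lin_ext R P \<phi> (free_gen R a) = finsum P (\<lambda>b. free_gen R a b \<odot>\<^bsub>P\<^esub> \<phi> b) {a}"
    using assms(2)
    by (intro lin_ext_superset[OF assms(1), of _ "{a}"] free_gen_closed)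
      (auto simp: P.R.cring_axioms free_gen_def)
  also have "\<dots> = \<phi> a"
    using assms(2) by (simp add: free_gen_def)
  finally show ?thesis .
qed

text \<open>
  Induction on a finite set containing the support, splitting off one coefficient at a time.
\<close>

lemma free_gen_span:
  assumes "cring R"
  shows "submodule_span R (free_module R A) (free_gen R ` A) = carrier (free_module R A)"
proof (rule antisym)
  interpret R: cring R by fact
  let ?F = "free_module R A"
  interpret F: module R ?F by (rule module_free) fact
  have sub: "free_gen R ` A \<subseteq> carrier ?F"
    using free_gen_closed[OF assms] by auto
  let ?H = "submodule_span R ?F (free_gen R ` A)"
  show "?H \<subseteq> carrier ?F"
    using F.module_axioms sub by (rule submodule_span_subset)
  have H: "submodule ?H R ?F"
    using F.module_axioms sub by (rule submodule_span_submodule)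
  have "f \<in> ?H" if "finite B" "f \<in> carrier ?F" "{a. f a \<noteq> \<zero>\<^bsub>R\<^esub>} \<subseteq> B" "B \<subseteq> A" for B f
    using that
  proof (induction B arbitrary: f rule: finite_induct)
    case empty
    then have "f = \<zero>\<^bsub>?F\<^esub>" by auto
    then show ?case
      using subgroup.one_closed[OF submodule.axioms(1)[OF H]] by simp
  next
    case (insert a B)
    let ?g = "f(a := \<zero>\<^bsub>R\<^esub>)"
    have gf: "{b. ?g b \<noteq> \<zero>\<^bsub>R\<^esub>} \<subseteq> {b. f b \<noteq> \<zero>\<^bsub>R\<^esub>}"
      by auto
    have g: "?g \<in> carrier ?F"
      using insert.prems(1) finite_subset[OF gf] by (auto simp: free_module_carrier)
    have 1: "?g \<in> ?H"
      using insert.prems by (intro insert.IH g) auto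
    have fa: "f a \<in> carrier R"
      using insert.prems(1) by (auto simp: free_module_carrier)
    have "free_gen R a \<in> ?H"
      using submodule_span_superset[of "free_gen R ` A" R ?F] insert.prems(3) by auto
    then have 2: "f a \<odot>\<^bsub>?F\<^esub> free_gen R a \<in> ?H"
      using F.submoduleE(4)[OF H fa] by simp
    have "f = ?g \<oplus>\<^bsub>?F\<^esub> (f a \<odot>\<^bsub>?F\<^esub> free_gen R a)"
      using insert.prems(1) by (auto simp: free_gen_def free_module_carrier)
    then show ?case
      using F.submoduleE(5)[OF H 1 2] by simp
  qed
  then show "carrier ?F \<subseteq> ?H"
    by (auto simp: free_module_carrier)
qed

text \<open>
  The module axioms are equations, so they pass to any structure onto which a module maps
  compatibly with the operations.  Quotients are obtained this way from the projection to cosets.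
\<close>

lemma module_of_surjection:
  fixes M :: "('r, 'm) module" and Q :: "('r, 'q) module"
  assumes "module R M" and img: "\<pi> ` carrier M = carrier Q"
    and add: "\<And>x y. \<lbrakk>x \<in> carrier M; y \<in> carrier M\<rbrakk> \<Longrightarrow> \<pi> (x \<oplus>\<^bsub>M\<^esub> y) = \<pi> x \<oplus>\<^bsub>Q\<^esub> \<pi> y"
    and smult: "\<And>a x. \<lbrakk>a \<in> carrier R; x \<in> carrier M\<rbrakk> \<Longrightarrow> \<pi> (a \<odot>\<^bsub>M\<^esub> x) = a \<odot>\<^bsub>Q\<^esub> \<pi> x"
    and zero: "\<pi> \<zero>\<^bsub>M\<^esub> = \<zero>\<^bsub>Q\<^esub>"
  shows "module R Q"
proof -
  interpret M: module R M by fact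
  have cl: "\<And>x. x \<in> carrier M \<Longrightarrow> \<pi> x \<in> carrier Q"
    using img by auto
  note r = add[symmetric] smult[symmetric] zero[symmetric]
  show ?thesis
  proof (rule moduleI)
    show "abelian_group Q"
    proof (rule abelian_groupI; (unfold img[symmetric])?; safe?)
      fix x assume x: "x \<in> carrier M"
      then show "\<exists>y\<in>\<pi> ` carrier M. y \<oplus>\<^bsub>Q\<^esub> \<pi> x = \<zero>\<^bsub>Q\<^esub>"
        by (intro bexI[of _ "\<pi> (\<ominus>\<^bsub>M\<^esub> x)"]) (simp_all add: r M.M.l_neg)
    qed (simp_all add: r M.M.a_ac)
  qed (unfold img[symmetric], safe,
     simp_all add: r M.R.cring_axioms M.smult_l_distr M.smult_r_distr M.smult_assoc1)
qed

locale module_quotient =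
  fixes R :: "('r, 'x) ring_scheme" and M :: "('r, 'm) module" and N :: "'m set"
  assumes M: "module R M" and N: "submodule N R M"
begin

sublocale M: module R M by (rule M)

lemma abelian_sub: "abelian_subgroup N M"
  by (intro abelian_subgroupI3 additive_subgroupI submodule.axioms(1)[OF N] M.abelian_group_axioms)

sublocale sub: abelian_subgroup N M by (rule abelian_sub)

lemma quot_carrier: "carrier (quot_module M N) = (\<lambda>x. N +>\<^bsub>M\<^esub> x) ` carrier M"
  by (auto simp: quot_module_def A_RCOSETS_def')

lemma coset_smult:
  assumes "a \<in> carrier R" "x \<in> carrier M"
  shows "a \<odot>\<^bsub>quot_module M N\<^esub> (N +>\<^bsub>M\<^esub> x) = N +>\<^bsub>M\<^esub> (a \<odot>\<^bsub>M\<^esub> x)"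
proof -
  have "N +>\<^bsub>M\<^esub> (a \<odot>\<^bsub>M\<^esub> u) = N +>\<^bsub>M\<^esub> (a \<odot>\<^bsub>M\<^esub> x)" if u: "u \<in> N +>\<^bsub>M\<^esub> x" for u
  proof -
    obtain n where n: "n \<in> N" "u = n \<oplus>\<^bsub>M\<^esub> x"
      using u unfolding a_r_coset_def' by auto
    then have "a \<odot>\<^bsub>M\<^esub> u = a \<odot>\<^bsub>M\<^esub> n \<oplus>\<^bsub>M\<^esub> a \<odot>\<^bsub>M\<^esub> x"
      using assms sub.a_subset by (auto simp: M.smult_r_distr)
    moreover have "a \<odot>\<^bsub>M\<^esub> n \<in> N"
      using M.submoduleE(4)[OF N assms(1) n(1)] .
    ultimately have "a \<odot>\<^bsub>M\<^esub> u \<in> N +>\<^bsub>M\<^esub> (a \<odot>\<^bsub>M\<^esub> x)"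
      unfolding a_r_coset_def' by auto
    then show ?thesis
      using sub.a_repr_independence' assms by simp
  qed
  then have "a \<odot>\<^bsub>quot_module M N\<^esub> (N +>\<^bsub>M\<^esub> x) = (\<Union>u\<in>N +>\<^bsub>M\<^esub> x. N +>\<^bsub>M\<^esub> (a \<odot>\<^bsub>M\<^esub> x))"
    by (simp add: quot_module_def)
  moreover have "N +>\<^bsub>M\<^esub> x \<noteq> {}"
    using sub.a_rcos_self assms by blast
  ultimately show ?thesis
    by (simp only: UN_constant if_False)
qed

lemma coset_add:
  assumes "x \<in> carrier M" "y \<in> carrier M"
  shows "(N +>\<^bsub>M\<^esub> x) \<oplus>\<^bsub>quot_module M N\<^esub> (N +>\<^bsub>M\<^esub> y) = N +>\<^bsub>M\<^esub> (x \<oplus>\<^bsub>M\<^esub> y)"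
  using sub.a_rcos_sum[OF assms] by (simp add: quot_module_def)

lemma coset_of_submodule: "x \<in> N \<Longrightarrow> N +>\<^bsub>M\<^esub> x = \<zero>\<^bsub>quot_module M N\<^esub>"
  using sub.a_subset by (simp add: quot_module_def M.M.a_coset_join2 sub.a_subgroup)

lemma quot_is_module: "module R (quot_module M N)"
  using M quot_carrier[symmetric]
  by (rule module_of_surjection) (auto simp: coset_add coset_smult coset_of_submodule)

lemma coset_hom: "(\<lambda>x. N +>\<^bsub>M\<^esub> x) \<in> module_hom R M (quot_module M N)"
  by (rule module_homI) (auto simp: quot_carrier coset_add coset_smult)

context
  fixes P :: "('r, 'p) module" and h :: "'m \<Rightarrow> 'p"
  assumes P: "module R P" and h: "h \<in> module_hom R M P"
    and vanish: "\<And>x. x \<in> N \<Longrightarrow> h x = \<zero>\<^bsub>P\<^esub>"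
begin

lemma quot_lift_coset:
  assumes "x \<in> carrier M"
  shows "quot_lift h (N +>\<^bsub>M\<^esub> x) = h x"
proof -
  interpret P: module R P by (rule P)
  have "h (n \<oplus>\<^bsub>M\<^esub> x) = h x" if "n \<in> N" for n
    using that sub.a_subset assms vanish module_hom_closed[OF h]
    by (simp add: module_hom_add[OF h] subset_iff)
  then have "(\<lambda>n. h (n \<oplus>\<^bsub>M\<^esub> x)) ` N = (\<lambda>n. h x) ` N"
    by (rule image_cong[OF refl])
  moreover have "N \<noteq> {}"
    using subgroup.one_closed[OF sub.a_subgroup] by blast
  moreover have "N +>\<^bsub>M\<^esub> x = (\<lambda>n. n \<oplus>\<^bsub>M\<^esub> x) ` N"
    unfolding a_r_coset_def' by blast
  ultimately have "h ` (N +>\<^bsub>M\<^esub> x) = {h x}"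
    by (simp only: image_image image_constant_conv if_False)
  then show ?thesis
    by (simp add: quot_lift_def)
qed

lemma quot_lift_hom: "quot_lift h \<in> module_hom R (quot_module M N) P"
  by (rule module_homI)
    (auto simp: quot_carrier coset_add coset_smult quot_lift_coset module_hom_closed[OF h]
      module_hom_add[OF h] module_hom_smult[OF h])

end

end

lemma tensor_relations_closed:
  assumes "module R M" "module R N"
  shows "tensor_relations R M N \<subseteq> carrier (free_module R (carrier M \<times> carrier N))"
proof -
  interpret M: module R M by fact
  interpret N: module R N by fact
  interpret F: module R "free_module R (carrier M \<times> carrier N)"
    by (rule module_free) (rule M.R.cring_axioms)
  have g: "x \<in> carrier M \<Longrightarrow> y \<in> carrier N \<Longrightarrow>
      free_gen R (x, y) \<in> carrier (free_module R (carrier M \<times> carrier N))" for x y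
    by (rule free_gen_closed) (auto simp: M.R.cring_axioms)
  show ?thesis
    unfolding tensor_relations_def Let_def
    by (intro Un_least subsetI; elim CollectE exE conjE; simp add: g del: free_module_ops)
qed

lemma tensor_quotient:
  assumes "module R M" "module R N"
  shows "module_quotient R (free_module R (carrier M \<times> carrier N)) (tensor_kernel R M N)"
proof (rule module_quotient.intro)
  interpret M: module R M by fact
  show "module R (free_module R (carrier M \<times> carrier N))"
    by (rule module_free) (rule M.R.cring_axioms)
  then show "submodule (tensor_kernel R M N) R (free_module R (carrier M \<times> carrier N))"
    unfolding tensor_kernel_def
    using tensor_relations_closed[OF assms] by (rule submodule_span_submodule)
qed

lemma module_tensor: "\<lbrakk>module R M; module R N\<rbrakk> \<Longrightarrow> module R (tensor_module R M N)"
  unfolding tensor_module_def by (rule module_quotient.quot_is_module[OF tensor_quotient])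

lemma pure_tensor_span:
  assumes "module R M" "module R N"
  shows "submodule_span R (tensor_module R M N)
           ((\<lambda>(x, y). pure_tensor R M N x y) ` (carrier M \<times> carrier N)) =
         carrier (tensor_module R M N)"
proof -
  let ?F = "free_module R (carrier M \<times> carrier N)"
  interpret Q: module_quotient R ?F "tensor_kernel R M N"
    by (rule tensor_quotient[OF assms])
  have "submodule_span R (tensor_module R M N)
      ((\<lambda>x. tensor_kernel R M N +>\<^bsub>?F\<^esub> x) ` free_gen R ` (carrier M \<times> carrier N)) =
      carrier (tensor_module R M N)"
    unfolding tensor_module_def
    by (rule span_image_surj[OF Q.M Q.quot_is_module Q.coset_hom])
      (simp_all add: Q.quot_carrier free_gen_span Q.M.R.cring_axioms)
  then show ?thesis
    by (simp add: image_image pure_tensor_def case_prod_beta)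
qed

text \<open>
  Each bilinearity equation says that two elements of the free module lie in the same coset, and
  their difference is one of the defining relations.
\<close>

lemma pure_tensor_bilinear:
  assumes "module R M" "module R N"
  shows "bilinear R M N (tensor_module R M N) (pure_tensor R M N)"
proof -
  interpret M: module R M by fact
  interpret N: module R N by fact
  let ?F = "free_module R (carrier M \<times> carrier N)" and ?K = "tensor_kernel R M N"
  interpret Q: module_quotient R ?F ?K
    by (rule tensor_quotient[OF assms])
  have g: "x \<in> carrier M \<Longrightarrow> y \<in> carrier N \<Longrightarrow> free_gen R (x, y) \<in> carrier ?F" for x y
    by (rule free_gen_closed) (auto simp: M.R.cring_axioms)
  have rel: "?K +>\<^bsub>?F\<^esub> u = ?K +>\<^bsub>?F\<^esub> v"
    if "u \<ominus>\<^bsub>?F\<^esub> v \<in> tensor_relations R M N" "u \<in> carrier ?F" "v \<in> carrier ?F" for u v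
  proof -
    have "u \<ominus>\<^bsub>?F\<^esub> v \<in> ?K"
      unfolding tensor_kernel_def using that(1) by (rule subsetD[OF submodule_span_superset])
    then have "u \<in> ?K +>\<^bsub>?F\<^esub> v"
      using Q.sub.a_rcos_module[OF that(3,2)] by (simp add: a_minus_def)
    then show ?thesis
      using Q.sub.a_repr_independence' that(3) by simp
  qed
  note [simp del] = free_module_ops
  note add = Q.coset_add[folded tensor_module_def]
    and smult = Q.coset_smult[folded tensor_module_def]
  show ?thesis
    unfolding bilinear_def
  proof (intro conjI ballI module_homI)
    fix x y assume "x \<in> carrier M" "y \<in> carrier N"
    then show "pure_tensor R M N x y \<in> carrier (tensor_module R M N)"
      "pure_tensor R M N x y \<in> carrier (tensor_module R M N)"
      by (auto simp: tensor_module_def Q.quot_carrier pure_tensor_def g)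
  next
    fix x y y' assume xy: "x \<in> carrier M" "y \<in> carrier N" "y' \<in> carrier N"
    have "free_gen R (x, y \<oplus>\<^bsub>N\<^esub> y') \<ominus>\<^bsub>?F\<^esub> (free_gen R (x, y) \<oplus>\<^bsub>?F\<^esub> free_gen R (x, y')) \<in> tensor_relations R M N"
      unfolding tensor_relations_def Let_def using xy by blast
    from rel[OF this] have "?K +>\<^bsub>?F\<^esub> free_gen R (x, y \<oplus>\<^bsub>N\<^esub> y') = ?K +>\<^bsub>?F\<^esub> (free_gen R (x, y) \<oplus>\<^bsub>?F\<^esub> free_gen R (x, y'))"
      using xy by (simp add: g)
    then show "pure_tensor R M N x (y \<oplus>\<^bsub>N\<^esub> y') =
        pure_tensor R M N x y \<oplus>\<^bsub>tensor_module R M N\<^esub> pure_tensor R M N x y'"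
      using xy by (simp add: pure_tensor_def add g)
  next
    fix x r y assume xy: "x \<in> carrier M" "r \<in> carrier R" "y \<in> carrier N"
    have "free_gen R (x, r \<odot>\<^bsub>N\<^esub> y) \<ominus>\<^bsub>?F\<^esub> (r \<odot>\<^bsub>?F\<^esub> free_gen R (x, y)) \<in> tensor_relations R M N"
      unfolding tensor_relations_def Let_def using xy by blast
    from rel[OF this] have "?K +>\<^bsub>?F\<^esub> free_gen R (x, r \<odot>\<^bsub>N\<^esub> y) = ?K +>\<^bsub>?F\<^esub> (r \<odot>\<^bsub>?F\<^esub> free_gen R (x, y))"
      using xy by (simp add: g)
    then show "pure_tensor R M N x (r \<odot>\<^bsub>N\<^esub> y) =
        r \<odot>\<^bsub>tensor_module R M N\<^esub> pure_tensor R M N x y"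
      using xy by (simp add: pure_tensor_def smult g)
  next
    fix y x x' assume xy: "y \<in> carrier N" "x \<in> carrier M" "x' \<in> carrier M"
    have "free_gen R (x \<oplus>\<^bsub>M\<^esub> x', y) \<ominus>\<^bsub>?F\<^esub> (free_gen R (x, y) \<oplus>\<^bsub>?F\<^esub> free_gen R (x', y)) \<in> tensor_relations R M N"
      unfolding tensor_relations_def Let_def using xy by blast
    from rel[OF this] have "?K +>\<^bsub>?F\<^esub> free_gen R (x \<oplus>\<^bsub>M\<^esub> x', y) = ?K +>\<^bsub>?F\<^esub> (free_gen R (x, y) \<oplus>\<^bsub>?F\<^esub> free_gen R (x', y))"
      using xy by (simp add: g)
    then show "pure_tensor R M N (x \<oplus>\<^bsub>M\<^esub> x') y =
        pure_tensor R M N x y \<oplus>\<^bsub>tensor_module R M N\<^esub> pure_tensor R M N x' y"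
      using xy by (simp add: pure_tensor_def add g)
  next
    fix y r x assume xy: "y \<in> carrier N" "r \<in> carrier R" "x \<in> carrier M"
    have "free_gen R (r \<odot>\<^bsub>M\<^esub> x, y) \<ominus>\<^bsub>?F\<^esub> (r \<odot>\<^bsub>?F\<^esub> free_gen R (x, y)) \<in> tensor_relations R M N"
      unfolding tensor_relations_def Let_def using xy by blast
    from rel[OF this] have "?K +>\<^bsub>?F\<^esub> free_gen R (r \<odot>\<^bsub>M\<^esub> x, y) = ?K +>\<^bsub>?F\<^esub> (r \<odot>\<^bsub>?F\<^esub> free_gen R (x, y))"
      using xy by (simp add: g)
    then show "pure_tensor R M N (r \<odot>\<^bsub>M\<^esub> x) y =
        r \<odot>\<^bsub>tensor_module R M N\<^esub> pure_tensor R M N x y"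
      using xy by (simp add: pure_tensor_def smult g)
  qed
qed

text \<open>
  The linear extension of a bilinear map annihilates the defining relations, hence the submodule
  they span, and so it descends to the tensor product.
\<close>

lemma tensor_lift:
  assumes "module R M" "module R N" "module R P" "bilinear R M N P b"
  shows tensor_lift_hom: "tensor_lift R P b \<in> module_hom R (tensor_module R M N) P"
    and tensor_lift_pure: "\<lbrakk>x \<in> carrier M; y \<in> carrier N\<rbrakk> \<Longrightarrow>
      tensor_lift R P b (pure_tensor R M N x y) = b x y"
proof -
  interpret M: module R M by fact
  interpret N: module R N by fact
  interpret P: module R P by fact
  let ?F = "free_module R (carrier M \<times> carrier N)" and ?K = "tensor_kernel R M N"
  interpret Q: module_quotient R ?F ?K
    by (rule tensor_quotient[OF assms(1,2)])
  let ?b = "\<lambda>(x, y). b x y"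
  let ?h = "lin_ext R P ?b"
  note bl = bilinear_left[OF assms(4)] and br = bilinear_right[OF assms(4)]
  have b: "b x y \<in> carrier P" if "x \<in> carrier M" "y \<in> carrier N" for x y
    using module_hom_closed[OF br] that by simp
  have h: "?h \<in> module_hom R ?F P"
    by (rule lin_ext_hom[OF assms(3)]) (auto simp: b)
  have g: "x \<in> carrier M \<Longrightarrow> y \<in> carrier N \<Longrightarrow> free_gen R (x, y) \<in> carrier ?F" for x y
    by (rule free_gen_closed) (auto simp: M.R.cring_axioms)
  have hg: "x \<in> carrier M \<Longrightarrow> y \<in> carrier N \<Longrightarrow> ?h (free_gen R (x, y)) = b x y" for x y
    by (subst lin_ext_free_gen) (auto simp: b assms(3))
  let ?Z = "{u \<in> carrier ?F. ?h u = \<zero>\<^bsub>P\<^esub>}"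
  have Z: "submodule ?Z R ?F"
    using module_hom_equalizer[OF Q.M assms(3) h module_hom_const_zero[OF assms(3)]] .
  have minus: "u \<ominus>\<^bsub>?F\<^esub> v \<in> ?Z" if "u \<in> carrier ?F" "v \<in> carrier ?F" "?h u = ?h v" for u v
    using that module_hom_closed[OF h, of v]
    by (simp add: a_minus_def module_hom_add[OF h] module_hom_neg[OF Q.M assms(3) h] P.M.r_neg
       del: free_module_ops)
  note [simp del] = free_module_ops
  have "tensor_relations R M N \<subseteq> ?Z"
    unfolding tensor_relations_def Let_def
    using bl br
    by (intro Un_least; intro subsetI; elim CollectE exE conjE; hypsubst; intro minus)
      (simp_all add: g hg b module_hom_add[OF h] module_hom_smult[OF h] 
       module_hom_add[OF br] module_hom_smult[OF br] 
       module_hom_add[OF bl] module_hom_smult[OF bl])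
  then have "?K \<subseteq> ?Z"
    unfolding tensor_kernel_def by (rule submodule_span_least[OF Z])
  then have v: "\<And>u. u \<in> ?K \<Longrightarrow> ?h u = \<zero>\<^bsub>P\<^esub>"
    by auto
  show "tensor_lift R P b \<in> module_hom R (tensor_module R M N) P"
    unfolding tensor_lift_def tensor_module_def by (rule Q.quot_lift_hom[OF assms(3) h v])
  show "tensor_lift R P b (pure_tensor R M N x y) = b x y"
    if "x \<in> carrier M" "y \<in> carrier N"
    unfolding tensor_lift_def pure_tensor_def
    using Q.quot_lift_coset[OF assms(3) h v g[OF that]] hg[OF that] by simp
qed

section \<open>Finite direct sums and graded tensor products\<close>

definition direct_sum_inj :: "'j set \<Rightarrow> ('j \<Rightarrow> ('r, 'm) module) \<Rightarrow> 'j \<Rightarrow> 'm \<Rightarrow> 'j \<Rightarrow> 'm" where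
  "direct_sum_inj J M j x = (\<lambda>k\<in>J. if k = j then x else \<zero>\<^bsub>M k\<^esub>)"

locale finite_direct_sum =
  fixes R :: "('r, 'x) ring_scheme" and J :: "'j set" and M :: "'j \<Rightarrow> ('r, 'm) module"
  assumes R: "cring R" and J: "finite J" and M: "\<And>j. j \<in> J \<Longrightarrow> module R (M j)"
begin

lemma sum_carrier: "carrier (direct_sum J M) = (\<Pi>\<^sub>E j\<in>J. carrier (M j))"
  using J by (auto simp: direct_sum_def)

lemma sum_ops:
  "u \<oplus>\<^bsub>direct_sum J M\<^esub> v = (\<lambda>j\<in>J. u j \<oplus>\<^bsub>M j\<^esub> v j)"
  "r \<odot>\<^bsub>direct_sum J M\<^esub> u = (\<lambda>j\<in>J. r \<odot>\<^bsub>M j\<^esub> u j)"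
  "\<zero>\<^bsub>direct_sum J M\<^esub> = (\<lambda>j\<in>J. \<zero>\<^bsub>M j\<^esub>)"
  by (simp_all add: direct_sum_def)

lemma sum_mem: "\<lbrakk>u \<in> carrier (direct_sum J M); j \<in> J\<rbrakk> \<Longrightarrow> u j \<in> carrier (M j)"
  by (auto simp: sum_carrier)

lemma restrict_mem_sum:
  "(\<And>j. j \<in> J \<Longrightarrow> u j \<in> carrier (M j)) \<Longrightarrow> (\<lambda>j\<in>J. u j) \<in> carrier (direct_sum J M)"
  by (simp add: sum_carrier)

lemma component_group: "j \<in> J \<Longrightarrow> abelian_group (M j)"
  by (rule module_abelian[OF M])

lemma component_monoid: "j \<in> J \<Longrightarrow> abelian_monoid (M j)"
  by (rule abelian_group.axioms(1)[OF component_group])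

lemmas component_simps =
  abelian_monoid.a_closed[OF component_monoid] abelian_monoid.zero_closed[OF component_monoid]
  abelian_monoid.l_zero[OF component_monoid] abelian_monoid.r_zero[OF component_monoid]
  abelian_group.a_inv_closed[OF component_group]
  abelian_group.l_neg[OF component_group] module.smult_closed[OF M]
  module.smult_l_distr[OF M] module.smult_r_distr[OF M] module.smult_assoc1[OF M]
  module.smult_one[OF M] module.smult_r_null[OF M]

lemma module_sum: "module R (direct_sum J M)"
proof (rule moduleI)
  let ?S = "direct_sum J M"
  note mem = sum_mem
  have eqI: "u = v" if "u \<in> carrier ?S" "v \<in> carrier ?S" "\<And>j. j \<in> J \<Longrightarrow> u j = v j" for u v
    using that unfolding sum_carrier by (rule PiE_ext)
  show "abelian_group ?S"
  proof (rule abelian_groupI)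
    fix u v w assume u: "u \<in> carrier ?S"
    show "\<exists>v\<in>carrier ?S. v \<oplus>\<^bsub>?S\<^esub> u = \<zero>\<^bsub>?S\<^esub>"
      by (rule bexI[of _ "\<lambda>j\<in>J. \<ominus>\<^bsub>M j\<^esub> u j"])
        (auto simp: sum_ops sum_carrier component_simps mem[OF u] intro!: restrict_ext)
    show "\<zero>\<^bsub>?S\<^esub> \<oplus>\<^bsub>?S\<^esub> u = u"
      using u by (intro eqI) (auto simp: sum_ops component_simps mem sum_carrier)
    assume v: "v \<in> carrier ?S"
    then show "u \<oplus>\<^bsub>?S\<^esub> v = v \<oplus>\<^bsub>?S\<^esub> u"
      using u by (auto simp: sum_ops mem abelian_monoid.a_comm[OF component_monoid] intro!: restrict_ext)
    assume w: "w \<in> carrier ?S"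
    then show "u \<oplus>\<^bsub>?S\<^esub> v \<oplus>\<^bsub>?S\<^esub> w = u \<oplus>\<^bsub>?S\<^esub> (v \<oplus>\<^bsub>?S\<^esub> w)"
      using u v by (auto simp: sum_ops mem abelian_monoid.a_assoc[OF component_monoid] intro!: restrict_ext)
  qed (auto simp: sum_ops component_simps mem sum_carrier)
  show "\<one>\<^bsub>R\<^esub> \<odot>\<^bsub>?S\<^esub> u = u" if "u \<in> carrier ?S" for u
    using that by (intro eqI) (auto simp: sum_ops component_simps mem sum_carrier)
qed (auto simp: sum_ops component_simps R cring.cring_simprules[OF R] sum_mem
    intro!: restrict_ext restrict_mem_sum)

lemma inj_hom:
  assumes "j \<in> J"
  shows "direct_sum_inj J M j \<in> module_hom R (M j) (direct_sum J M)"
  by (rule module_homI)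
    (auto simp: direct_sum_inj_def sum_ops sum_carrier component_simps assms
      intro!: restrict_ext split: if_splits)

lemma proj_hom:
  assumes "j \<in> J"
  shows "(\<lambda>u. u j) \<in> module_hom R (direct_sum J M) (M j)"
  by (rule module_homI) (auto simp: sum_ops sum_carrier assms)

text \<open>
  The two sides are compared componentwise.  A component of a \<open>finsum\<close> is computed by pushing the
  linear projection through the sum.
\<close>

lemma sum_decomposition:
  assumes u: "u \<in> carrier (direct_sum J M)"
  shows "u = finsum (direct_sum J M) (\<lambda>j. direct_sum_inj J M j (u j)) J"
proof -
  let ?S = "direct_sum J M"
  interpret S: module R ?S by (rule module_sum)
  have mem: "u j \<in> carrier (M j)" if "j \<in> J" for j
    using u that by (auto simp: sum_carrier)
  have inj: "(\<lambda>j. direct_sum_inj J M j (u j)) \<in> J \<rightarrow> carrier ?S"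
    using module_hom_closed[OF inj_hom] mem by auto
  have cl: "finsum ?S (\<lambda>j. direct_sum_inj J M j (u j)) J \<in> carrier ?S"
    using inj by (rule S.M.finsum_closed)
  show ?thesis
  proof (rule PiE_ext)
    fix k assume k: "k \<in> J"
    interpret K: module R "M k" by (rule M[OF k])
    have "finsum ?S (\<lambda>j. direct_sum_inj J M j (u j)) J k =
        finsum (M k) (\<lambda>j. direct_sum_inj J M j (u j) k) J"
      using module_hom_image_finsum[OF module_sum M[OF k] proj_hom[OF k] J inj] .
    also have "\<dots> = finsum (M k) (\<lambda>j. if k = j then u k else \<zero>\<^bsub>M k\<^esub>) J"
      using k mem by (intro K.M.finsum_cong') (auto simp: direct_sum_inj_def)
    also have "\<dots> = u k"
      using K.M.finsum_singleton[OF k J, of "\<lambda>_. u k"] mem[OF k] by simp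
    finally show "u k = finsum ?S (\<lambda>j. direct_sum_inj J M j (u j)) J k" ..
  qed (use u cl in \<open>simp_all add: sum_carrier\<close>)
qed

lemma hom_eq_on_summands:
  assumes "module R P" "f \<in> module_hom R (direct_sum J M) P" "g \<in> module_hom R (direct_sum J M) P"
    and eq: "\<And>j x. \<lbrakk>j \<in> J; x \<in> carrier (M j)\<rbrakk> \<Longrightarrow>
      f (direct_sum_inj J M j x) = g (direct_sum_inj J M j x)"
    and u: "u \<in> carrier (direct_sum J M)"
  shows "f u = g u"
proof -
  interpret P: module R P by fact
  have mem: "u j \<in> carrier (M j)" if "j \<in> J" for j
    using u that by (auto simp: sum_carrier)
  have inj: "(\<lambda>j. direct_sum_inj J M j (u j)) \<in> J \<rightarrow> carrier (direct_sum J M)"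
    using module_hom_closed[OF inj_hom] mem by auto
  note im = module_hom_image_finsum[OF module_sum assms(1) _ J inj]
  have "f u = finsum P (\<lambda>j. f (direct_sum_inj J M j (u j))) J"
    by (subst sum_decomposition[OF u]) (rule im[OF assms(2)])
  also have "\<dots> = finsum P (\<lambda>j. g (direct_sum_inj J M j (u j))) J"
    using eq mem inj module_hom_closed[OF assms(3)]
    by (intro P.M.finsum_cong') (auto simp: Pi_def)
  also have "\<dots> = g u"
    by (subst (2) sum_decomposition[OF u]) (rule im[OF assms(3), symmetric])
  finally show ?thesis .
qed

lemma sum_lift_hom:
  assumes "module R P" "\<And>j. j \<in> J \<Longrightarrow> g j \<in> module_hom R (M j) P"
  shows "(\<lambda>u. finsum P (\<lambda>j. g j (u j)) J) \<in> module_hom R (direct_sum J M) P"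
  using module_hom_comp[OF proj_hom assms(2)] J assms(1) by (intro module_hom_finsum) auto

lemma sum_lift_inj:
  assumes "module R P" "\<And>j. j \<in> J \<Longrightarrow> g j \<in> module_hom R (M j) P" "j \<in> J" "x \<in> carrier (M j)"
  shows "finsum P (\<lambda>k. g k (direct_sum_inj J M j x k)) J = g j x"
proof -
  interpret P: module R P by fact
  have gx: "g j x \<in> carrier P"
    using module_hom_closed[OF assms(2)] assms(3,4) by simp
  have "finsum P (\<lambda>k. g k (direct_sum_inj J M j x k)) J =
      finsum P (\<lambda>k. if j = k then g j x else \<zero>\<^bsub>P\<^esub>) J"
    using gx module_hom_zero[OF M assms(1,2)]
    by (intro P.M.finsum_cong') (auto simp: direct_sum_inj_def)
  also have "\<dots> = g j x"
    using P.M.finsum_singleton[OF assms(3) J, of "\<lambda>_. g j x"] gx by simp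
  finally show ?thesis .
qed

end

lemma finite_bidegrees: "finite (bidegrees n)"
  by (rule finite_subset[of _ "{..n} \<times> {..n}"]) (auto simp: bidegrees_def)

lemma htensor_eq_inj:
  "p + q = n \<Longrightarrow> htensor R C D p x q y =
     direct_sum_inj (bidegrees n) (\<lambda>(p, q). tensor_module R (grade C p) (grade D q)) (p, q)
       (pure_tensor R (grade C p) (grade D q) x y)"
  by (auto simp: htensor_def direct_sum_inj_def restrict_def fun_eq_iff)

lemma (in dg_module) cring: "cring R"
  using grade_module[of 0] by (rule module.axioms)

locale dg_module_pair = C: dg_module R C + D: dg_module R D
  for R :: "('r, 'x) ring_scheme" and C :: "('r, 'm) dg_module" and D :: "('r, 'n) dg_module"
begin

abbreviation tens :: "nat \<times> nat \<Rightarrow> ('r, ('m \<times> 'n \<Rightarrow> 'r) set) module" where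
  "tens \<equiv> \<lambda>(p, q). tensor_module R (grade C p) (grade D q)"

lemma module_tens: "module R (tens j)"
  by (cases j) (simp add: module_tensor C.grade_module D.grade_module)

lemma direct_sum_tens: "finite_direct_sum R (bidegrees n) tens"
  by (rule finite_direct_sum.intro) (rule C.cring finite_bidegrees module_tens)+

lemma module_gr_tensor: "module R (gr_tensor R C D n)"
  unfolding gr_tensor_def by (rule finite_direct_sum.module_sum[OF direct_sum_tens])

lemma htensor_bilinear:
  assumes "p + q = n"
  shows "bilinear R (grade C p) (grade D q) (gr_tensor R C D n) (\<lambda>x y. htensor R C D p x q y)"
proof -
  have "(p, q) \<in> bidegrees n"
    using assms by (simp add: bidegrees_def)
  from finite_direct_sum.inj_hom[OF direct_sum_tens this]
  show ?thesis
    unfolding gr_tensor_def htensor_eq_inj[OF assms]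
    by (intro bilinear_comp[OF pure_tensor_bilinear module_hom_id module_hom_id] C.grade_module
        D.grade_module) simp
qed

lemma htensor_closed:
  "\<lbrakk>p + q = n; x \<in> carrier (grade C p); y \<in> carrier (grade D q)\<rbrakk> \<Longrightarrow>
    htensor R C D p x q y \<in> carrier (gr_tensor R C D n)"
  using module_hom_closed[OF bilinear_right[OF htensor_bilinear]] by blast

lemma hom_eq_on_htensor:
  assumes P: "module R P"
    and f: "f \<in> module_hom R (gr_tensor R C D n) P"
    and g: "g \<in> module_hom R (gr_tensor R C D n) P"
    and eq: "\<And>p q x y. \<lbrakk>p + q = n; x \<in> carrier (grade C p); y \<in> carrier (grade D q)\<rbrakk> \<Longrightarrow>
      f (htensor R C D p x q y) = g (htensor R C D p x q y)"
    and u: "u \<in> carrier (gr_tensor R C D n)"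
  shows "f u = g u"
proof (rule finite_direct_sum.hom_eq_on_summands[OF direct_sum_tens P
      f[unfolded gr_tensor_def] g[unfolded gr_tensor_def] _ u[unfolded gr_tensor_def]])
  fix j v assume j: "j \<in> bidegrees n" and v: "v \<in> carrier (tens j)"
  obtain p q where pq: "j = (p, q)" "p + q = n"
    using j by (auto simp: bidegrees_def)
  let ?i = "direct_sum_inj (bidegrees n) tens j"
  have i: "?i \<in> module_hom R (tens j) (gr_tensor R C D n)"
    unfolding gr_tensor_def by (rule finite_direct_sum.inj_hom[OF direct_sum_tens j])
  have "f (?i w) = g (?i w)"
    if "w \<in> (\<lambda>(x, y). pure_tensor R (grade C p) (grade D q) x y) `
      (carrier (grade C p) \<times> carrier (grade D q))" for w
    using that eq[OF pq(2)] by (auto simp: htensor_eq_inj[OF pq(2)] pq(1))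
  from module_hom_eq_on_generators[OF module_tens P module_hom_comp[OF i f] module_hom_comp[OF i g]
      _ this v] pure_tensor_span[OF C.grade_module D.grade_module, of p q]
  show "f (?i v) = g (?i v)"
    unfolding pq(1) by simp
qed

text \<open>
  It suffices to let the first factor range over generators.  For \<open>W_res\<close> this leaves only
  $e_k$ and $T e_k$.
\<close>

lemma hom_eq_on_htensor_generators:
  assumes P: "module R P"
    and f: "f \<in> module_hom R (gr_tensor R C D n) P"
    and g: "g \<in> module_hom R (gr_tensor R C D n) P"
    and S: "\<And>p. submodule_span R (grade C p) (S p) = carrier (grade C p)"
    and eq: "\<And>p q x y. \<lbrakk>p + q = n; x \<in> S p; y \<in> carrier (grade D q)\<rbrakk> \<Longrightarrow>
      f (htensor R C D p x q y) = g (htensor R C D p x q y)"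
    and u: "u \<in> carrier (gr_tensor R C D n)"
  shows "f u = g u"
proof (rule hom_eq_on_htensor[OF P f g _ u])
  fix p q x y assume pq: "p + q = n" and x: "x \<in> carrier (grade C p)" and y: "y \<in> carrier (grade D q)"
  note h = bilinear_left[OF htensor_bilinear[OF pq] y]
  show "f (htensor R C D p x q y) = g (htensor R C D p x q y)"
    by (rule module_hom_eq_on_generators[OF C.grade_module P module_hom_comp[OF h f]
          module_hom_comp[OF h g] S _ x]) (rule eq[OF pq _ y])
qed

context
  fixes P :: "('r, 'p) module" and b n
  assumes P: "module R P"
    and b: "\<And>p q. p + q = n \<Longrightarrow> bilinear R (grade C p) (grade D q) P (b p q)"
begin

lemma gr_lift_component_hom:
  assumes "j \<in> bidegrees n"
  shows "(\<lambda>(p, q). tensor_lift R P (b p q)) j \<in> module_hom R (tens j) P"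
  using assms by (auto simp: bidegrees_def intro!: tensor_lift_hom C.grade_module D.grade_module P b)

lemma gr_lift_eq_sum_lift:
  "gr_lift R P b n u =
     finsum P (\<lambda>j. (\<lambda>(p, q). tensor_lift R P (b p q)) j (u j)) (bidegrees n)"
  unfolding gr_lift_def split_def prod.collapse ..

lemma gr_lift_hom: "gr_lift R P b n \<in> module_hom R (gr_tensor R C D n) P"
  unfolding gr_tensor_def gr_lift_eq_sum_lift[abs_def]
  by (rule finite_direct_sum.sum_lift_hom[OF direct_sum_tens P gr_lift_component_hom])

lemma gr_lift_htensor:
  assumes pq: "p + q = n" and x: "x \<in> carrier (grade C p)" and y: "y \<in> carrier (grade D q)"
  shows "gr_lift R P b n (htensor R C D p x q y) = b p q x y"
proof -
  have j: "(p, q) \<in> bidegrees n"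
    using pq by (simp add: bidegrees_def)
  have "pure_tensor R (grade C p) (grade D q) x y \<in> carrier (tens (p, q))"
    using module_hom_closed[OF bilinear_right[OF pure_tensor_bilinear[OF C.grade_module D.grade_module] x] y]
    by simp
  from finite_direct_sum.sum_lift_inj[OF direct_sum_tens P gr_lift_component_hom j this]
  have "gr_lift R P b n (htensor R C D p x q y) =
      tensor_lift R P (b p q) (pure_tensor R (grade C p) (grade D q) x y)"
    unfolding gr_lift_eq_sum_lift htensor_eq_inj[OF pq] by simp
  also have "\<dots> = b p q x y"
    by (rule tensor_lift_pure[OF C.grade_module D.grade_module P b[OF pq] x y])
  finally show ?thesis .
qed

end

end

section \<open>Boundary, transposition and unitors on tensor products\<close>

lemma (in dg_module) bd_hom_pred:
  "n \<noteq> 0 \<Longrightarrow> bd C n \<in> module_hom R (grade C n) (grade C (n - 1))"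
  using bd_hom[of "n - 1"] by simp

context dg_module_pair
begin

text \<open>
  The summand $\partial x \otimes y$ lives in total degree $n - 1$ only if $x$ has positive degree,
  and similarly for $y$; hence the case distinctions.
\<close>

lemma tensor_bd_bilinear:
  assumes pq: "p + q = n"
  shows "bilinear R (grade C p) (grade D q) (gr_tensor R C D (n - 1))
    (\<lambda>x y. (if p = 0 then \<zero>\<^bsub>gr_tensor R C D (n - 1)\<^esub> else htensor R C D (p - 1) (bd C p x) q y)
      \<oplus>\<^bsub>gr_tensor R C D (n - 1)\<^esub>
      signed (gr_tensor R C D (n - 1)) p
        (if q = 0 then \<zero>\<^bsub>gr_tensor R C D (n - 1)\<^esub> else htensor R C D p x (q - 1) (bd D q y)))"
proof -
  note id = module_hom_id
  have 1: "bilinear R (grade C p) (grade D q) (gr_tensor R C D (n - 1))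
      (\<lambda>x y. htensor R C D (p - 1) (bd C p x) q y)" if "p \<noteq> 0"
    by (rule bilinear_comp[OF htensor_bilinear C.bd_hom_pred id id]) (use pq that in auto)
  have 2: "bilinear R (grade C p) (grade D q) (gr_tensor R C D (n - 1))
      (\<lambda>x y. htensor R C D p x (q - 1) (bd D q y))" if "q \<noteq> 0"
    by (rule bilinear_comp[OF htensor_bilinear id D.bd_hom_pred id]) (use pq that in auto)
  show ?thesis
    by (intro bilinear_plus bilinear_signed bilinear_if bilinear_zero module_gr_tensor 1 2)
qed

lemma tensor_bd_hom:
  "tensor_bd R C D n \<in> module_hom R (gr_tensor R C D n) (gr_tensor R C D (n - 1))"
  unfolding tensor_bd_def Let_def by (rule gr_lift_hom[OF module_gr_tensor tensor_bd_bilinear])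

lemma tensor_bd_htensor:
  assumes "p + q = Suc m" "x \<in> carrier (grade C p)" "y \<in> carrier (grade D q)"
  shows "tensor_bd R C D (Suc m) (htensor R C D p x q y) =
    (if p = 0 then \<zero>\<^bsub>gr_tensor R C D m\<^esub> else htensor R C D (p - 1) (bd C p x) q y)
      \<oplus>\<^bsub>gr_tensor R C D m\<^esub>
    signed (gr_tensor R C D m) p
      (if q = 0 then \<zero>\<^bsub>gr_tensor R C D m\<^esub> else htensor R C D p x (q - 1) (bd D q y))"
  unfolding tensor_bd_def Let_def
  using gr_lift_htensor[OF module_gr_tensor[of "Suc m - 1"] tensor_bd_bilinear[of _ _ "Suc m"] assms]
  by (simp only: diff_Suc_1)

end

lemma tensor_map:
  assumes "dg_module_pair R C D" "dg_module_pair R C' D'"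
    and f: "\<And>p. f p \<in> module_hom R (grade C p) (grade C' p)"
    and g: "\<And>q. g q \<in> module_hom R (grade D q) (grade D' q)"
  shows tensor_map_hom:
      "tensor_map R C' D' f g n \<in> module_hom R (gr_tensor R C D n) (gr_tensor R C' D' n)"
    and tensor_map_htensor:
      "\<lbrakk>p + q = n; x \<in> carrier (grade C p); y \<in> carrier (grade D q)\<rbrakk> \<Longrightarrow>
        tensor_map R C' D' f g n (htensor R C D p x q y) = htensor R C' D' p (f p x) q (g q y)"
proof -
  interpret A: dg_module_pair R C D by fact
  interpret B: dg_module_pair R C' D' by fact
  have b: "bilinear R (grade C p) (grade D q) (gr_tensor R C' D' n)
      (\<lambda>x y. htensor R C' D' p (f p x) q (g q y))" if "p + q = n" for p q
    by (rule bilinear_comp[OF B.htensor_bilinear[OF that] f g module_hom_id])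
  show "tensor_map R C' D' f g n \<in> module_hom R (gr_tensor R C D n) (gr_tensor R C' D' n)"
    unfolding tensor_map_def by (rule A.gr_lift_hom[OF B.module_gr_tensor b])
  show "tensor_map R C' D' f g n (htensor R C D p x q y) = htensor R C' D' p (f p x) q (g q y)"
    if "p + q = n" "x \<in> carrier (grade C p)" "y \<in> carrier (grade D q)"
    unfolding tensor_map_def by (rule A.gr_lift_htensor[OF B.module_gr_tensor b that])
qed

lemma (in dg_module) self_pair: "dg_module_pair R C C"
  by (rule dg_module_pair.intro) (rule dg_module_axioms)+

sublocale dg_module \<subseteq> self: dg_module_pair R C C
  by (rule self_pair)

context dg_module
begin

lemma transpose_bilinear:
  assumes "p + q = n"
  shows "bilinear R (grade C p) (grade C q) (gr_tensor R C C n)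
    (\<lambda>x y. signed (gr_tensor R C C n) (p * q) (htensor R C C q y p x))"
  using assms
  by (intro bilinear_signed bilinear_swap[OF self.htensor_bilinear] self.module_gr_tensor) simp

lemma transpose_hom:
  "transpose_tensor R C n \<in> module_hom R (gr_tensor R C C n) (gr_tensor R C C n)"
  unfolding transpose_tensor_def by (rule self.gr_lift_hom[OF self.module_gr_tensor transpose_bilinear])

lemma transpose_htensor:
  "\<lbrakk>p + q = n; x \<in> carrier (grade C p); y \<in> carrier (grade C q)\<rbrakk> \<Longrightarrow>
    transpose_tensor R C n (htensor R C C p x q y) =
      signed (gr_tensor R C C n) (p * q) (htensor R C C q y p x)"
  unfolding transpose_tensor_def
  by (rule self.gr_lift_htensor[OF self.module_gr_tensor transpose_bilinear])

lemma transpose_transpose: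
  assumes "u \<in> carrier (gr_tensor R C C n)"
  shows "transpose_tensor R C n (transpose_tensor R C n u) = u"
proof (rule self.hom_eq_on_htensor[OF self.module_gr_tensor module_hom_comp[OF transpose_hom transpose_hom]
      module_hom_id _ assms])
  fix p q x y assume pq: "p + q = n" and x: "x \<in> carrier (grade C p)" and y: "y \<in> carrier (grade C q)"
  have qp: "q + p = n" using pq by simp
  note M = self.module_gr_tensor
  show "transpose_tensor R C n (transpose_tensor R C n (htensor R C C p x q y)) = htensor R C C p x q y"
    by (simp add: transpose_htensor[OF pq x y] transpose_htensor[OF qp y x]
        module_hom_signed[OF M M transpose_hom self.htensor_closed[OF qp y x]]
        signed_signed[OF M self.htensor_closed[OF pq x y]] mult.commute)
      (simp add: signed_def)
qed

text \<open>
  On $x \otimes y$ in bidegree $(p, q)$ the signs match because $pq + q \equiv (p - 1) q$ and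
  $p + p (q - 1) = pq$ modulo $2$ whenever the term in question is present.
\<close>

lemma transpose_tensor_bd:
  assumes "u \<in> carrier (gr_tensor R C C (Suc m))"
  shows "tensor_bd R C C (Suc m) (transpose_tensor R C (Suc m) u) =
    transpose_tensor R C m (tensor_bd R C C (Suc m) u)"
proof -
  have bd: "tensor_bd R C C (Suc m) \<in> module_hom R (gr_tensor R C C (Suc m)) (gr_tensor R C C m)"
    using self.tensor_bd_hom[of "Suc m"] by simp
  note M = self.module_gr_tensor
  show ?thesis
  proof (rule self.hom_eq_on_htensor[OF M module_hom_comp[OF transpose_hom bd]
        module_hom_comp[OF bd transpose_hom] _ assms])
    fix p q x y
    assume pq: "p + q = Suc m" and x: "x \<in> carrier (grade C p)" and y: "y \<in> carrier (grade C q)"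
    have qp: "q + p = Suc m" using pq by simp
    let ?P = "gr_tensor R C C m"
    interpret P: module R ?P by (rule M)
    let ?a = "if p = 0 then \<zero>\<^bsub>?P\<^esub> else htensor R C C q y (p - 1) (bd C p x)"
    let ?b = "if q = 0 then \<zero>\<^bsub>?P\<^esub> else htensor R C C (q - 1) (bd C q y) p x"
    let ?a' = "if p = 0 then \<zero>\<^bsub>?P\<^esub> else htensor R C C (p - 1) (bd C p x) q y"
    let ?b' = "if q = 0 then \<zero>\<^bsub>?P\<^esub> else htensor R C C p x (q - 1) (bd C q y)"
    have bx: "p \<noteq> 0 \<Longrightarrow> bd C p x \<in> carrier (grade C (p - 1))"
      using module_hom_closed[OF bd_hom_pred x] .
    have bdy: "q \<noteq> 0 \<Longrightarrow> bd C q y \<in> carrier (grade C (q - 1))"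
      using module_hom_closed[OF bd_hom_pred y] .
    have cl: "?a \<in> carrier ?P" "?b \<in> carrier ?P" "?a' \<in> carrier ?P" "?b' \<in> carrier ?P"
      using pq bx bdy x y by (auto intro!: self.htensor_closed)
    have Ta: "transpose_tensor R C m ?a' = signed ?P ((p - 1) * q) ?a"
      using transpose_htensor[of "p - 1" q m "bd C p x" y] pq bx y
      by (auto simp: module_hom_zero[OF M M transpose_hom] signed_zero[OF M])
    have Tb: "transpose_tensor R C m ?b' = signed ?P (p * (q - 1)) ?b"
      using transpose_htensor[of p "q - 1" m x "bd C q y"] pq bdy x
      by (auto simp: module_hom_zero[OF M M transpose_hom] signed_zero[OF M])
    have sa: "signed ?P (p * q) (signed ?P q ?a) = signed ?P ((p - 1) * q) ?a"
    proof (cases p)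
      case (Suc k)
      show ?thesis
        unfolding signed_signed[OF M cl(1)] by (rule signed_parity) (auto simp: Suc)
    qed (simp add: signed_zero[OF M])
    have sb: "signed ?P (p * q) ?b = signed ?P p (signed ?P (p * (q - 1)) ?b)"
    proof (cases q)
      case (Suc k)
      show ?thesis
        unfolding signed_signed[OF M cl(2)] by (rule signed_parity) (auto simp: Suc)
    qed (simp add: signed_zero[OF M])
    have "tensor_bd R C C (Suc m) (transpose_tensor R C (Suc m) (htensor R C C p x q y)) =
        signed ?P (p * q) (?b \<oplus>\<^bsub>?P\<^esub> signed ?P q ?a)"
      by (simp only: transpose_htensor[OF pq x y] self.tensor_bd_htensor[OF qp y x]
          module_hom_signed[OF M M bd self.htensor_closed[OF qp y x]])
    also have "\<dots> = signed ?P ((p - 1) * q) ?a \<oplus>\<^bsub>?P\<^esub> signed ?P p (signed ?P (p * (q - 1)) ?b)"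
      unfolding signed_plus[OF M cl(2) signed_closed[OF M cl(1)]] sa sb
      by (intro P.M.a_comm signed_closed[OF M] cl)
    also have "\<dots> = transpose_tensor R C m (tensor_bd R C C (Suc m) (htensor R C C p x q y))"
      unfolding self.tensor_bd_htensor[OF pq x y]
        module_hom_add[OF transpose_hom cl(3) signed_closed[OF M cl(4)]]
        module_hom_signed[OF M M transpose_hom cl(4)] Ta Tb ..
    finally show "tensor_bd R C C (Suc m) (transpose_tensor R C (Suc m) (htensor R C C p x q y)) =
        transpose_tensor R C m (tensor_bd R C C (Suc m) (htensor R C C p x q y))" .
  qed
qed

end

lemma zero_module_ops [simp]:
  "carrier (zero_module R) = {\<zero>\<^bsub>R\<^esub>}" "\<zero>\<^bsub>zero_module R\<^esub> = \<zero>\<^bsub>R\<^esub>"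
  "x \<oplus>\<^bsub>zero_module R\<^esub> y = x \<oplus>\<^bsub>R\<^esub> y" "a \<odot>\<^bsub>zero_module R\<^esub> x = a \<otimes>\<^bsub>R\<^esub> x"
  by (simp_all add: zero_module_def self_module_def)

lemma self_module_ops [simp]:
  "carrier (self_module R) = carrier R" "\<zero>\<^bsub>self_module R\<^esub> = \<zero>\<^bsub>R\<^esub>"
  "x \<oplus>\<^bsub>self_module R\<^esub> y = x \<oplus>\<^bsub>R\<^esub> y" "a \<odot>\<^bsub>self_module R\<^esub> x = a \<otimes>\<^bsub>R\<^esub> x"
  by (simp_all add: self_module_def)

lemma module_zero:
  assumes "cring R"
  shows "module R (zero_module R)"
proof -
  interpret cring R by fact
  show ?thesis
    by (rule moduleI) (auto simp: assms intro!: abelian_groupI)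
qed

lemma ground_simps: "grade (ground R) 0 = self_module R" "q \<noteq> 0 \<Longrightarrow> grade (ground R) q = zero_module R"
  by (simp_all add: ground_def)

lemma dg_module_ground:
  assumes "cring R"
  shows "dg_module R (ground R)"
proof (rule dg_module.intro)
  interpret cring R by fact
  show "module R (grade (ground R) n)" for n
    using module_self[OF assms] module_zero[OF assms] by (simp add: ground_def)
  show "bd (ground R) (Suc n) \<in> module_hom R (grade (ground R) (Suc n)) (grade (ground R) n)" for n
    by (rule module_homI) (auto simp: ground_def)
  show "bd (ground R) (Suc n) (bd (ground R) (Suc (Suc n)) x) = \<zero>\<^bsub>grade (ground R) n\<^esub>" for n x
    by (simp add: ground_def)
qed

context dg_module
begin

lemma ground_pairs: "dg_module_pair R C (ground R)" "dg_module_pair R (ground R) C"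
  by (intro dg_module_pair.intro dg_module_axioms dg_module_ground cring)+

text \<open>
  The composite of $\mathrm{id} \otimes \phi$ with the right unitor evaluates the second factor.
  A general \<open>D\<close> and \<open>\<phi>\<close> keep this symmetric to the left-hand version, where both the counit of
  \<open>C\<close> and the augmentation of $W$ are needed.
\<close>

lemma right_counit:
  assumes D: "dg_module R D" and \<phi>: "\<And>q. \<phi> q \<in> module_hom R (grade D q) (grade (ground R) q)"
  defines "e \<equiv> \<lambda>n u. right_unitor R C n (tensor_map R C (ground R) (\<lambda>_ c. c) \<phi> n u)"
  shows right_counit_hom: "e n \<in> module_hom R (gr_tensor R C D n) (grade C n)"
    and right_counit_htensor:
      "\<lbrakk>p + q = n; x \<in> carrier (grade C p); y \<in> carrier (grade D q)\<rbrakk> \<Longrightarrow>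
        e n (htensor R C D p x q y) =
          (if q = 0 then \<phi> 0 y \<odot>\<^bsub>grade C n\<^esub> x else \<zero>\<^bsub>grade C n\<^esub>)"
proof -
  interpret G: dg_module_pair R C "ground R" by (rule ground_pairs)
  interpret D: dg_module_pair R C D
    by (rule dg_module_pair.intro[OF dg_module_axioms D])
  note map = tensor_map[OF D.dg_module_pair_axioms G.dg_module_pair_axioms module_hom_id \<phi>]
  have b: "bilinear R (grade C p) (grade (ground R) q) (grade C n)
      (\<lambda>x r. if q = 0 then r \<odot>\<^bsub>grade C n\<^esub> x else \<zero>\<^bsub>grade C n\<^esub>)" if "p + q = n" for p q
  proof (cases "q = 0")
    case True
    with that show ?thesis
      unfolding bilinear_def
      by (auto simp: ground_simps intro!: module_hom_smult_right module_hom_scale module_hom_id grade_module)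
  qed (simp add: bilinear_zero grade_module)
  show "e n \<in> module_hom R (gr_tensor R C D n) (grade C n)"
    unfolding e_def right_unitor_def
    by (rule module_hom_comp[OF map(1) G.gr_lift_hom[OF grade_module b]])
  show "e n (htensor R C D p x q y) =
      (if q = 0 then \<phi> 0 y \<odot>\<^bsub>grade C n\<^esub> x else \<zero>\<^bsub>grade C n\<^esub>)"
    if "p + q = n" "x \<in> carrier (grade C p)" "y \<in> carrier (grade D q)"
    unfolding e_def right_unitor_def map(2)[OF that]
    using G.gr_lift_htensor[OF grade_module b that(1,2) module_hom_closed[OF \<phi> that(3)]]
    by simp
qed

lemma left_counit:
  assumes D: "dg_module R D" and \<phi>: "\<And>p. \<phi> p \<in> module_hom R (grade D p) (grade (ground R) p)"
  defines "e \<equiv> \<lambda>n u. left_unitor R C n (tensor_map R (ground R) C \<phi> (\<lambda>_ c. c) n u)"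
  shows left_counit_hom: "e n \<in> module_hom R (gr_tensor R D C n) (grade C n)"
    and left_counit_htensor:
      "\<lbrakk>p + q = n; x \<in> carrier (grade D p); y \<in> carrier (grade C q)\<rbrakk> \<Longrightarrow>
        e n (htensor R D C p x q y) =
          (if p = 0 then \<phi> 0 x \<odot>\<^bsub>grade C n\<^esub> y else \<zero>\<^bsub>grade C n\<^esub>)"
proof -
  interpret G: dg_module_pair R "ground R" C by (rule ground_pairs)
  interpret D: dg_module_pair R D C
    by (rule dg_module_pair.intro[OF D dg_module_axioms])
  note map = tensor_map[OF D.dg_module_pair_axioms G.dg_module_pair_axioms \<phi> module_hom_id]
  have b: "bilinear R (grade (ground R) p) (grade C q) (grade C n)
      (\<lambda>r x. if p = 0 then r \<odot>\<^bsub>grade C n\<^esub> x else \<zero>\<^bsub>grade C n\<^esub>)" if "p + q = n" for p q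
  proof (cases "p = 0")
    case True
    with that show ?thesis
      unfolding bilinear_def
      by (auto simp: ground_simps intro!: module_hom_smult_right module_hom_scale module_hom_id grade_module)
  qed (simp add: bilinear_zero grade_module)
  show "e n \<in> module_hom R (gr_tensor R D C n) (grade C n)"
    unfolding e_def left_unitor_def
    by (rule module_hom_comp[OF map(1) G.gr_lift_hom[OF grade_module b]])
  show "e n (htensor R D C p x q y) =
      (if p = 0 then \<phi> 0 x \<odot>\<^bsub>grade C n\<^esub> y else \<zero>\<^bsub>grade C n\<^esub>)"
    if "p + q = n" "x \<in> carrier (grade D p)" "y \<in> carrier (grade C q)"
    unfolding e_def left_unitor_def map(2)[OF that]
    using G.gr_lift_htensor[OF grade_module b that(1) module_hom_closed[OF \<phi> that(2)] that(3)]
    by simp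
qed

text \<open>
  No sign appears: a map to the ground ring sees only factors of degree $0$, on which the
  transposition acts without sign.
\<close>

lemma right_counit_transpose:
  assumes \<phi>: "\<And>q. \<phi> q \<in> module_hom R (grade C q) (grade (ground R) q)"
    and u: "u \<in> carrier (gr_tensor R C C n)"
  shows "right_unitor R C n (tensor_map R C (ground R) (\<lambda>_ c. c) \<phi> n (transpose_tensor R C n u)) =
    left_unitor R C n (tensor_map R (ground R) C \<phi> (\<lambda>_ c. c) n u)"
proof (rule self.hom_eq_on_htensor[OF grade_module
      module_hom_comp[OF transpose_hom right_counit_hom[OF dg_module_axioms \<phi>]]
      left_counit_hom[OF dg_module_axioms \<phi>] _ u])
  fix p q x y assume pq: "p + q = n" and x: "x \<in> carrier (grade C p)" and y: "y \<in> carrier (grade C q)"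
  have qp: "q + p = n" using pq by simp
  show "right_unitor R C n (tensor_map R C (ground R) (\<lambda>_ c. c) \<phi> n
        (transpose_tensor R C n (htensor R C C p x q y))) =
      left_unitor R C n (tensor_map R (ground R) C \<phi> (\<lambda>_ c. c) n (htensor R C C p x q y))"
    unfolding transpose_htensor[OF pq x y]
      module_hom_signed[OF self.module_gr_tensor grade_module right_counit_hom[OF dg_module_axioms \<phi>]
        self.htensor_closed[OF qp y x]]
      right_counit_htensor[OF dg_module_axioms \<phi> qp y x] left_counit_htensor[OF dg_module_axioms \<phi> pq x y]
    by (simp add: signed_zero[OF grade_module]) (simp add: signed_def)
qed

end

section \<open>The resolution of the ground ring\<close>

lemma twist_twist [simp]: "twist (twist g) = g"
  by (cases g) simp_all

lemma W_twist_twist [simp]: "W_twist (W_twist w) = w"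
  by (simp add: W_twist_def)

lemma UNIV_sigma2: "(UNIV :: sigma2 set) = {Unit2, Twist2}"
  using sigma2.exhaust by auto

lemma finite_sigma2: "finite (A :: sigma2 set)"
proof (rule finite_subset)
  show "A \<subseteq> {Unit2, Twist2}"
    using UNIV_sigma2 by blast
qed simp

lemma W_carrier: "w \<in> carrier (free_module R (UNIV :: sigma2 set)) \<longleftrightarrow> (\<forall>g. w g \<in> carrier R)"
  by (simp add: free_module_carrier finite_sigma2)

lemma W_twist_hom:
  "W_twist \<in> module_hom R (free_module R (UNIV :: sigma2 set)) (free_module R UNIV)"
  by (rule module_homI) (auto simp: W_carrier W_twist_def)

lemma W_grade [simp]: "grade (W_res R) k = free_module R UNIV"
  by (simp add: W_res_def Let_def)

lemma W_bd:
  "bd (W_res R) k w =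
     w \<oplus>\<^bsub>free_module R UNIV\<^esub> signed (free_module R UNIV) k (W_twist w)"
  by (simp add: W_res_def Let_def)

lemma dg_module_W:
  assumes "cring R"
  shows "dg_module R (W_res R)"
proof (rule dg_module.intro)
  let ?F = "free_module R (UNIV :: sigma2 set)"
  have F: "module R ?F"
    using assms by (rule module_free)
  interpret F: module R ?F by (rule F)
  note [simp del] = free_module_ops
  show "module R (grade (W_res R) n)" for n
    using F by simp
  show "bd (W_res R) (Suc n) \<in> module_hom R (grade (W_res R) (Suc n)) (grade (W_res R) n)" for n
    unfolding W_bd[abs_def] W_grade
    by (intro module_hom_plus module_hom_signed_comp module_hom_id W_twist_hom F)
  fix n w assume "w \<in> carrier (grade (W_res R) (Suc (Suc n)))"
  then have w: "w \<in> carrier ?F" by simp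
  then have Tw: "W_twist w \<in> carrier ?F"
    by (rule module_hom_closed[OF W_twist_hom])
  have "W_twist (bd (W_res R) (Suc (Suc n)) w) = W_twist w \<oplus>\<^bsub>?F\<^esub> signed ?F n w"
    by (simp add: W_bd module_hom_add[OF W_twist_hom w signed_closed[OF F Tw]]
        module_hom_signed[OF F F W_twist_hom Tw]) (simp add: signed_def)
  then have "bd (W_res R) (Suc n) (bd (W_res R) (Suc (Suc n)) w) =
      (w \<oplus>\<^bsub>?F\<^esub> signed ?F n (W_twist w)) \<oplus>\<^bsub>?F\<^esub>
      signed ?F (Suc n) (W_twist w \<oplus>\<^bsub>?F\<^esub> signed ?F n w)"
    by (simp only: W_bd[of R "Suc n"]) (simp add: W_bd signed_def)
  also have "\<dots> = \<zero>\<^bsub>?F\<^esub>"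
    using w Tw by (simp add: signed_def F.M.minus_add F.M.a_ac F.M.a_cancel)
  finally show "bd (W_res R) (Suc n) (bd (W_res R) (Suc (Suc n)) w) = \<zero>\<^bsub>grade (W_res R) n\<^esub>"
    by simp
qed

lemma W_gen_closed: "cring R \<Longrightarrow> W_gen R \<in> carrier (grade (W_res R) k)"
  unfolding W_gen_def W_grade by (rule free_gen_closed) simp_all

lemma W_twist_gen: "W_twist (W_gen R) = free_gen R Twist2"
  by (rule ext, rename_tac g, case_tac g) (simp_all add: W_twist_def W_gen_def free_gen_def)

lemma W_span:
  assumes "cring R"
  shows "submodule_span R (grade (W_res R) k) {W_gen R, W_twist (W_gen R)} = carrier (grade (W_res R) k)"
  using free_gen_span[OF assms, of "UNIV :: sigma2 set"]
  by (simp add: UNIV_sigma2[symmetric] W_twist_gen) (simp add: UNIV_sigma2 W_gen_def)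

lemma W_coeff_hom:
  "(\<lambda>w. w g) \<in> module_hom R (grade (W_res R) k) (self_module R)"
  by (rule module_homI) (auto simp: W_carrier)

lemma W_aug_hom:
  assumes "cring R"
  shows "W_aug R k \<in> module_hom R (grade (W_res R) k) (grade (ground R) k)"
proof (cases "k = 0")
  case True
  have "(\<lambda>w. w Unit2 \<oplus>\<^bsub>self_module R\<^esub> w Twist2) \<in> module_hom R (grade (W_res R) k) (self_module R)"
    by (intro module_hom_plus W_coeff_hom module_self assms)
  then show ?thesis
    using True by (simp add: W_aug_def[abs_def] ground_simps)
next
  case False
  then show ?thesis
    using module_hom_const_zero[OF module_zero[OF assms]]
    by (simp add: W_aug_def[abs_def] ground_simps)
qed

section \<open>Coalgebras from families of coproducts\<close>

text \<open>
  The description of a coalgebra structure by maps $\Delta_k$.  In total degree $k + n = 0$ the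
  boundary is zero and there is no condition, so the relation is stated for $k + n = m + 1$.  The
  cases $k = 0$ and $n = 0$ express $\Delta_{-1} = 0$ and $\partial_0 = 0$.
\<close>

locale coproduct_family = dg_module R C
  for R :: "('r, 'x) ring_scheme" and C :: "('r, 'm) dg_module" +
  fixes \<delta> :: "nat \<Rightarrow> nat \<Rightarrow> 'm \<Rightarrow> ('r, 'm, 'm) tens" and \<epsilon> :: "nat \<Rightarrow> 'm \<Rightarrow> 'r"
  assumes family_hom: "\<And>k n. \<delta> k n \<in> module_hom R (grade C n) (gr_tensor R C C (k + n))"
    and family_bd: "\<And>k n m c. \<lbrakk>k + n = Suc m; c \<in> carrier (grade C n)\<rbrakk> \<Longrightarrow>
      tensor_bd R C C (Suc m) (\<delta> k n c) =
        (if k = 0 then \<zero>\<^bsub>gr_tensor R C C m\<^esub>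
         else \<delta> (k - 1) n c \<oplus>\<^bsub>gr_tensor R C C m\<^esub>
           signed (gr_tensor R C C m) k (transpose_tensor R C m (\<delta> (k - 1) n c)))
        \<oplus>\<^bsub>gr_tensor R C C m\<^esub>
        signed (gr_tensor R C C m) k
          (if n = 0 then \<zero>\<^bsub>gr_tensor R C C m\<^esub> else \<delta> k (n - 1) (bd C n c))"
    and counit: "chain_map R C (ground R) \<epsilon>"
    and family_right_counit: "\<And>k n c. c \<in> carrier (grade C n) \<Longrightarrow>
      right_unitor R C (k + n) (tensor_map R C (ground R) (\<lambda>_ c. c) \<epsilon> (k + n) (\<delta> k n c)) =
        (if k = 0 then c else \<zero>\<^bsub>grade C (k + n)\<^esub>)"
    and family_left_counit: "\<And>k n c. c \<in> carrier (grade C n) \<Longrightarrow>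
      left_unitor R C (k + n) (tensor_map R (ground R) C \<epsilon> (\<lambda>_ c. c) (k + n) (\<delta> k n c)) =
        (if k = 0 then c else \<zero>\<^bsub>grade C (k + n)\<^esub>)"
begin

abbreviation "\<Delta> \<equiv> coproduct_of_family R C \<delta>"

lemma pair_W: "dg_module_pair R (W_res R) C"
  by (intro dg_module_pair.intro dg_module_W cring dg_module_axioms)

sublocale W: dg_module_pair R "W_res R" C
  by (rule pair_W)

abbreviation "P \<equiv> gr_tensor R C C"

lemmas module_P = self.module_gr_tensor
lemmas module_WC = W.module_gr_tensor

lemma family_hom': "k + m = n \<Longrightarrow> \<delta> k m \<in> module_hom R (grade C m) (P n)"
  using family_hom[of k m] by simp

lemma family_closed: "\<lbrakk>k + m = n; c \<in> carrier (grade C m)\<rbrakk> \<Longrightarrow> \<delta> k m c \<in> carrier (P n)"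
  using module_hom_closed[OF family_hom'] .

lemma transpose_closed: "u \<in> carrier (P n) \<Longrightarrow> transpose_tensor R C n u \<in> carrier (P n)"
  using module_hom_closed[OF transpose_hom] .

lemma coproduct_bilinear:
  assumes kn: "k + m = n"
  shows "bilinear R (grade (W_res R) k) (grade C m) (P n)
    (\<lambda>w c. w Unit2 \<odot>\<^bsub>P n\<^esub> \<delta> k m c \<oplus>\<^bsub>P n\<^esub> w Twist2 \<odot>\<^bsub>P n\<^esub> transpose_tensor R C n (\<delta> k m c))"
  by (rule bilinear_plus[OF _ _ module_P]; unfold bilinear_def)
    (auto intro!: module_hom_smult_right W_coeff_hom module_hom_scale module_P family_hom'[OF kn]
      family_closed[OF kn] transpose_closed module_hom_comp[OF family_hom'[OF kn] transpose_hom]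
      simp: W_carrier simp del: W_grade, auto simp: W_carrier)

lemma coproduct_hom: "\<Delta> n \<in> module_hom R (gr_tensor R (W_res R) C n) (P n)"
  unfolding coproduct_of_family_def Let_def by (rule W.gr_lift_hom[OF module_P coproduct_bilinear])

lemma coproduct_htensor:
  assumes "k + m = n" "w \<in> carrier (grade (W_res R) k)" "c \<in> carrier (grade C m)"
  shows "\<Delta> n (htensor R (W_res R) C k w m c) =
    w Unit2 \<odot>\<^bsub>P n\<^esub> \<delta> k m c \<oplus>\<^bsub>P n\<^esub> w Twist2 \<odot>\<^bsub>P n\<^esub> transpose_tensor R C n (\<delta> k m c)"
  unfolding coproduct_of_family_def Let_def
  by (rule W.gr_lift_htensor[OF module_P coproduct_bilinear assms])

lemma coproduct_gen:
  assumes kn: "k + m = n" and c: "c \<in> carrier (grade C m)"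
  shows "\<Delta> n (htensor R (W_res R) C k (W_gen R) m c) = \<delta> k m c"
proof -
  interpret P: module R "P n" by (rule module_P)
  show ?thesis
    unfolding coproduct_htensor[OF kn W_gen_closed[OF cring] c]
    using family_closed[OF kn c] transpose_closed
    by (simp add: W_gen_def free_gen_def)
qed

lemma coproduct_twist:
  assumes kn: "k + m = n" and w: "w \<in> carrier (grade (W_res R) k)" and c: "c \<in> carrier (grade C m)"
  shows "\<Delta> n (htensor R (W_res R) C k (W_twist w) m c) =
    transpose_tensor R C n (\<Delta> n (htensor R (W_res R) C k w m c))"
proof -
  interpret P: module R "P n" by (rule module_P)
  have Tw: "W_twist w \<in> carrier (grade (W_res R) k)"
    using w module_hom_closed[OF W_twist_hom] by simp
  have d: "\<delta> k m c \<in> carrier (P n)" "transpose_tensor R C n (\<delta> k m c) \<in> carrier (P n)"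
    using family_closed[OF kn c] transpose_closed by auto
  have wR: "w g \<in> carrier R" for g
    using w by (simp add: W_carrier)
  show ?thesis
    unfolding coproduct_htensor[OF kn w c] coproduct_htensor[OF kn Tw c]
    using d wR
    by (simp add: module_hom_add[OF transpose_hom] module_hom_smult[OF transpose_hom]
        transpose_transpose W_twist_def P.M.a_comm)
qed

lemma W_tensor_twist_hom:
  "W_tensor_twist R C n \<in> module_hom R (gr_tensor R (W_res R) C n) (gr_tensor R (W_res R) C n)"
  unfolding W_tensor_twist_def
  by (rule tensor_map_hom[OF pair_W pair_W _ module_hom_id]) (simp add: W_twist_hom)

lemma coproduct_equivariant:
  assumes "u \<in> carrier (gr_tensor R (W_res R) C n)"
  shows "\<Delta> n (W_tensor_twist R C n u) = transpose_tensor R C n (\<Delta> n u)"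
proof (rule W.hom_eq_on_htensor[OF module_P module_hom_comp[OF W_tensor_twist_hom coproduct_hom]
      module_hom_comp[OF coproduct_hom transpose_hom] _ assms])
  fix k m w c
  assume *: "k + m = n" "w \<in> carrier (grade (W_res R) k)" "c \<in> carrier (grade C m)"
  have "W_tensor_twist R C n (htensor R (W_res R) C k w m c) = htensor R (W_res R) C k (W_twist w) m c"
    unfolding W_tensor_twist_def
    by (rule tensor_map_htensor[OF pair_W pair_W _ module_hom_id *]) (simp add: W_twist_hom)
  then show "\<Delta> n (W_tensor_twist R C n (htensor R (W_res R) C k w m c)) =
      transpose_tensor R C n (\<Delta> n (htensor R (W_res R) C k w m c))"
    by (simp add: coproduct_twist[OF *])
qed

text \<open>
  The formula holds for every \<open>w\<close>, not just for $e_k$.  Applied to $T e_k$ as well, it shows that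
  $\Delta\partial(T e_k \otimes c) = T\Delta\partial(e_k \otimes c)$.
\<close>

lemma coproduct_bd_htensor:
  assumes km: "k + m = Suc n" and w: "w \<in> carrier (grade (W_res R) k)" and c: "c \<in> carrier (grade C m)"
  shows "\<Delta> n (tensor_bd R (W_res R) C (Suc n) (htensor R (W_res R) C k w m c)) =
    (if k = 0 then \<zero>\<^bsub>P n\<^esub>
     else \<Delta> n (htensor R (W_res R) C (k - 1) w m c) \<oplus>\<^bsub>P n\<^esub>
       signed (P n) k (transpose_tensor R C n (\<Delta> n (htensor R (W_res R) C (k - 1) w m c))))
    \<oplus>\<^bsub>P n\<^esub>
    signed (P n) k
      (if m = 0 then \<zero>\<^bsub>P n\<^esub> else \<Delta> n (htensor R (W_res R) C k w (m - 1) (bd C m c)))"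
proof -
  let ?W = "gr_tensor R (W_res R) C n" and ?F = "free_module R (UNIV :: sigma2 set)"
  let ?h = "htensor R (W_res R) C"
  let ?A = "if k = 0 then \<zero>\<^bsub>?W\<^esub> else ?h (k - 1) (bd (W_res R) k w) m c"
  let ?B = "if m = 0 then \<zero>\<^bsub>?W\<^esub> else ?h k w (m - 1) (bd C m c)"
  have F: "module R ?F" by (rule module_free[OF cring])
  have wF: "w \<in> carrier ?F" using w by simp
  have Tw: "W_twist w \<in> carrier ?F"
    using module_hom_closed[OF W_twist_hom wF] .
  have wF': "w \<in> carrier (grade (W_res R) j)" for j using wF by simp
  have dw: "k \<noteq> 0 \<Longrightarrow> bd (W_res R) k w \<in> carrier (grade (W_res R) (k - 1))"
    using module_hom_closed[OF W.C.bd_hom_pred w] .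
  have dc: "m \<noteq> 0 \<Longrightarrow> bd C m c \<in> carrier (grade C (m - 1))"
    using module_hom_closed[OF bd_hom_pred c] .
  interpret WM: module R ?W by (rule module_WC)
  have A: "?A \<in> carrier ?W"
    using W.htensor_closed[OF _ dw c] km by auto
  have B: "?B \<in> carrier ?W"
    using W.htensor_closed[OF _ w dc] km by auto
  have dA: "\<Delta> n ?A = (if k = 0 then \<zero>\<^bsub>P n\<^esub>
     else \<Delta> n (?h (k - 1) w m c) \<oplus>\<^bsub>P n\<^esub>
       signed (P n) k (transpose_tensor R C n (\<Delta> n (?h (k - 1) w m c))))"
  proof (cases "k = 0")
    case False
    then have km': "(k - 1) + m = n" using km by simp
    let ?g = "\<lambda>v. \<Delta> n (?h (k - 1) v m c)"
    have g: "?g \<in> module_hom R ?F (P n)"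
      using module_hom_comp[OF bilinear_left[OF W.htensor_bilinear[OF km'] c] coproduct_hom] by simp
    have "?g (bd (W_res R) k w) = ?g w \<oplus>\<^bsub>P n\<^esub> signed (P n) k (?g (W_twist w))"
      unfolding W_bd module_hom_add[OF g wF signed_closed[OF F Tw]]
        module_hom_signed[OF F module_P g Tw] ..
    then show ?thesis
      using False coproduct_twist[OF km' wF' c] by simp
  qed (simp add: module_hom_zero[OF module_WC module_P coproduct_hom])
  have dB: "\<Delta> n ?B = (if m = 0 then \<zero>\<^bsub>P n\<^esub> else \<Delta> n (?h k w (m - 1) (bd C m c)))"
    by (simp add: module_hom_zero[OF module_WC module_P coproduct_hom])
  show ?thesis
    unfolding W.tensor_bd_htensor[OF km w c] 
      module_hom_add[OF coproduct_hom A signed_closed[OF module_WC B]]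
      module_hom_signed[OF module_WC module_P coproduct_hom B] dA dB ..
qed

text \<open>
  On $e_k \otimes c$ this is the cosymmetry relation.  Both sides commute with $T$, which takes
  $e_k \otimes c$ to the other generator $T e_k \otimes c$.
\<close>

lemma coproduct_bd:
  assumes "u \<in> carrier (gr_tensor R (W_res R) C (Suc n))"
  shows "\<Delta> n (tensor_bd R (W_res R) C (Suc n) u) = tensor_bd R C C (Suc n) (\<Delta> (Suc n) u)"
proof -
  have bW: "tensor_bd R (W_res R) C (Suc n) \<in>
      module_hom R (gr_tensor R (W_res R) C (Suc n)) (gr_tensor R (W_res R) C n)"
    using W.tensor_bd_hom[of "Suc n"] by simp
  have bP: "tensor_bd R C C (Suc n) \<in> module_hom R (P (Suc n)) (P n)"
    using self.tensor_bd_hom[of "Suc n"] by simp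
  let ?h = "htensor R (W_res R) C"
  interpret P: module R "P n" by (rule module_P)
  show ?thesis
  proof (rule W.hom_eq_on_htensor_generators[OF module_P module_hom_comp[OF bW coproduct_hom]
        module_hom_comp[OF coproduct_hom bP] W_span[OF cring] _ assms])
    fix k m w c
    assume km: "k + m = Suc n" and w: "w \<in> {W_gen R, W_twist (W_gen R)}"
      and c: "c \<in> carrier (grade C m)"
    let ?e = "W_gen R" and ?T = "transpose_tensor R C n"
    note e = W_gen_closed[OF cring]
    have dc: "m \<noteq> 0 \<Longrightarrow> bd C m c \<in> carrier (grade C (m - 1))"
      using module_hom_closed[OF bd_hom_pred c] .
    have km': "k \<noteq> 0 \<Longrightarrow> k - 1 + m = n" "m \<noteq> 0 \<Longrightarrow> k + (m - 1) = n"
      using km by auto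
    \<comment> \<open>The family relation, read off at $e_k \otimes c$\<close>
    have gen: "\<Delta> n (tensor_bd R (W_res R) C (Suc n) (?h k ?e m c)) =
        tensor_bd R C C (Suc n) (\<Delta> (Suc n) (?h k ?e m c))"
      unfolding coproduct_bd_htensor[OF km e c] coproduct_gen[OF km c] family_bd[OF km c]
      using coproduct_gen[OF km'(1) c] coproduct_gen[OF km'(2) dc]
      by (cases "k = 0"; cases "m = 0") simp_all
    have tw: "\<Delta> n (tensor_bd R (W_res R) C (Suc n) (?h k (W_twist ?e) m c)) =
        ?T (\<Delta> n (tensor_bd R (W_res R) C (Suc n) (?h k ?e m c)))"
    proof -
      have Te: "W_twist ?e \<in> carrier (grade (W_res R) j)" for j
        using module_hom_closed[OF W_twist_hom] e by simp
      let ?a = "if k = 0 then \<zero>\<^bsub>P n\<^esub> else \<Delta> n (?h (k - 1) ?e m c)"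
      let ?b = "if m = 0 then \<zero>\<^bsub>P n\<^esub> else \<Delta> n (?h k ?e (m - 1) (bd C m c))"
      have a: "?a \<in> carrier (P n)" and b: "?b \<in> carrier (P n)"
        using family_closed[OF km'(1) c] family_closed[OF km'(2) dc]
          coproduct_gen[OF km'(1) c] coproduct_gen[OF km'(2) dc]
        by (cases "k = 0"; cases "m = 0"; simp)+
      note T0 = module_hom_zero[OF module_P module_P transpose_hom]
      have 1: "\<Delta> n (tensor_bd R (W_res R) C (Suc n) (?h k ?e m c)) =
          (?a \<oplus>\<^bsub>P n\<^esub> signed (P n) k (?T ?a)) \<oplus>\<^bsub>P n\<^esub> signed (P n) k ?b"
        unfolding coproduct_bd_htensor[OF km e c] by (simp add: T0 signed_zero[OF module_P])
      have 2: "\<Delta> n (tensor_bd R (W_res R) C (Suc n) (?h k (W_twist ?e) m c)) =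
          (?T ?a \<oplus>\<^bsub>P n\<^esub> signed (P n) k (?T (?T ?a))) \<oplus>\<^bsub>P n\<^esub> signed (P n) k (?T ?b)"
        unfolding coproduct_bd_htensor[OF km Te c]
        using coproduct_twist[OF km'(1) e c] coproduct_twist[OF km'(2) e dc]
        by (cases "k = 0"; cases "m = 0") (simp_all add: T0 signed_zero[OF module_P])
      show ?thesis
        unfolding 1 2 using a b
        by (simp only: module_hom_add[OF transpose_hom] signed_closed[OF module_P]
            module_hom_signed[OF module_P module_P transpose_hom] transpose_closed P.M.a_closed)
    qed
    have "\<Delta> n (tensor_bd R (W_res R) C (Suc n) (?h k (W_twist ?e) m c)) =
        tensor_bd R C C (Suc n) (\<Delta> (Suc n) (?h k (W_twist ?e) m c))"
      unfolding tw gen coproduct_twist[OF km e c] coproduct_gen[OF km c]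
      using transpose_tensor_bd[OF family_closed[OF km c]] by simp
    with gen w show "\<Delta> n (tensor_bd R (W_res R) C (Suc n) (?h k w m c)) =
        tensor_bd R C C (Suc n) (\<Delta> (Suc n) (?h k w m c))"
      by auto
  qed
qed

lemma coproduct_chain_map: "chain_map R (dg_tensor R (W_res R) C) (dg_tensor R C C) \<Delta>"
  using coproduct_hom coproduct_bd by (simp add: chain_map_def dg_tensor_def)

lemma counit_hom: "\<epsilon> n \<in> module_hom R (grade C n) (grade (ground R) n)"
  using counit by (simp add: chain_map_def)

text \<open>
  On $e_k \otimes c$ these are the counit conditions of the family.  Passing to $T e_k \otimes c$
  interchanges the two conditions, and the augmentation of $W$ takes the value $1$ on both
  generators.
\<close>

lemma coproduct_counit:
  assumes "u \<in> carrier (gr_tensor R (W_res R) C n)"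
  shows coproduct_right_counit:
      "right_unitor R C n (tensor_map R C (ground R) (\<lambda>_ c. c) \<epsilon> n (\<Delta> n u)) =
       left_unitor R C n (tensor_map R (ground R) C (W_aug R) (\<lambda>_ c. c) n u)"
    and coproduct_left_counit:
      "left_unitor R C n (tensor_map R (ground R) C \<epsilon> (\<lambda>_ c. c) n (\<Delta> n u)) =
       left_unitor R C n (tensor_map R (ground R) C (W_aug R) (\<lambda>_ c. c) n u)"
proof -
  let ?r = "\<lambda>u. right_unitor R C n (tensor_map R C (ground R) (\<lambda>_ c. c) \<epsilon> n u)"
  let ?l = "\<lambda>u. left_unitor R C n (tensor_map R (ground R) C \<epsilon> (\<lambda>_ c. c) n u)"
  let ?w = "\<lambda>u. left_unitor R C n (tensor_map R (ground R) C (W_aug R) (\<lambda>_ c. c) n u)"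
  note rh = right_counit_hom[OF dg_module_axioms counit_hom]
    and lh = left_counit_hom[OF dg_module_axioms counit_hom]
    and wh = left_counit_hom[OF W.C.dg_module_axioms W_aug_hom[OF cring]]
  have *: "?r (\<Delta> n (htensor R (W_res R) C k w m c)) = ?w (htensor R (W_res R) C k w m c) \<and>
      ?l (\<Delta> n (htensor R (W_res R) C k w m c)) = ?w (htensor R (W_res R) C k w m c)"
    if km: "k + m = n" and w: "w \<in> {W_gen R, W_twist (W_gen R)}" and c: "c \<in> carrier (grade C m)"
    for k m w c
  proof -
    interpret C: module R "grade C n" by (rule grade_module)
    note e = W_gen_closed[OF cring]
    have wc: "w \<in> carrier (grade (W_res R) k)"
      using w e module_hom_closed[OF W_twist_hom] by auto
    have aug: "W_aug R 0 w = \<one>\<^bsub>R\<^esub>"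
      using w by (auto simp: W_aug_def W_gen_def W_twist_def free_gen_def)
    have "?w (htensor R (W_res R) C k w m c) = (if k = 0 then c else \<zero>\<^bsub>grade C n\<^esub>)"
      using left_counit_htensor[OF W.C.dg_module_axioms W_aug_hom[OF cring] km wc c] aug c km
        module.smult_one[OF grade_module c] by auto
    moreover have d: "?r (\<delta> k m c) = (if k = 0 then c else \<zero>\<^bsub>grade C n\<^esub>)"
      "?l (\<delta> k m c) = (if k = 0 then c else \<zero>\<^bsub>grade C n\<^esub>)"
      using family_right_counit[OF c, of k] family_left_counit[OF c, of k] km by auto
    moreover have "?r (transpose_tensor R C n (\<delta> k m c)) = ?l (\<delta> k m c)"
      by (rule right_counit_transpose[OF counit_hom family_closed[OF km c]])
    moreover have "?l (transpose_tensor R C n (\<delta> k m c)) = ?r (\<delta> k m c)"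
      using right_counit_transpose[OF counit_hom transpose_closed[OF family_closed[OF km c]]]
      by (simp add: transpose_transpose[OF family_closed[OF km c]])
    moreover have "\<Delta> n (htensor R (W_res R) C k w m c) \<in> {\<delta> k m c, transpose_tensor R C n (\<delta> k m c)}"
      using w coproduct_twist[OF km e c] coproduct_gen[OF km c] by auto
    ultimately show ?thesis by auto
  qed
  show "?r (\<Delta> n u) = ?w u"
    by (rule W.hom_eq_on_htensor_generators[OF grade_module module_hom_comp[OF coproduct_hom rh] wh
          W_span[OF cring] _ assms]) (use * in blast)
  show "?l (\<Delta> n u) = ?w u"
    by (rule W.hom_eq_on_htensor_generators[OF grade_module module_hom_comp[OF coproduct_hom lh] wh
          W_span[OF cring] _ assms]) (use * in blast)
qed

lemma coalgebra: "counital_cosymmetric_coalgebra R C \<Delta> \<epsilon>"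
  by (intro counital_cosymmetric_coalgebra.intro dg_module_axioms
      counital_cosymmetric_coalgebra_axioms.intro counit coproduct_chain_map coproduct_equivariant
      coproduct_right_counit coproduct_left_counit)

end

section \<open>Iterated sources and targets\<close>

text \<open>
  The two definitions have the same body and differ only in the maps they are applied to.  With
  the symmetry \<open>globular_set_swap\<close>, each statement about iterated sources yields the one about
  iterated targets.
\<close>

lemma iter_tgt_eq_iter_src: "iter_tgt = iter_src"
  by (simp add: fun_eq_iff iter_tgt_def iter_src_def)

lemma iter_src_top: "iter_src s n (Suc n) x = s n x"
  by (simp add: iter_src_def)

lemma iter_src_step:
  assumes "k < n"
  shows "iter_src s k (Suc n) x = iter_src s k n (s n x)"
proof -
  have "n - k = Suc (n - Suc k)"
    using assms by simp
  then show ?thesis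
    using assms by (simp add: iter_src_def)
qed

context globular_set
begin

lemma globular_set_swap: "globular_set X t s i"
  using globular_set_axioms by (simp add: globular_set_def)

lemma iter_src_closed:
  assumes "x \<in> X n" "k < n"
  shows "iter_src s k n x \<in> X k"
  unfolding iter_src_def using assms by (intro s_closed descend_closed) auto

text \<open>
  One level down, $s_j$ does not distinguish $s_{j+1} x$ from $t_{j+1} x$, and from there on both
  sides follow the same path.
\<close>

lemma iter_src_tgt:
  assumes "k < n" "x \<in> X (Suc n)"
  shows "iter_src s k n (t n x) = iter_src s k n (s n x)"
proof -
  obtain j where j: "n = Suc j"
    using assms(1) by (cases n) auto
  have "s j (s (Suc j) x) = s j (t (Suc j) x)"
    using assms(2) by (simp add: j s_s)
  then show ?thesis
    using assms(1) by (cases "k = j") (simp_all add: j iter_src_top iter_src_step less_Suc_eq)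
qed

lemma descend_pred:
  "Suc j < n \<Longrightarrow> descend f (Suc j) (n - Suc j) x = f (Suc j) (descend f (Suc (Suc j)) (n - Suc (Suc j)) x)"
  using descend_Suc_left[of f "Suc j" "n - Suc (Suc j)" x] by (simp add: Suc_diff_Suc del: descend.simps(2))

lemma src_iter_src:
  assumes "Suc j < n" "x \<in> X n"
  shows "s j (iter_src s (Suc j) n x) = iter_src s j n x"
  using assms by (simp add: iter_src_def descend_pred)

text \<open>
  Together with the previous lemma and their mirror images: the boundaries of both $s_{j+1} x$ and
  $t_{j+1} x$ are $t_j x - s_j x$.
\<close>

lemma src_iter_tgt:
  assumes "Suc j < n" "x \<in> X n"
  shows "s j (iter_src t (Suc j) n x) = iter_src s j n x"
  using iter_src_eq[of t x n j] assms by (simp add: iter_src_def descend_pred)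

end

section \<open>Globular chains\<close>

locale globular_chain_complex = globular_set X s t i + R: cring R
  for R :: "('r, 'x) ring_scheme" and X :: "nat \<Rightarrow> 'a set" and s t i :: "nat \<Rightarrow> 'a \<Rightarrow> 'a"
begin

sublocale swap: globular_set X t s i
  by (rule globular_set_swap)

abbreviation "G \<equiv> globular_chains R X s t i"
abbreviation "cl \<equiv> cell R X i"

lemma degenerate_subset: "degenerate X i n \<subseteq> X n"
  by (cases n) (auto simp: degenerate_def i_closed)

lemma degenerate_submodule:
  "module_quotient R (free_module R (X n)) (carrier (free_module R (degenerate X i n)))"
proof (rule module_quotient.intro)
  show F: "module R (free_module R (X n))"
    by (rule module_free) (rule R.cring_axioms)
  have "(free_module R (X n))\<lparr>carrier := carrier (free_module R (degenerate X i n))\<rparr> =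
      free_module R (degenerate X i n)"
    by (simp add: free_module_def)
  then show "submodule (carrier (free_module R (degenerate X i n))) R (free_module R (X n))"
    using degenerate_subset[of n]
    by (intro module.module_incl_imp_submodule[OF F])
      (auto simp: free_module_carrier module_free R.cring_axioms subset_iff)
qed

lemma grade_G: "grade G = chain_group R X i"
  by (simp add: globular_chains_def)

lemma module_G: "module R (grade G n)"
  unfolding grade_G chain_group_def
  by (rule module_quotient.quot_is_module[OF degenerate_submodule])

lemma cell_closed: "x \<in> X n \<Longrightarrow> cl n x \<in> carrier (grade G n)"
  unfolding grade_G chain_group_def cell_def
  by (intro module_hom_closed[OF module_quotient.coset_hom[OF degenerate_submodule]]
      free_gen_closed R.cring_axioms)

lemma cell_degenerate: "x \<in> degenerate X i n \<Longrightarrow> cl n x = \<zero>\<^bsub>grade G n\<^esub>"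
  unfolding grade_G chain_group_def cell_def
  by (intro module_quotient.coset_of_submodule[OF degenerate_submodule] free_gen_closed R.cring_axioms)

text \<open>
  The cells are the images of the free generators under the projection to the quotient.
\<close>

lemma cell_span: "submodule_span R (grade G n) (cl n ` X n) = carrier (grade G n)"
proof -
  let ?F = "free_module R (X n)"
  interpret Q: module_quotient R ?F "carrier (free_module R (degenerate X i n))"
    by (rule degenerate_submodule)
  show ?thesis
    using span_image_surj[OF Q.M Q.quot_is_module Q.coset_hom _ free_gen_span[OF R.cring_axioms]]
    by (simp add: Q.quot_carrier image_image cell_def grade_G chain_group_def)
qed

lemma hom_eq_on_cells:
  assumes "module R P" "f \<in> module_hom R (grade G n) P" "g \<in> module_hom R (grade G n) P"
    and "\<And>x. x \<in> X n \<Longrightarrow> f (cl n x) = g (cl n x)" and "c \<in> carrier (grade G n)"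
  shows "f c = g c"
  using module_hom_eq_on_generators[OF module_G assms(1-3) cell_span _ assms(5)] assms(4) by blast

context
  fixes P :: "('r, 'p) module" and \<phi> :: "'a \<Rightarrow> 'p" and n
  assumes P: "module R P" and \<phi>: "\<And>x. x \<in> X n \<Longrightarrow> \<phi> x \<in> carrier P"
    and degen: "\<And>x. x \<in> degenerate X i n \<Longrightarrow> \<phi> x = \<zero>\<^bsub>P\<^esub>"
begin

text \<open>
  A chain supported on degenerate cells is a combination of cells on which \<open>\<phi>\<close> vanishes.
\<close>

lemma lin_ext_degenerate:
  assumes "f \<in> carrier (free_module R (degenerate X i n))"
  shows "lin_ext R P \<phi> f = \<zero>\<^bsub>P\<^esub>"
proof -
  interpret P: module R P by (rule P)
  have "lin_ext R P \<phi> f = finsum P (\<lambda>a. \<zero>\<^bsub>P\<^esub>) {a. f a \<noteq> \<zero>\<^bsub>R\<^esub>}"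
    unfolding lin_ext_def using assms degen
    by (intro P.M.finsum_cong') (auto simp: free_module_carrier subset_iff)
  then show ?thesis
    by (simp add: P.M.finsum_zero)
qed

lemma chain_lift_hom: "quot_lift (lin_ext R P \<phi>) \<in> module_hom R (grade G n) P"
  unfolding grade_G chain_group_def using \<phi>
  by (intro module_quotient.quot_lift_hom[OF degenerate_submodule P] lin_ext_hom[OF P]
      lin_ext_degenerate) auto

lemma chain_lift_cell:
  assumes "x \<in> X n"
  shows "quot_lift (lin_ext R P \<phi>) (cl n x) = \<phi> x"
  unfolding cell_def using \<phi> assms
  by (subst module_quotient.quot_lift_coset[OF degenerate_submodule P])
    (auto intro!: lin_ext_hom P lin_ext_degenerate free_gen_closed R.cring_axioms simp: lin_ext_free_gen P)

end

lemma bd_cell_hom: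
  shows bd_G_hom: "bd G (Suc n) \<in> module_hom R (grade G (Suc n)) (grade G n)"
    and bd_G_cell: "x \<in> X (Suc n) \<Longrightarrow>
      bd G (Suc n) (cl (Suc n) x) = cl n (t n x) \<ominus>\<^bsub>grade G n\<^esub> cl n (s n x)"
proof -
  interpret G: module R "grade G n" by (rule module_G)
  let ?\<phi> = "\<lambda>x. cl n (t n x) \<ominus>\<^bsub>grade G n\<^esub> cl n (s n x)"
  have 1: "?\<phi> x \<in> carrier (grade G n)" if "x \<in> X (Suc n)" for x
    using that by (intro G.M.minus_closed cell_closed t_closed s_closed)
  have 2: "?\<phi> x = \<zero>\<^bsub>grade G n\<^esub>" if "x \<in> degenerate X i (Suc n)" for x
    using that by (auto simp: degenerate_def t_i s_i a_minus_def G.M.r_neg cell_closed)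
  have eq: "bd G (Suc n) = quot_lift (lin_ext R (grade G n) ?\<phi>)"
    unfolding grade_G by (simp add: globular_chains_def Let_def)
  show "bd G (Suc n) \<in> module_hom R (grade G (Suc n)) (grade G n)"
    unfolding eq by (rule chain_lift_hom[OF module_G 1 2])
  show "bd G (Suc n) (cl (Suc n) x) = ?\<phi> x" if "x \<in> X (Suc n)"
    unfolding eq by (rule chain_lift_cell[OF module_G 1 2 that])
qed

lemma dg_module_G: "dg_module R G"
proof (rule dg_module.intro[OF module_G bd_G_hom])
  fix n c assume c: "c \<in> carrier (grade G (Suc (Suc n)))"
  show "bd G (Suc n) (bd G (Suc (Suc n)) c) = \<zero>\<^bsub>grade G n\<^esub>"
  proof (rule hom_eq_on_cells[OF module_G module_hom_comp[OF bd_G_hom bd_G_hom]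
        module_hom_const_zero[OF module_G] _ c])
    fix x assume x: "x \<in> X (Suc (Suc n))"
    interpret G: module R "grade G n" by (rule module_G)
    have tx: "t (Suc n) x \<in> X (Suc n)" and sx: "s (Suc n) x \<in> X (Suc n)"
      using x by (simp_all add: t_closed s_closed)
    have "cl n (t n (s (Suc n) x)) \<in> carrier (grade G n)" "cl n (s n (t (Suc n) x)) \<in> carrier (grade G n)"
      using tx sx by (simp_all add: cell_closed t_closed s_closed)
    then show "bd G (Suc n) (bd G (Suc (Suc n)) (cl (Suc (Suc n)) x)) = \<zero>\<^bsub>grade G n\<^esub>"
      unfolding bd_G_cell[OF x]
        module_hom_minus[OF module_G module_G bd_G_hom cell_closed[OF tx] cell_closed[OF sx]]
        bd_G_cell[OF tx] bd_G_cell[OF sx] t_t[OF x] s_s[OF x]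
      by (simp add: a_minus_def G.M.r_neg)
  qed
qed

sublocale G: dg_module R G
  by (rule dg_module_G)

section \<open>The coproduct on cells\<close>

abbreviation "P \<equiv> gr_tensor R G G"
abbreviation "h p x q y \<equiv> htensor R G G p (cl p x) q (cl q y)"
abbreviation "D \<equiv> globular_coproduct_on_cell R X s t i"
abbreviation "\<delta> \<equiv> globular_coproduct_family R X s t i"
abbreviation "T \<equiv> transpose_tensor R G"
abbreviation "tgt \<equiv> iter_src t"
abbreviation "src \<equiv> iter_src s"

lemmas module_P = G.self.module_gr_tensor

lemma h_closed: "\<lbrakk>p + q = n; x \<in> X p; y \<in> X q\<rbrakk> \<Longrightarrow> h p x q y \<in> carrier (P n)"
  by (intro G.self.htensor_closed cell_closed)

lemma transpose_h: "\<lbrakk>p + q = n; x \<in> X p; y \<in> X q\<rbrakk> \<Longrightarrow> T n (h p x q y) = signed (P n) (p * q) (h q y p x)"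
  by (intro G.transpose_htensor cell_closed)

lemma htensor_bd_left:
  assumes "p + q = n" "x \<in> X (Suc p)" "y \<in> X q"
  shows "htensor R G G p (bd G (Suc p) (cl (Suc p) x)) q (cl q y) =
    h p (t p x) q y \<ominus>\<^bsub>P n\<^esub> h p (s p x) q y"
  using module_hom_minus[OF module_G module_P
      bilinear_left[OF G.self.htensor_bilinear[OF assms(1)] cell_closed[OF assms(3)]]
      cell_closed[OF t_closed[OF assms(2)]] cell_closed[OF s_closed[OF assms(2)]]]
  by (simp add: bd_G_cell[OF assms(2)])

lemma htensor_bd_right:
  assumes "p + q = n" "x \<in> X p" "y \<in> X (Suc q)"
  shows "htensor R G G p (cl p x) q (bd G (Suc q) (cl (Suc q) y)) =
    h p x q (t q y) \<ominus>\<^bsub>P n\<^esub> h p x q (s q y)"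
  using module_hom_minus[OF module_G module_P
      bilinear_right[OF G.self.htensor_bilinear[OF assms(1)] cell_closed[OF assms(2)]]
      cell_closed[OF t_closed[OF assms(3)]] cell_closed[OF s_closed[OF assms(3)]]]
  by (simp add: bd_G_cell[OF assms(3)])

lemma bd_h:
  assumes "p + q = Suc m" "x \<in> X p" "y \<in> X q"
  shows "tensor_bd R G G (Suc m) (h p x q y) =
    (case p of 0 \<Rightarrow> \<zero>\<^bsub>P m\<^esub> | Suc p' \<Rightarrow> h p' (t p' x) q y \<ominus>\<^bsub>P m\<^esub> h p' (s p' x) q y) \<oplus>\<^bsub>P m\<^esub>
    signed (P m) p
      (case q of 0 \<Rightarrow> \<zero>\<^bsub>P m\<^esub> | Suc q' \<Rightarrow> h p x q' (t q' y) \<ominus>\<^bsub>P m\<^esub> h p x q' (s q' y))"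
  using G.self.tensor_bd_htensor[OF assms(1) cell_closed[OF assms(2)] cell_closed[OF assms(3)]] assms
  by (auto simp: htensor_bd_left htensor_bd_right split: nat.split)

lemma on_cell_less: "n < k \<Longrightarrow> D k n x = \<zero>\<^bsub>P (k + n)\<^esub>"
  by (simp add: globular_coproduct_on_cell_def Let_def)

lemma on_cell_eq: "D n n x = h n x n x"
  by (simp add: globular_coproduct_on_cell_def Let_def)

lemma on_cell_greater:
  "k < n \<Longrightarrow> D k n x =
    h k (tgt k n x) n x \<oplus>\<^bsub>P (k + n)\<^esub> signed (P (k + n)) ((n + 1) * k) (h n x k (src k n x))"
  by (simp add: globular_coproduct_on_cell_def Let_def iter_tgt_eq_iter_src)

lemma on_cell_closed:
  assumes "x \<in> X n"
  shows "D k n x \<in> carrier (P (k + n))"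
proof -
  interpret P: module R "P (k + n)" by (rule module_P)
  consider "n < k" | "n = k" | "k < n" by linarith
  then show ?thesis
    using assms
    by cases (auto simp: on_cell_less on_cell_eq on_cell_greater iter_src_closed swap.iter_src_closed
        intro!: h_closed signed_closed module_P)
qed

text \<open>
  Every tensor in $\Delta_k(x)$ has $x$ as a factor, and the class of a degenerate \<open>x\<close> is zero.
\<close>

lemma on_cell_degenerate:
  assumes "x \<in> degenerate X i n"
  shows "D k n x = \<zero>\<^bsub>P (k + n)\<^esub>"
proof -
  interpret P: module R "P (k + n)" by (rule module_P)
  have x: "x \<in> X n" using assms degenerate_subset by auto
  have l: "htensor R G G n (cl n x) k c = \<zero>\<^bsub>P (k + n)\<^esub>" if "c \<in> carrier (grade G k)" for c
    unfolding cell_degenerate[OF assms]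
    by (rule bilinear_zero_left[OF G.self.htensor_bilinear module_G module_P that]) simp
  have r: "htensor R G G k c n (cl n x) = \<zero>\<^bsub>P (k + n)\<^esub>" if "c \<in> carrier (grade G k)" for c
    unfolding cell_degenerate[OF assms]
    by (rule bilinear_zero_right[OF G.self.htensor_bilinear module_G module_P that]) simp
  consider "n < k" | "n = k" | "k < n" by linarith
  then show ?thesis
  proof cases
    case 2
    then show ?thesis using l[of "cl n x"] x by (simp add: on_cell_eq cell_closed)
  next
    case 3
    then show ?thesis
      using x by (simp add: on_cell_greater l r cell_closed iter_src_closed swap.iter_src_closed
          signed_zero[OF module_P])
  qed (simp add: on_cell_less)
qed

lemma family_hom: "\<delta> k n \<in> module_hom R (grade G n) (P (k + n))"
  unfolding globular_coproduct_family_def Let_def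
  by (rule chain_lift_hom[OF module_P on_cell_closed on_cell_degenerate])

lemma family_cell: "x \<in> X n \<Longrightarrow> \<delta> k n (cl n x) = D k n x"
  unfolding globular_coproduct_family_def Let_def
  by (rule chain_lift_cell[OF module_P on_cell_closed on_cell_degenerate])

text \<open>
  The value of $\Delta_k$ on $\partial x$ has the same shape for $k < j$ and for $k = j$, although
  $\Delta_k$ is given by different formulas on $j$-cells: for $k = j$ the sign is $+1$, and the mixed
  terms $t x \otimes s x$ on the right cancel.
\<close>

lemma family_bd_cell:
  assumes x: "x \<in> X (Suc j)" and kj: "k \<le> j"
  shows "\<delta> k j (bd G (Suc j) (cl (Suc j) x)) =
    (h k (tgt k (Suc j) x) j (t j x) \<ominus>\<^bsub>P (k + j)\<^esub> h k (tgt k (Suc j) x) j (s j x)) \<oplus>\<^bsub>P (k + j)\<^esub>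
    signed (P (k + j)) ((j + 1) * k)
      (h j (t j x) k (src k (Suc j) x) \<ominus>\<^bsub>P (k + j)\<^esub> h j (s j x) k (src k (Suc j) x))"
proof -
  interpret P: module R "P (k + j)" by (rule module_P)
  have tx: "t j x \<in> X j" and sx: "s j x \<in> X j"
    using x by (simp_all add: t_closed s_closed)
  have k: "tgt k (Suc j) x \<in> X k" "src k (Suc j) x \<in> X k"
    using x kj by (auto intro: iter_src_closed swap.iter_src_closed)
  have bd: "\<delta> k j (bd G (Suc j) (cl (Suc j) x)) = D k j (t j x) \<ominus>\<^bsub>P (k + j)\<^esub> D k j (s j x)"
    unfolding bd_G_cell[OF x]
    using module_hom_minus[OF module_G module_P family_hom cell_closed[OF tx] cell_closed[OF sx]]
    by (simp add: family_cell tx sx)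
  note c = h_closed[OF _ k(1) tx] h_closed[OF _ k(1) sx] h_closed[OF _ tx k(2)] h_closed[OF _ sx k(2)]
  note c' = c(1,2)[of "k + j", OF refl] c(3,4)[of "k + j", OF add.commute]
  show ?thesis
  proof (cases "k = j")
    case True
    interpret Q: module R "P (j + j)" by (rule module_P)
    show ?thesis
      using c'[unfolded True]
      by (simp add: bd[unfolded True] True on_cell_eq iter_src_top signed_def a_minus_def Q.M.a_ac Q.M.a_cancel
          Q.M.minus_add)
  next
    case False
    then have kj': "k < j" using kj by simp
    have e: "tgt k j (t j x) = tgt k (Suc j) x" "tgt k j (s j x) = tgt k (Suc j) x"
      "src k j (t j x) = src k (Suc j) x" "src k j (s j x) = src k (Suc j) x"
      using kj' x by (simp_all add: iter_src_step iter_src_tgt swap.iter_src_tgt)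
    show ?thesis
      using c'
      by (cases "even j"; cases "even k")
        (simp_all add: bd on_cell_greater[OF kj'] e signed_def a_minus_def P.M.a_ac P.M.minus_add)
  qed
qed

text \<open>
  The cosymmetry relation on an $n$-cell, by comparing $k$ with $n$.  In each case both sides are
  expanded into signed pure tensors of cells.  The signs depend only on parities, so after a case
  distinction on these the two sides are equal up to the order of summands.
\<close>

lemma bd_on_cell:
  assumes km: "k + n = Suc m" and x: "x \<in> X n"
  shows "tensor_bd R G G (Suc m) (D k n x) =
    (if k = 0 then \<zero>\<^bsub>P m\<^esub>
     else D (k - 1) n x \<oplus>\<^bsub>P m\<^esub> signed (P m) k (T m (D (k - 1) n x))) \<oplus>\<^bsub>P m\<^esub>
    signed (P m) k (if n = 0 then \<zero>\<^bsub>P m\<^esub> else \<delta> k (n - 1) (bd G n (cl n x)))"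
proof -
  interpret P: module R "P m" by (rule module_P)
  have bd: "tensor_bd R G G (Suc m) \<in> module_hom R (P (Suc m)) (P m)"
    using G.self.tensor_bd_hom[of "Suc m"] by simp
  note bd0 = module_hom_zero[OF module_P module_P bd]
  note T0 = module_hom_zero[OF module_P module_P G.transpose_hom]
  note s0 = signed_zero[OF module_P]
  \<comment> \<open>A cell of dimension at most \<open>k\<close> has a boundary of dimension less than \<open>k\<close>.\<close>
  have low: "\<delta> k (n - 1) (bd G n (cl n x)) = \<zero>\<^bsub>P m\<^esub>" if "n \<noteq> 0" "n \<le> k"
  proof -
    obtain j where j: "n = Suc j" using \<open>n \<noteq> 0\<close> by (cases n) auto
    have tx: "t j x \<in> X j" and sx: "s j x \<in> X j"
      using x j by (simp_all add: t_closed s_closed)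
    have m: "m = k + j" using km j by simp
    show ?thesis
      using x that module_hom_minus[OF module_G module_P family_hom[of k j] cell_closed[OF tx] cell_closed[OF sx]]
      by (simp add: j bd_G_cell family_cell tx sx on_cell_less m a_minus_def P.M.r_neg[OF P.M.zero_closed, unfolded m])
  qed
  consider "n + 1 < k" | "k = n + 1" | "k = n" | "k < n" by linarith
  then show ?thesis
  proof cases
    case 1
    then have m: "m = k - 1 + n" "Suc m = k + n" using km by auto
    show ?thesis
      using 1 low by (simp add: on_cell_less m(2)[symmetric] m(1)[symmetric] bd0 T0 s0)
  next
    case 2
    then have m: "m = n + n" using km by simp
    have c: "h n x n x \<in> carrier (P m)" by (rule h_closed) (simp_all add: m x)
    have "T m (h n x n x) = signed (P m) (n * n) (h n x n x)"
      by (rule transpose_h) (simp_all add: m x)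
    then have "h n x n x \<oplus>\<^bsub>P m\<^esub> signed (P m) (n + 1) (T m (h n x n x)) = \<zero>\<^bsub>P m\<^esub>"
      using c by (simp add: signed_def P.M.r_neg P.M.minus_minus)
    moreover have "D k n x = \<zero>\<^bsub>P (Suc m)\<^esub>"
      using on_cell_less[of n k x] 2 km by simp
    moreover have "(if n = 0 then \<zero>\<^bsub>P m\<^esub> else \<delta> k (n - 1) (bd G n (cl n x))) = \<zero>\<^bsub>P m\<^esub>"
      using low 2 by simp
    ultimately show ?thesis
      using 2 by (simp only: bd0 s0) (simp add: on_cell_eq)
  next
    case 3
    then obtain j where j: "n = Suc j" "k = Suc j" using km by (cases n) auto
    then have m: "m = j + Suc j" using km by simp
    have tx: "t j x \<in> X j" and sx: "s j x \<in> X j"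
      using x j by (simp_all add: t_closed s_closed)
    have xj: "x \<in> X (Suc j)" using x j by simp
    note hs = tx xj sx xj xj tx xj sx
    let ?a = "h j (t j x) (Suc j) x" and ?b = "h j (s j x) (Suc j) x"
    let ?c = "h (Suc j) x j (t j x)" and ?d = "h (Suc j) x j (s j x)"
    have c: "?a \<in> carrier (P m)" "?b \<in> carrier (P m)" "?c \<in> carrier (P m)" "?d \<in> carrier (P m)"
      using tx sx xj by (auto intro!: h_closed simp: m)
    have Ta: "T m ?a = signed (P m) (j * Suc j) ?c" "T m ?d = signed (P m) (Suc j * j) ?b"
      using tx sx xj by - (rule transpose_h; simp add: m)+
    have Dj: "D (k - 1) n x = ?a \<oplus>\<^bsub>P m\<^esub> signed (P m) ((Suc j + 1) * j) ?d"
      using on_cell_greater[of j "Suc j" x] by (simp add: j iter_src_top m)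
    have TD: "T m (D (k - 1) n x) =
        signed (P m) (j * Suc j) ?c \<oplus>\<^bsub>P m\<^esub> signed (P m) ((Suc j + 1) * j) (signed (P m) (Suc j * j) ?b)"
      unfolding Dj module_hom_add[OF G.transpose_hom c(1) signed_closed[OF module_P c(4)]]
        module_hom_signed[OF module_P module_P G.transpose_hom c(4)] Ta ..
    have "tensor_bd R G G (Suc m) (D k n x) =
        (?a \<ominus>\<^bsub>P m\<^esub> ?b) \<oplus>\<^bsub>P m\<^esub> signed (P m) (Suc j) (?c \<ominus>\<^bsub>P m\<^esub> ?d)"
      using bd_h[of "Suc j" "Suc j" m x x] xj by (simp add: j on_cell_eq m)
    then show ?thesis
      unfolding TD unfolding Dj using c low[OF _ eq_imp_le[OF 3[symmetric]]]
      by (cases "even j") (simp_all add: j signed_def a_minus_def P.M.a_ac P.M.minus_add)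
  next
    case 4
    then obtain j where j: "n = Suc j" "k \<le> j" by (cases n) auto
    then have m: "m = k + j" using km by simp
    have tx: "t j x \<in> X j" and sx: "s j x \<in> X j"
      using x j by (simp_all add: t_closed s_closed)
    have k: "tgt k n x \<in> X k" "src k n x \<in> X k"
      using x 4 by (auto intro: iter_src_closed swap.iter_src_closed)
    let ?A = "h k (tgt k n x) j (t j x)" and ?A' = "h k (tgt k n x) j (s j x)"
    let ?B = "h j (t j x) k (src k n x)" and ?B' = "h j (s j x) k (src k n x)"
    have c: "?A \<in> carrier (P m)" "?A' \<in> carrier (P m)" "?B \<in> carrier (P m)" "?B' \<in> carrier (P m)"
      using tx sx k by (auto intro!: h_closed simp: m)
    have db: "\<delta> k (n - 1) (bd G n (cl n x)) =
        (?A \<ominus>\<^bsub>P m\<^esub> ?A') \<oplus>\<^bsub>P m\<^esub> signed (P m) (n * k) (?B \<ominus>\<^bsub>P m\<^esub> ?B')"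
      using family_bd_cell[of x j k] x j by (simp add: m)
    have hc: "h k (tgt k n x) n x \<in> carrier (P (Suc m))" "h n x k (src k n x) \<in> carrier (P (Suc m))"
      using x k km by (auto intro!: h_closed)
    have lhs: "tensor_bd R G G (Suc m) (D k n x) =
        tensor_bd R G G (Suc m) (h k (tgt k n x) n x) \<oplus>\<^bsub>P m\<^esub>
        signed (P m) ((n + 1) * k) (tensor_bd R G G (Suc m) (h n x k (src k n x)))"
      unfolding on_cell_greater[OF 4] km
        module_hom_add[OF bd hc(1) signed_closed[OF module_P hc(2)]]
        module_hom_signed[OF module_P module_P bd hc(2)] ..
    have bh: "tensor_bd R G G (Suc m) (h k (tgt k n x) n x) =
        (case k of 0 \<Rightarrow> \<zero>\<^bsub>P m\<^esub> | Suc l \<Rightarrow> h l (tgt l n x) n x \<ominus>\<^bsub>P m\<^esub> h l (src l n x) n x) \<oplus>\<^bsub>P m\<^esub>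
        signed (P m) k (?A \<ominus>\<^bsub>P m\<^esub> ?A')"
      using bd_h[OF km k(1) x] 4 x
      by (auto simp: j(1) swap.src_iter_src src_iter_tgt split: nat.split)
    have bh': "tensor_bd R G G (Suc m) (h n x k (src k n x)) =
        (?B \<ominus>\<^bsub>P m\<^esub> ?B') \<oplus>\<^bsub>P m\<^esub> signed (P m) n
        (case k of 0 \<Rightarrow> \<zero>\<^bsub>P m\<^esub> | Suc l \<Rightarrow> h n x l (tgt l n x) \<ominus>\<^bsub>P m\<^esub> h n x l (src l n x))"
      using bd_h[of n k m, OF _ x k(2)] km 4 x
      by (auto simp: j(1) src_iter_src swap.src_iter_tgt split: nat.split)
    show ?thesis
    proof (cases k)
      case 0
      then show ?thesis
        unfolding lhs bh bh' db using c j
        by (simp add: signed_def a_minus_def P.M.a_ac)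
    next
      case (Suc l)
      have ln: "l < n" "Suc l < n" using 4 Suc by auto
      have lX: "tgt l n x \<in> X l" "src l n x \<in> X l"
        using x ln by (auto intro: iter_src_closed swap.iter_src_closed)
      have ml: "l + n = m" "n + l = m" using km Suc by auto
      let ?E = "h l (tgt l n x) n x" and ?E' = "h l (src l n x) n x"
      let ?F = "h n x l (tgt l n x)" and ?F' = "h n x l (src l n x)"
      have cE: "?E \<in> carrier (P m)" "?E' \<in> carrier (P m)" "?F \<in> carrier (P m)" "?F' \<in> carrier (P m)"
        using x lX ml by (auto intro!: h_closed)
      have Dl: "D l n x = ?E \<oplus>\<^bsub>P m\<^esub> signed (P m) ((n + 1) * l) ?F'"
        using on_cell_greater[OF ln(1), of x] ml by simp
      have TD: "T m (D l n x) =
          signed (P m) (l * n) ?F \<oplus>\<^bsub>P m\<^esub> signed (P m) ((n + 1) * l) (signed (P m) (n * l) ?E')"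
        unfolding Dl module_hom_add[OF G.transpose_hom cE(1) signed_closed[OF module_P cE(4)]]
          module_hom_signed[OF module_P module_P G.transpose_hom cE(4)]
          transpose_h[OF ml(1) lX(1) x] transpose_h[OF ml(2) x lX(2)] ..
      have k: "k - 1 = l" "k \<noteq> 0" "n \<noteq> 0" using Suc j by auto
      show ?thesis
        unfolding lhs bh bh' db k(1) unfolding TD unfolding Dl using c cE k(2,3)
        by (cases "even l"; cases "even n")
          (simp_all add: Suc signed_def a_minus_def P.M.a_ac P.M.minus_add)
    qed
  qed
qed

section \<open>The counit on cells\<close>

lemma counit_cell:
  assumes "x \<in> X n"
  shows "globular_counit R n (cl n x) = (if n = 0 then \<one>\<^bsub>R\<^esub> else \<zero>\<^bsub>R\<^esub>)"
  unfolding globular_counit_def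
  by (rule chain_lift_cell[OF module_self[OF R.cring_axioms] _ _ assms]) (auto simp: degenerate_def)

lemma counit_hom: "globular_counit R n \<in> module_hom R (grade G n) (grade (ground R) n)"
proof -
  have self: "globular_counit R n \<in> module_hom R (grade G n) (self_module R)"
    unfolding globular_counit_def
    by (rule chain_lift_hom[OF module_self[OF R.cring_axioms]]) (auto simp: degenerate_def)
  show ?thesis
  proof (cases "n = 0")
    case True
    then show ?thesis using self by (simp add: ground_simps)
  next
    case False
    have "globular_counit R n c = \<zero>\<^bsub>R\<^esub>" if "c \<in> carrier (grade G n)" for c
      using hom_eq_on_cells[OF module_self[OF R.cring_axioms] self
          module_hom_const_zero[OF module_self[OF R.cring_axioms]] _ that] False
      by (simp add: counit_cell)
    then show ?thesis
      using module_hom_cong[OF module_hom_const_zero[OF module_zero[OF R.cring_axioms]] module_G] False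
      by (simp add: ground_simps)
  qed
qed

lemma counit_chain_map: "chain_map R G (ground R) (globular_counit R)"
proof -
  have "globular_counit R n (bd G (Suc n) c) = \<zero>\<^bsub>grade (ground R) n\<^esub>"
    if c: "c \<in> carrier (grade G (Suc n))" for n c
  proof (rule hom_eq_on_cells[OF G.ground_pairs(1)[THEN dg_module_pair.axioms(2), THEN dg_module.grade_module]
        module_hom_comp[OF bd_G_hom counit_hom] module_hom_const_zero _ c])
    show M: "module R (grade (ground R) n)"
      using dg_module.grade_module[OF dg_module_ground[OF R.cring_axioms]] .
    interpret K: module R "grade (ground R) n" by (rule M)
    fix x assume x: "x \<in> X (Suc n)"
    have c: "cl n (t n x) \<in> carrier (grade G n)" "cl n (s n x) \<in> carrier (grade G n)"
      using x by (simp_all add: cell_closed t_closed s_closed)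
    have "globular_counit R n (cl n (t n x)) = globular_counit R n (cl n (s n x))"
      using x by (simp add: counit_cell t_closed s_closed)
    then show "globular_counit R n (bd G (Suc n) (cl (Suc n) x)) = \<zero>\<^bsub>grade (ground R) n\<^esub>"
      using module_hom_minus[OF module_G M counit_hom c] module_hom_closed[OF counit_hom c(2)]
      by (simp add: bd_G_cell[OF x] a_minus_def K.M.r_neg)
  qed
  then show ?thesis
    by (simp add: chain_map_def counit_hom) (simp add: ground_def self_module_def zero_module_def)
qed

lemma counit_smult: "\<lbrakk>x \<in> X 0; c \<in> carrier (grade G n)\<rbrakk> \<Longrightarrow>
    globular_counit R 0 (cl 0 x) \<odot>\<^bsub>grade G n\<^esub> c = c"
  using module.smult_one[OF module_G] by (simp add: counit_cell)

lemma right_counit_h: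
  assumes "p + q = n" "x \<in> X p" "y \<in> X q"
  shows "right_unitor R G n (tensor_map R G (ground R) (\<lambda>_ c. c) (globular_counit R) n (h p x q y)) =
    (if q = 0 then cl p x else \<zero>\<^bsub>grade G n\<^esub>)"
  using G.right_counit_htensor[OF dg_module_G counit_hom assms(1) cell_closed[OF assms(2)]
      cell_closed[OF assms(3)]] assms cell_closed[OF assms(2)]
  by (auto simp: counit_smult)

lemma left_counit_h:
  assumes "p + q = n" "x \<in> X p" "y \<in> X q"
  shows "left_unitor R G n (tensor_map R (ground R) G (globular_counit R) (\<lambda>_ c. c) n (h p x q y)) =
    (if p = 0 then cl q y else \<zero>\<^bsub>grade G n\<^esub>)"
  using G.left_counit_htensor[OF dg_module_G counit_hom assms(1) cell_closed[OF assms(2)]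
      cell_closed[OF assms(3)]] assms cell_closed[OF assms(3)]
  by (auto simp: counit_smult)

text \<open>
  The map \<open>e\<close> stands for either of the two counit maps $C \otimes C \to C$; the disjunction records
  which factor it evaluates.  For $k = 0 < n$ it picks one of $t_0 x \otimes x$ and $x \otimes s_0 x$,
  and the result is $x$ both times.
\<close>

lemma counit_on_cell:
  assumes x: "x \<in> X n"
    and e: "e \<in> module_hom R (P (k + n)) (grade G (k + n))"
    and eh: "(\<forall>p q y z. p + q = k + n \<longrightarrow> y \<in> X p \<longrightarrow> z \<in> X q \<longrightarrow>
        e (h p y q z) = (if q = 0 then cl p y else \<zero>\<^bsub>grade G (k + n)\<^esub>)) \<or>
      (\<forall>p q y z. p + q = k + n \<longrightarrow> y \<in> X p \<longrightarrow> z \<in> X q \<longrightarrow>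
        e (h p y q z) = (if p = 0 then cl q z else \<zero>\<^bsub>grade G (k + n)\<^esub>))"
  shows "e (D k n x) = (if k = 0 then cl n x else \<zero>\<^bsub>grade G (k + n)\<^esub>)"
proof -
  interpret A: module R "grade G (k + n)" by (rule module_G)
  consider "n < k" | "n = k" | "k < n" by linarith
  then show ?thesis
  proof cases
    case 1
    then show ?thesis
      by (simp add: on_cell_less module_hom_zero[OF module_P module_G e])
  next
    case 2
    with eh x show ?thesis
      by (auto simp: on_cell_eq)
  next
    case 3
    have a: "tgt k n x \<in> X k" "src k n x \<in> X k"
      using x 3 by (auto intro: iter_src_closed swap.iter_src_closed)
    have c: "h k (tgt k n x) n x \<in> carrier (P (k + n))" "h n x k (src k n x) \<in> carrier (P (k + n))"
      using a x by (auto intro!: h_closed)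
    have "e (D k n x) = e (h k (tgt k n x) n x) \<oplus>\<^bsub>grade G (k + n)\<^esub>
        signed (grade G (k + n)) ((n + 1) * k) (e (h n x k (src k n x)))"
      unfolding on_cell_greater[OF 3] module_hom_add[OF e c(1) signed_closed[OF module_P c(2)]]
        module_hom_signed[OF module_P module_G e c(2)] ..
    also have "\<dots> = (if k = 0 then cl n x else \<zero>\<^bsub>grade G (k + n)\<^esub>)"
    proof (cases "k = 0")
      case True
      interpret B: module R "grade G n" by (rule module_G)
      show ?thesis
        using eh 3 a x cell_closed[OF x] True
        by (elim disjE) (simp_all add: signed_zero[OF module_G] signed_def)
    next
      case False
      then show ?thesis
        using eh 3 a x by (elim disjE) (simp_all add: signed_zero[OF module_G])
    qed
    finally show ?thesis .
  qed
qed

lemma counit_of_family: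
  assumes c: "c \<in> carrier (grade G n)"
    and e: "e \<in> module_hom R (P (k + n)) (grade G (k + n))"
    and ex: "\<And>x. x \<in> X n \<Longrightarrow> e (D k n x) = (if k = 0 then cl n x else \<zero>\<^bsub>grade G (k + n)\<^esub>)"
  shows "e (\<delta> k n c) = (if k = 0 then c else \<zero>\<^bsub>grade G (k + n)\<^esub>)"
proof (rule hom_eq_on_cells[OF module_G module_hom_comp[OF family_hom e] module_hom_if _ c])
  show "(\<lambda>c. c) \<in> module_hom R (grade G n) (grade G (k + n))" if "k = 0"
    using that module_hom_id by simp
qed (simp_all add: module_hom_const_zero module_G family_cell ex)

lemma coproduct_family_G: "coproduct_family R G \<delta> (globular_counit R)"
proof (intro coproduct_family.intro dg_module_G coproduct_family_axioms.intro family_hom counit_chain_map)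
  fix k n m c assume km: "k + n = Suc m" and c: "c \<in> carrier (grade G n)"
  have bd: "tensor_bd R G G (Suc m) \<in> module_hom R (P (k + n)) (P m)"
    using G.self.tensor_bd_hom[of "Suc m"] km by simp
  have d: "\<delta> (k - 1) n \<in> module_hom R (grade G n) (P m)" if "k \<noteq> 0"
  proof -
    have "k - 1 + n = m" using km that by simp
    then show ?thesis using family_hom[of "k - 1" n] by simp
  qed
  have d': "(\<lambda>c. \<delta> k (n - 1) (bd G n c)) \<in> module_hom R (grade G n) (P m)" if "n \<noteq> 0"
  proof -
    have "k + (n - 1) = m" using km that by simp
    then show ?thesis
      using module_hom_comp[OF G.bd_hom_pred[OF that] family_hom[of k "n - 1"]] by simp
  qed
  show "tensor_bd R G G (Suc m) (\<delta> k n c) =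
      (if k = 0 then \<zero>\<^bsub>P m\<^esub>
       else \<delta> (k - 1) n c \<oplus>\<^bsub>P m\<^esub> signed (P m) k (T m (\<delta> (k - 1) n c))) \<oplus>\<^bsub>P m\<^esub>
      signed (P m) k (if n = 0 then \<zero>\<^bsub>P m\<^esub> else \<delta> k (n - 1) (bd G n c))"
  proof (rule hom_eq_on_cells[OF module_P module_hom_comp[OF family_hom bd] _ _ c])
    show "(\<lambda>c. (if k = 0 then \<zero>\<^bsub>P m\<^esub>
       else \<delta> (k - 1) n c \<oplus>\<^bsub>P m\<^esub> signed (P m) k (T m (\<delta> (k - 1) n c))) \<oplus>\<^bsub>P m\<^esub>
      signed (P m) k (if n = 0 then \<zero>\<^bsub>P m\<^esub> else \<delta> k (n - 1) (bd G n c)))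
      \<in> module_hom R (grade G n) (P m)"
      by (intro module_hom_plus module_hom_if module_hom_signed_comp module_hom_const_zero module_P d d'
          module_hom_comp[OF d G.transpose_hom])
  qed (simp only: family_cell bd_on_cell[OF km])
next
  fix k n c assume c: "c \<in> carrier (grade G n)"
  note right = G.right_counit_hom[OF dg_module_G counit_hom]
    and left = G.left_counit_hom[OF dg_module_G counit_hom]
  show "right_unitor R G (k + n)
        (tensor_map R G (ground R) (\<lambda>_ c. c) (globular_counit R) (k + n) (\<delta> k n c)) =
      (if k = 0 then c else \<zero>\<^bsub>grade G (k + n)\<^esub>)"
    by (rule counit_of_family[OF c right]) (rule counit_on_cell[OF _ right], simp_all add: right_counit_h)
  show "left_unitor R G (k + n)
        (tensor_map R (ground R) G (globular_counit R) (\<lambda>_ c. c) (k + n) (\<delta> k n c)) =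
      (if k = 0 then c else \<zero>\<^bsub>grade G (k + n)\<^esub>)"
    by (rule counit_of_family[OF c left]) (rule counit_on_cell[OF _ left], simp_all add: left_counit_h)
qed

end

theorem lemma21:
  fixes R :: "('r, 'x) ring_scheme"
    and X :: "nat \<Rightarrow> 'a set"
    and s t i :: "nat \<Rightarrow> 'a \<Rightarrow> 'a"
  assumes "cring R"
    and "globular_set X s t i"
  shows "counital_cosymmetric_coalgebra R (globular_chains R X s t i)
           (globular_coproduct R X s t i) (globular_counit R) \<and>
         (\<forall>k n. \<forall>x\<in>X n.
            globular_coproduct R X s t i (k + n)
              (htensor R (W_res R) (globular_chains R X s t i) k (W_gen R) n (cell R X i n x)) =
            globular_coproduct_on_cell R X s t i k n x) \<and>
         (\<forall>n. \<forall>x\<in>X n. globular_counit R n (cell R X i n x) = (if n = 0 then \<one>\<^bsub>R\<^esub> else \<zero>\<^bsub>R\<^esub>))"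
proof -
  interpret A: globular_chain_complex R X s t i
    using assms by (intro globular_chain_complex.intro)
  interpret F: coproduct_family R "globular_chains R X s t i"
    "globular_coproduct_family R X s t i" "globular_counit R"
    by (rule A.coproduct_family_G)
  have D: "globular_coproduct R X s t i = F.\<Delta>"
    by (simp add: globular_coproduct_def)
  show ?thesis
    unfolding D using F.coalgebra F.coproduct_gen A.cell_closed A.family_cell A.counit_cell by simp
qed

end
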